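(* Let $(\lambda_N)_{N}$ be a sequence of non-trivial conjugacy classes $\lambda_N\subset\mathfrak{S}(N)$ which converges and is evanescent, with limiting data $(\lambda(i))_{i\ge2}$, and for each $N$ let $(S^N_t)_{t\ge 0}$ be a $\lambda_N$-random walk on $\mathfrak{S}(N)$. For $n\ge1$ and $t\ge 0$ let $m_{n^c}(t)=\lim_{N\to\infty}\mathbb{E}\,m_{(1,\dots,n)^c}[S^N_t]$ and let $m_{\infty^c}(t)=1-\sum_{n\ge1}m_{n^c}(t)$. The function $t\mapsto m_{\infty^c}(t)$ is continuous on $[0,\infty)$ and converges to $1$ as $t\to\infty$. Besides, if $$t^\lambda_c=\delta_{\sum_{j\ge2}\lambda(j)=1}\,\frac{1}{\sum_{j=2}^\infty(j-1)\lambda(j)},$$ then $m_{\infty^c}(t)=0$ for any $0\le t\le t^\lambda_c$ and $m_{\infty^c}(t)>0$ for any $t>t^\lambda_c$.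
   Context: Random walks. $\mathfrak{S}(N)$ is the symmetric group. For a permutation $\sigma$, the period of $j$ in $\sigma$ is the smallest $n\ge1$ with $\sigma^n(j)=j$. For a conjugacy class $\lambda_N$ of $\mathfrak{S}(N)$, $\lambda_N(i)$ is the number of $j\in\{1,\dots,N\}$ whose period in $\sigma$ equals $i$ (any $\sigma\in\lambda_N$), and $\lambda_N(1^c)=N-\lambda_N(1)$. Classes are assumed non-trivial: $\lambda_N\neq\{id_N\}$ ($N\ge2$). The $\lambda_N$-random walk $(S^N_t)_{t\ge0}$ is the Markov process on $\mathfrak{S}(N)$ with $S^N_0=id_N$ and generator $$H_Nf(\sigma_0)=\frac{N}{\lambda_N(1^c)}\frac{1}{\#\lambda_N}\sum_{\sigma\in\lambda_N}[f(\sigma\sigma_0)-f(\sigma_0)].$$ The sequence $(\lambda_N)_N$ converges if there are $\lambda(i)\ge0$ ($i\ge2$) with $\sum_{i\ge2}\lambda(i)\le1$ and $\lambda_N(i)/\lambda_N(1^c)\to\lambda(i)$ for every $i\ge2$, and there is $\alpha\in[0,1]$ with $\lambda_N(1)/N\to1-\alpha$. It is evanescent if $\alpha=0$. For $S\in\mathfrak{S}(N)$, $m_{(1,\dots,n)^c}(S)=\frac1N\#\{j\in\{1,\dots,N\}: j\text{ has period }n\text{ in }S\}$, and $\mathbb{E}m_{(1,\dots,n)^c}[S]$ is its expectation for random $S$ (the limit $m_{n^c}(t)$ exists). In the formula for $t^\lambda_c$, $\delta_A$ is $1$ if $A$ holds and $0$ otherwise; $t^\lambda_c=0$ if $\sum_{j\ge2}\lambda(j)\ne1$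 or if $\sum_{j\ge2}(j-1)\lambda(j)=\infty$. *)

theory Defs
  imports "HOL-Probability.Probability" "HOL-Algebra.Sym_Groups"
begin

section \<open>Conjugacy classes of the symmetric group\<close>

definition conjugacy_class :: "('a, 'b) monoid_scheme \<Rightarrow> 'a set \<Rightarrow> bool" where
  "conjugacy_class G C \<longleftrightarrow>
     (\<exists>x\<in>carrier G. C = {g \<otimes>\<^bsub>G\<^esub> x \<otimes>\<^bsub>G\<^esub> inv\<^bsub>G\<^esub> g | g. g \<in> carrier G})"

definition period_count :: "nat \<Rightarrow> (nat \<Rightarrow> nat) \<Rightarrow> nat \<Rightarrow> nat" where
  "period_count N \<sigma> n = card {j \<in> {1..N}. least_power \<sigma> j = n}"

text \<open>\<open>period_count N\<close> is invariant under conjugation, so the choice of the element of the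
  class is immaterial.\<close>

definition class_count :: "nat \<Rightarrow> (nat \<Rightarrow> nat) set \<Rightarrow> nat \<Rightarrow> nat" where
  "class_count N C i = period_count N (SOME \<sigma>. \<sigma> \<in> C) i"

definition class_support :: "nat \<Rightarrow> (nat \<Rightarrow> nat) set \<Rightarrow> nat" where
  "class_support N C = N - class_count N C 1"

definition classes_converge ::
    "(nat \<Rightarrow> (nat \<Rightarrow> nat) set) \<Rightarrow> (nat \<Rightarrow> real) \<Rightarrow> real \<Rightarrow> bool" where
  "classes_converge C l \<alpha> \<longleftrightarrow>
     (\<forall>i\<ge>2. 0 \<le> l i) \<and> l summable_on {2..} \<and> (\<Sum>\<^sub>\<infinity>i\<in>{2..}. l i) \<le> 1 \<and>
     (\<forall>i\<ge>2. (\<lambda>N. real (class_count N (C N) i) / real (class_support N (C N))) \<longlonglongrightarrow> l i) \<and>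
     \<alpha> \<in> {0..1} \<and>
     (\<lambda>N. real (class_count N (C N) 1) / real N) \<longlonglongrightarrow> 1 - \<alpha>"

section \<open>Markov processes on a finite state space\<close>

text \<open>In this section \<open>X\<close> is the finite state space and \<open>p t x\<close> is the law at time \<open>t\<close> of the
  process started at \<open>x\<close>; only \<open>t \<ge> 0\<close> and \<open>x \<in> X\<close> are relevant.\<close>

definition transition_semigroup :: "'s set \<Rightarrow> (real \<Rightarrow> 's \<Rightarrow> 's pmf) \<Rightarrow> bool" where
  "transition_semigroup X p \<longleftrightarrow>
     (\<forall>t\<ge>0. \<forall>x\<in>X. set_pmf (p t x) \<subseteq> X) \<and>
     (\<forall>x\<in>X. p 0 x = return_pmf x) \<and>
     (\<forall>s\<ge>0. \<forall>t\<ge>0. \<forall>x\<in>X. p (s + t) x = bind_pmf (p s x) (p t))"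

definition has_generator ::
    "'s set \<Rightarrow> (real \<Rightarrow> 's \<Rightarrow> 's pmf) \<Rightarrow> (('s \<Rightarrow> real) \<Rightarrow> 's \<Rightarrow> real) \<Rightarrow> bool" where
  "has_generator X p H \<longleftrightarrow>
     (\<forall>f. \<forall>x\<in>X. ((\<lambda>t. (measure_pmf.expectation (p t x) f - f x) / t) \<longlongrightarrow> H f x) (at_right 0))"

definition natural_filtration ::
    "'w measure \<Rightarrow> 's set \<Rightarrow> (real \<Rightarrow> 'w \<Rightarrow> 's) \<Rightarrow> real \<Rightarrow> 'w measure" where
  "natural_filtration M X S s =
     sigma (space M) {S u -` A \<inter> space M | u A. u \<in> {0..s} \<and> A \<subseteq> X}"

definition markov_process ::
    "'w measure \<Rightarrow> 's set \<Rightarrow> (real \<Rightarrow> 'w \<Rightarrow> 's) \<Rightarrow> (real \<Rightarrow> 's \<Rightarrow> 's pmf) \<Rightarrow> bool" where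
  "markov_process M X S p \<longleftrightarrow>
     prob_space M \<and> transition_semigroup X p \<and>
     (\<forall>t\<ge>0. S t \<in> measurable M (count_space X)) \<and>
     (\<forall>s\<ge>0. \<forall>t\<ge>0. \<forall>y\<in>X. AE w in M.
        real_cond_exp M (natural_filtration M X S s)
          (indicat_real {v \<in> space M. S (s + t) v = y}) w = pmf (p t (S s w)) y)"

section \<open>The random walk attached to a conjugacy class\<close>

definition walk_generator ::
    "nat \<Rightarrow> (nat \<Rightarrow> nat) set \<Rightarrow> ((nat \<Rightarrow> nat) \<Rightarrow> real) \<Rightarrow> (nat \<Rightarrow> nat) \<Rightarrow> real" where
  "walk_generator N C f \<sigma>\<^sub>0 =
     real N / real (class_support N C) * (1 / real (card C)) * (\<Sum>\<sigma>\<in>C. f (\<sigma> \<circ> \<sigma>\<^sub>0) - f \<sigma>\<^sub>0)"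

definition class_random_walk ::
    "nat \<Rightarrow> (nat \<Rightarrow> nat) set \<Rightarrow> 'w measure \<Rightarrow> (real \<Rightarrow> 'w \<Rightarrow> nat \<Rightarrow> nat) \<Rightarrow> bool" where
  "class_random_walk N C M S \<longleftrightarrow>
     (\<exists>p. markov_process M (carrier (sym_group N)) S p \<and>
          has_generator (carrier (sym_group N)) p (walk_generator N C)) \<and>
     (AE w in M. S 0 w = id)"

section \<open>Limiting cycle structure\<close>

definition mean_mass ::
    "(nat \<Rightarrow> 'w measure) \<Rightarrow> (nat \<Rightarrow> real \<Rightarrow> 'w \<Rightarrow> nat \<Rightarrow> nat) \<Rightarrow> nat \<Rightarrow> real \<Rightarrow> nat \<Rightarrow> real" where
  "mean_mass M S n t N = (\<integral>w. real (period_count N (S N t w) n) / real N \<partial>M N)"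

definition limit_mass ::
    "(nat \<Rightarrow> 'w measure) \<Rightarrow> (nat \<Rightarrow> real \<Rightarrow> 'w \<Rightarrow> nat \<Rightarrow> nat) \<Rightarrow> nat \<Rightarrow> real \<Rightarrow> real" where
  "limit_mass M S n t = lim (mean_mass M S n t)"

definition infinite_mass ::
    "(nat \<Rightarrow> 'w measure) \<Rightarrow> (nat \<Rightarrow> real \<Rightarrow> 'w \<Rightarrow> nat \<Rightarrow> nat) \<Rightarrow> real \<Rightarrow> real" where
  "infinite_mass M S t = 1 - (\<Sum>\<^sub>\<infinity>n\<in>{1..}. limit_mass M S n t)"

definition critical_time :: "(nat \<Rightarrow> real) \<Rightarrow> real" where
  "critical_time l =
     (if (\<Sum>\<^sub>\<infinity>j\<in>{2..}. l j) = 1 \<and> (\<lambda>j. (real j - 1) * l j) summable_on {2..}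
      then 1 / (\<Sum>\<^sub>\<infinity>j\<in>{2..}. (real j - 1) * l j) else 0)"

end

theory Submission
  imports Defs
begin

text \<open>Write \<open>A\<close> for the number of points moved by the class and
  \<open>\<Phi> z \<sigma> = (\<Sum>j. z ^ per \<sigma> j) / N\<close>. A random element of the class meets a given
  cycle of bounded length at most once up to probability \<open>O(A / N)\<close>, and then merely merges cycles
  with the (asymptotically independent) sizes of the cycles of uniform points. Hence, uniformly in
  the state, the generator maps \<open>\<Phi> z\<close> to \<open>- z \<cdot> \<partial>\<Phi>/\<partial>z \<cdot> (1 - g \<Phi>) + o(1)\<close>
  with \<open>g u = (\<Sum>i\<ge>2. l i * u ^ (i - 1))\<close>, and the square field of \<open>\<Phi> z\<close> is \<open>O(A / N)\<close>. The
  characteristics of this transport equation are \<open>t \<mapsto> h t u = u * exp (t * (1 - g u))\<close>, so Gronwall's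
  inequality for the mean of \<open>(\<Phi> (h t u) - u)\<^sup>2\<close> gives \<open>\<Phi> (h t u) \<rightarrow> u\<close> in mean
  square as long as \<open>h t u < 1\<close>. Thus the limiting masses \<open>m n\<close> exist, satisfy
  \<open>(\<Sum>n. m n * h t u ^ n) = u\<close>, and sum to \<open>q t\<close>, the smallest \<open>u\<close> with \<open>h t u = 1\<close>: the
  extinction probability of a branching process with compound Poisson offspring, which is less
  than 1 exactly when \<open>t\<close> exceeds the critical time.\<close>

section \<open>Cycles of a product of permutations\<close>

text \<open>The rate N / A cancels the factor A / N in the change of \<Phi> at one jump, so the
  generator is an average over moved points of \<open>n * z ^ n\<close> after the jump minus before
  it, shared among the moved points of a common cycle. As z < 1 stays fixed,
  \<open>n * z ^ n\<close> is bounded and small for n > L: only L steps of each cycle have to be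
  explored, and long cycles need no description. The mean of \<Phi> does not obey a closed equation,
  because g \<Phi> is not linear; hence the squared distance to u instead of the mean. Along the
  characteristic this distance starts at 0 and its drift is at most a multiple of itself plus small
  errors, the multiple coming from a Lipschitz bound for g. Concentration and the value of the limit
  thus come together, without a compactness or uniqueness argument for the transport equation. The
  bound on \<open>n * z ^ n\<close> fails at z = 1 and the Lipschitz bound may fail there; so the
  total mass is recovered only at the end, by letting u increase to q t.\<close>

definition cycle_set :: "('a \<Rightarrow> 'a) \<Rightarrow> 'a \<Rightarrow> 'a set" where
  "cycle_set p a = range (\<lambda>k. (p ^^ k) a)"

lemma cycle_set_self: "a \<in> cycle_set p a"
  unfolding cycle_set_def by (metis funpow_0 rangeI)

lemma cycle_set_eq_support:
  assumes "permutation p"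
  shows "cycle_set p a = set (support p a)"
  unfolding cycle_set_def using support_set[OF assms] by metis

lemma card_cycle_set:
  assumes "permutation p"
  shows "card (cycle_set p a) = least_power p a"
proof -
  have "card (set (support p a)) = length (support p a)"
    using cycle_of_permutation[OF assms] by (rule distinct_card)
  then show ?thesis
    by (simp only: cycle_set_eq_support[OF assms]) simp
qed

lemma cycle_set_subset:
  assumes "b \<in> cycle_set p a"
  shows "cycle_set p b \<subseteq> cycle_set p a"
proof
  fix x assume "x \<in> cycle_set p b"
  then obtain i j where "x = (p ^^ i) b" "b = (p ^^ j) a"
    using assms unfolding cycle_set_def by blast
  then have "x = (p ^^ (i + j)) a" by (simp add: funpow_add)
  then show "x \<in> cycle_set p a" unfolding cycle_set_def by blast
qed

lemma cycle_set_sym: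
  assumes "permutation p" "b \<in> cycle_set p a"
  shows "a \<in> cycle_set p b"
proof -
  obtain j where j: "j < least_power p a" "b = (p ^^ j) a"
    using assms cycle_set_eq_support[OF assms(1), of a] by auto
  have "(p ^^ (least_power p a - j)) b = (p ^^ (least_power p a - j + j)) a"
    unfolding j(2) by (subst funpow_add) simp
  also have "\<dots> = a" using j(1) least_power_of_permutation[OF assms(1), of a] by simp
  finally show ?thesis unfolding cycle_set_def by (metis rangeI)
qed

lemma cycle_set_cong:
  assumes "permutation p" "b \<in> cycle_set p a"
  shows "cycle_set p b = cycle_set p a" "least_power p b = least_power p a"
proof -
  show "cycle_set p b = cycle_set p a"
    using cycle_set_subset cycle_set_sym assms by (metis subset_antisym)
  then show "least_power p b = least_power p a"
    using card_cycle_set[OF assms(1)] by metis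
qed

lemma cycle_set_in: "p permutes X \<Longrightarrow> a \<in> X \<Longrightarrow> cycle_set p a \<subseteq> X"
  unfolding cycle_set_def using permutes_funpow permutes_in_image by fastforce

text \<open>Each point j whose cycle meets B splits its term equally among the points of B on that
  cycle. After exchanging the sums, a point a of B collects one share from each of the
  \<open>least_power p a\<close> points of its cycle.\<close>

lemma touched_sum:
  fixes f :: "nat \<Rightarrow> real"
  assumes p: "p permutes X" and fin: "finite X" and B: "B \<subseteq> X"
  shows "(\<Sum>j | j \<in> X \<and> cycle_set p j \<inter> B \<noteq> {}. f (least_power p j)) =
    (\<Sum>a\<in>B. real (least_power p a) * f (least_power p a) / real (card (B \<inter> cycle_set p a)))"
proof -
  have perm: "permutation p" using p fin permutation_permutes by blast
  have finB: "finite B" using B fin finite_subset by blast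
  define h where "h j = f (least_power p j) / real (card (B \<inter> cycle_set p j))" for j
  have hcong: "h b = h a" if "b \<in> cycle_set p a" for a b
    unfolding h_def using cycle_set_cong[OF perm that] by simp
  have "(\<Sum>j | j \<in> X \<and> cycle_set p j \<inter> B \<noteq> {}. f (least_power p j))
    = (\<Sum>j | j \<in> X \<and> cycle_set p j \<inter> B \<noteq> {}. \<Sum>a\<in>B \<inter> cycle_set p j. h j)"
  proof (rule sum.cong)
    fix j assume "j \<in> {j. j \<in> X \<and> cycle_set p j \<inter> B \<noteq> {}}"
    then have "card (B \<inter> cycle_set p j) \<noteq> 0" using finB by auto
    then show "f (least_power p j) = (\<Sum>a\<in>B \<inter> cycle_set p j. h j)"
      unfolding h_def by simp
  qed simp
  also have "\<dots> = (\<Sum>j\<in>X. \<Sum>a\<in>B \<inter> cycle_set p j. h j)"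
    by (rule sum.mono_neutral_left) (auto simp: fin Int_commute)
  also have "\<dots> = (\<Sum>j\<in>X. \<Sum>a\<in>B. if a \<in> cycle_set p j then h j else 0)"
    by (intro sum.cong refl sum.inter_restrict finB)
  also have "\<dots> = (\<Sum>a\<in>B. \<Sum>j\<in>X. if a \<in> cycle_set p j then h j else 0)"
    by (rule sum.swap)
  also have "\<dots> = (\<Sum>a\<in>B. \<Sum>j\<in>X. if j \<in> cycle_set p a then h a else 0)"
    by (intro sum.cong refl) (metis hcong cycle_set_sym perm)
  also have "\<dots> = (\<Sum>a\<in>B. \<Sum>j\<in>cycle_set p a. h a)"
  proof (rule sum.cong[OF refl])
    fix a assume "a \<in> B"
    then have "cycle_set p a = X \<inter> cycle_set p a" using B cycle_set_in[OF p] by blast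
    then show "(\<Sum>j\<in>X. if j \<in> cycle_set p a then h a else 0) = (\<Sum>j\<in>cycle_set p a. h a)"
      using sum.inter_restrict[OF fin, of "\<lambda>_. h a" "cycle_set p a"] by simp
  qed
  also have "\<dots> = (\<Sum>a\<in>B. real (least_power p a) * f (least_power p a) / real (card (B \<inter> cycle_set p a)))"
    by (simp add: card_cycle_set[OF perm] h_def)
  finally show ?thesis .
qed

section \<open>Cycles of a product, seen from the moved points\<close>

definition moved :: "('a \<Rightarrow> 'a) \<Rightarrow> 'a set" where
  "moved s = {x. s x \<noteq> x}"

lemma cycle_set_comp_untouched:
  assumes "cycle_set p j \<inter> moved s = {}"
  shows "((s \<circ> p) ^^ k) j = (p ^^ k) j"
proof (induction k)
  case (Suc k)
  have "(p ^^ Suc k) j \<notin> moved s" using assms unfolding cycle_set_def by blast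
  then show ?case using Suc by (simp add: moved_def)
qed simp

lemma cycle_set_comp_eq:
  assumes "cycle_set p j \<inter> moved s = {}"
  shows "cycle_set (s \<circ> p) j = cycle_set p j" "least_power (s \<circ> p) j = least_power p j"
  using cycle_set_comp_untouched[OF assms] unfolding cycle_set_def least_power_def by auto

text \<open>The inverse of s moves the same points and undoes the composition, so one implication
  yields the other. Hence the touched points before and after a jump form one and the same
  set.\<close>

lemma touched_comp_iff:
  assumes "bij s"
  shows "cycle_set (s \<circ> p) j \<inter> moved s = {} \<longleftrightarrow> cycle_set p j \<inter> moved s = {}"
proof
  assume "cycle_set p j \<inter> moved s = {}"
  then show "cycle_set (s \<circ> p) j \<inter> moved s = {}" using cycle_set_comp_eq(1) by metis
next
  have mi: "moved (inv' s) = moved s"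
    unfolding moved_def using assms by (metis bij_inv_eq_iff)
  have c: "inv' s \<circ> (s \<circ> p) = p" using assms by (simp add: bij_is_inj fun_eq_iff)
  assume "cycle_set (s \<circ> p) j \<inter> moved s = {}"
  then have "cycle_set (inv' s \<circ> (s \<circ> p)) j \<inter> moved s = {}"
    using cycle_set_comp_eq(1)[of "s \<circ> p" j "inv' s"] mi by simp
  then show "cycle_set p j \<inter> moved s = {}" using c by simp
qed

lemma least_power_eqI:
  assumes "(p ^^ n) a = a" "n > 0" "\<And>m. 0 < m \<Longrightarrow> m < n \<Longrightarrow> (p ^^ m) a \<noteq> a"
  shows "least_power p a = n"
  unfolding least_power_def
  by (rule Least_equality) (use assms in \<open>auto simp: not_less[symmetric]\<close>)

lemma funpow_neq_of_less_least_power: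
  assumes "0 < m" "m < least_power p a"
  shows "(p ^^ m) a \<noteq> a"
  using assms least_power_le[of m p a] by auto

lemma cycle_set_lessThan:
  assumes "permutation p"
  shows "cycle_set p a = (\<lambda>k. (p ^^ k) a) ` {..<least_power p a}"
  unfolding cycle_set_eq_support[OF assms] by (auto simp: lessThan_atLeast0)

lemma inj_on_funpow_cycle:
  assumes "permutation p"
  shows "inj_on (\<lambda>k. (p ^^ k) a) {..<least_power p a}"
  using cycle_of_permutation[OF assms, of a] by (simp add: distinct_map lessThan_atLeast0)

text \<open>If the first \<open>L\<close> steps of the \<open>p\<close>-cycles issued from the \<open>s\<close>-cycle of \<open>a\<close> do not meet other
  points moved by \<open>s\<close>, then the \<open>s \<circ> p\<close>-cycle of \<open>a\<close> runs through these \<open>p\<close>-cycles one after the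
  other, entering the \<open>k\<close>-th one at time \<open>T k\<close>.\<close>

lemma merge_cycles:
  fixes s p :: "'a \<Rightarrow> 'a"
  assumes s: "permutation s" and p: "permutation p" and a: "a \<in> moved s"
    and good: "\<And>k m. k \<le> L \<Longrightarrow> 0 < m \<Longrightarrow> m \<le> L \<Longrightarrow> (p ^^ m) ((s ^^ k) a) \<in> moved s \<Longrightarrow>
        (p ^^ m) ((s ^^ k) a) = (s ^^ k) a"
  shows "least_power (s \<circ> p) a = (\<Sum>k<least_power s a. least_power p ((s ^^ k) a)) \<and>
      card (moved s \<inter> cycle_set (s \<circ> p) a) = least_power s a \<or>
    L < least_power (s \<circ> p) a \<and> L < (\<Sum>k<least_power s a. least_power p ((s ^^ k) a))"
proof -
  define T where "T i = (\<Sum>k<i. least_power p ((s ^^ k) a))" for i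
  have sp: "permutation (s \<circ> p)" using s p permutation_compose by blast
  have pos: "0 < least_power p x" for x using least_power_of_permutation[OF p] by blast
  have T0: "T 0 = 0" and TS: "T (Suc i) = T i + least_power p ((s ^^ i) a)" for i
    by (simp_all add: T_def)
  have Tmono: "strict_mono T" by (rule strict_monoI_Suc) (simp add: TS pos)
  have Tge: "k \<le> T k" for k using strict_mono_imp_increasing[OF Tmono] by blast
  \<comment> \<open>The windows from \<open>T k\<close> to \<open>T (Suc k)\<close> are nonempty,
    since \<open>least_power p\<close> is positive, so they cover all times.\<close>
  have ex: "\<exists>k. T k \<le> m \<and> m < T (Suc k)" for m
  proof (induction m)
    case 0 then show ?case using T0 TS pos by (metis add.left_neutral le_refl)
  next
    case (Suc m)
    then obtain k where "T k \<le> m" "m < T (Suc k)" by blast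
    then show ?case
      by (metis Suc_leI TS le_SucI le_neq_implies_less less_add_same_cancel1 pos le_refl)
  qed
  have bm: "(s ^^ k) a \<in> moved s" for k
  proof -
    have "inj s" using s by (simp add: bij_is_inj permutation_bijective)
    then have "inj (s ^^ k)" by (rule inj_fn)
    then show ?thesis using a unfolding moved_def
      by (metis (mono_tags, lifting) funpow_swap1 injD mem_Collect_eq)
  qed
  have main: "\<forall>k. T k \<le> m \<and> m < T (Suc k) \<longrightarrow> ((s \<circ> p) ^^ m) a = (p ^^ (m - T k)) ((s ^^ k) a)"
    if "m \<le> L" for m
    using that
  proof (induction m)
    case 0
    then show ?case using T0 by (metis funpow_0 le_zero_eq diff_zero Tge bot_nat_0.extremum_uniqueI)
  next
    case (Suc m)
    show ?case
    proof (intro allI impI, elim conjE)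
      fix k assume k: "T k \<le> Suc m" "Suc m < T (Suc k)"
      show "((s \<circ> p) ^^ Suc m) a = (p ^^ (Suc m - T k)) ((s ^^ k) a)"
      proof (cases "T k \<le> m")
        case True
        then have "((s \<circ> p) ^^ m) a = (p ^^ (m - T k)) ((s ^^ k) a)"
          using Suc.IH Suc.prems k Suc_leD Suc_lessD by blast
        then have e: "((s \<circ> p) ^^ Suc m) a = s ((p ^^ (Suc m - T k)) ((s ^^ k) a))"
          using True by (simp add: Suc_diff_le)
        \<comment> \<open>Strictly inside a window the \<open>p\<close>-cycle has not closed up; by
          \<open>good\<close> its current point is then not moved, and s fixes it.\<close>
        have "(p ^^ (Suc m - T k)) ((s ^^ k) a) \<noteq> (s ^^ k) a"
          by (rule funpow_neq_of_less_least_power) (use True k TS in auto)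
        then have "(p ^^ (Suc m - T k)) ((s ^^ k) a) \<notin> moved s"
          using good[of k "Suc m - T k"] True Suc.prems Tge[of k]
          by (metis Suc_leD diff_le_self le_trans zero_less_diff le_imp_less_Suc)
        then show ?thesis using e by (simp add: moved_def)
      next
        case False
        \<comment> \<open>Here the step closes the \<open>p\<close>-cycle entered at
          \<open>T k'\<close>, and s jumps from its entry point to the next point of the
          \<open>s\<close>-cycle.\<close>
        then have Tk: "T k = Suc m" using k by simp
        then obtain k' where k': "k = Suc k'" using T0 by (cases k) auto
        have le: "T k' \<le> m" "m < T (Suc k')" using Tk TS[of k'] pos[of "(s ^^ k') a"] k' by auto
        then have "((s \<circ> p) ^^ m) a = (p ^^ (m - T k')) ((s ^^ k') a)"
          using Suc.IH Suc.prems Suc_leD by blast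
        then have "((s \<circ> p) ^^ Suc m) a = s ((p ^^ (Suc (m - T k'))) ((s ^^ k') a))" by simp
        also have "Suc (m - T k') = least_power p ((s ^^ k') a)"
          using Tk TS[of k'] le k' by simp
        also have "(p ^^ \<dots>) ((s ^^ k') a) = (s ^^ k') a"
          using least_power_of_permutation[OF p] by blast
        finally have e: "((s \<circ> p) ^^ Suc m) a = s ((s ^^ k') a)" .
        have "(p ^^ (Suc m - T k)) ((s ^^ k) a) = s ((s ^^ k') a)" using Tk k' by simp
        then show ?thesis using e by (rule trans[OF _ sym, rotated])
      qed
    qed
  qed
  have atT: "((s \<circ> p) ^^ T k) a = (s ^^ k) a" if "T k \<le> L" for k
    using main[OF that] TS[of k] pos[of "(s ^^ k) a"] by auto
  have visit: "\<exists>k. m = T k" if "m \<le> L" "((s \<circ> p) ^^ m) a \<in> moved s" for m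
  proof -
    obtain k where k: "T k \<le> m" "m < T (Suc k)" using ex by blast
    have "m = T k"
    proof (rule ccontr)
      assume "m \<noteq> T k"
      then have "(p ^^ (m - T k)) ((s ^^ k) a) \<noteq> (s ^^ k) a"
        by (intro funpow_neq_of_less_least_power) (use k TS in auto)
      moreover have "(p ^^ (m - T k)) ((s ^^ k) a) \<in> moved s" using main[OF that(1)] k that(2) by simp
      ultimately show False
        using good[of k "m - T k"] k that(1) Tge[of k] \<open>m \<noteq> T k\<close> by auto
    qed
    then show ?thesis by blast
  qed
  let ?i = "least_power s a"
  have ret: "?i dvd k \<and> m = T k" if "m \<le> L" "((s \<circ> p) ^^ m) a = a" "m = T k" for m k
    using atT[of k] that least_power_minimal by metis
  \<comment> \<open>Up to time L, moved points are met only at entry times \<open>T k\<close>, where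
    the orbit is at \<open>(s ^^ k) a\<close>; this is a only when \<open>?i\<close> divides
    k.\<close>
  have noret: "T ?i \<le> m" if m: "0 < m" "m \<le> L" "((s \<circ> p) ^^ m) a = a" for m
  proof -
    obtain k where k: "m = T k" using visit[of m] m a by auto
    then have "?i dvd k" using ret m by blast
    moreover have "k \<noteq> 0" using k m T0 by (metis less_irrefl)
    ultimately have "?i \<le> k" by (simp add: dvd_imp_le)
    then show ?thesis using k Tmono by (simp add: strict_mono_less_eq)
  qed
  have ipos: "0 < ?i" using least_power_of_permutation[OF s] by blast
  show ?thesis
  \<comment> \<open>Beyond time L the orbit is not described. In that case both lengths exceed L,
    and this crude information suffices because \<open>n * z ^ n\<close> is small there.\<close>
  proof (cases "T ?i \<le> L")
    case True
    have per: "least_power (s \<circ> p) a = T ?i"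
    proof (rule least_power_eqI)
      show "((s \<circ> p) ^^ T ?i) a = a"
        using atT[OF True] least_power_of_permutation[OF s, of a] by simp
      show "0 < T ?i" using ipos Tge[of ?i] by linarith
      show "((s \<circ> p) ^^ m) a \<noteq> a" if "0 < m" "m < T ?i" for m
        using noret[of m] that True by auto
    qed
    have "moved s \<inter> cycle_set (s \<circ> p) a = (\<lambda>k. (s ^^ k) a) ` {..<?i}" (is "?A = ?B")
    proof
      show "?A \<subseteq> ?B"
      proof
        fix x assume x: "x \<in> ?A"
        then obtain m where m: "m < T ?i" "x = ((s \<circ> p) ^^ m) a"
          using cycle_set_lessThan[OF sp] per by auto
        then obtain k where k: "m = T k" using visit[of m] True x by auto
        then have "k < ?i" using m Tmono by (simp add: strict_mono_less)
        then show "x \<in> ?B" using k m atT[of k] True by auto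
      qed
      show "?B \<subseteq> ?A"
      proof
        fix x assume "x \<in> ?B"
        then obtain k where k: "k < ?i" "x = (s ^^ k) a" by blast
        then have "T k \<le> L" using Tmono True by (meson less_imp_le order_trans strict_mono_less)
        then have "x \<in> cycle_set (s \<circ> p) a" unfolding cycle_set_def using atT k by (metis rangeI)
        then show "x \<in> ?A" using k bm by blast
      qed
    qed
    then have "card ?A = ?i" using inj_on_funpow_cycle[OF s, of a] by (simp add: card_image)
    then show ?thesis using per unfolding T_def by blast
  next
    case False
    have "L < least_power (s \<circ> p) a"
    proof (rule ccontr)
      assume "\<not> L < least_power (s \<circ> p) a"
      then show False
        using noret[of "least_power (s \<circ> p) a"] least_power_of_permutation[OF sp, of a] False by auto
    qed
    then show ?thesis using False unfolding T_def by simp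
  qed
qed

text \<open>The counterpart of \<open>merge_cycles\<close> for the cycles before the jump: without
  collisions within L steps, the divisor in \<open>touched_sum\<close> is 1.\<close>

lemma lone_point_of_cycle:
  assumes p: "permutation p" and a: "a \<in> B"
    and good: "\<And>m. 0 < m \<Longrightarrow> m \<le> L \<Longrightarrow> (p ^^ m) a \<in> B \<Longrightarrow> (p ^^ m) a = a"
    and le: "least_power p a \<le> L"
  shows "card (B \<inter> cycle_set p a) = 1"
proof -
  have "B \<inter> cycle_set p a = {a}"
  proof (intro equalityI subsetI)
    fix x assume x: "x \<in> B \<inter> cycle_set p a"
    then obtain m where m: "m < least_power p a" "x = (p ^^ m) a"
      using cycle_set_lessThan[OF p] by auto
    then show "x \<in> {a}" using good[of m] x le by (cases "m = 0") auto
  qed (use a cycle_set_self in auto)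
  then show ?thesis by simp
qed

section \<open>Averages over a conjugacy class\<close>

text \<open>Sampling i points without replacement, which is the law of a cycle of length i of a
  random class element. For i > N there is no such list, and division by zero gives 0.\<close>

definition list_mean :: "nat \<Rightarrow> (nat list \<Rightarrow> real) \<Rightarrow> nat \<Rightarrow> real" where
  "list_mean N f i = (\<Sum>xs | length xs = i \<and> distinct xs \<and> set xs \<subseteq> {1..N}. f xs) /
     real (card {xs. length xs = i \<and> distinct xs \<and> set xs \<subseteq> {1..N}})"

lemma finite_distinct_lists:
  "finite A \<Longrightarrow> finite {xs. length xs = i \<and> distinct xs \<and> set xs \<subseteq> A}"
  by (rule finite_subset[OF _ finite_lists_length_eq[of A i]]) auto

text \<open>The permutations act transitively on lists of i distinct points, so the sum does not
  depend on xs; averaging it over all xs produces the mean.\<close>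

lemma sum_permutes_map:
  fixes f :: "nat list \<Rightarrow> real"
  assumes "length xs = i" "distinct xs" "set xs \<subseteq> {1..N}"
  shows "(\<Sum>\<pi> | \<pi> permutes {1..N}. f (map \<pi> xs)) =
    real (card {\<pi>. \<pi> permutes {1..N}}) * list_mean N f i"
proof -
  let ?P = "{\<pi>. \<pi> permutes {1..N}}"
  let ?D = "{xs. length xs = i \<and> distinct xs \<and> set xs \<subseteq> {1..N}}"
  have finD: "finite ?D" by (simp add: finite_distinct_lists)
  have finP: "finite ?P" by (simp add: finite_permutations)
  define G where "G ys = (\<Sum>\<pi>\<in>?P. f (map \<pi> ys))" for ys
  have const: "G ys = G xs" if "ys \<in> ?D" for ys
  proof -
    have "length xs = length ys" using that assms by simp
    have cards: "card (set xs) = card (set ys)" using that assms by (simp add: distinct_card)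
    then have "card ({1..N} - set xs) = card ({1..N} - set ys)"
      using that assms by (simp add: card_Diff_subset)
    then obtain e where e: "bij_betw e ({1..N} - set xs) ({1..N} - set ys)"
      using finite_same_card_bij[of "{1..N} - set xs" "{1..N} - set ys"] by auto
    \<comment> \<open>\<rho> carries xs to ys entry by entry and the complements onto each other
      through e, so it is a permutation, and composing with it turns the sum for ys into the one for
      xs.\<close>
    define \<rho> where "\<rho> x = (if x \<in> set xs then the (map_of (zip xs ys) x) else if x \<in> {1..N} then e x else x)" for x
    have map\<rho>: "map \<rho> xs = ys"
    proof (rule nth_equalityI)
      fix k assume "k < length (map \<rho> xs)"
      then have k: "k < length xs" by simp
      then have "map_of (zip xs ys) (xs ! k) = Some (ys ! k)"
        using \<open>length xs = length ys\<close> assms(2) by (simp add: map_of_zip_nth)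
      then show "map \<rho> xs ! k = ys ! k" using k by (simp add: \<rho>_def)
    qed (use \<open>length xs = length ys\<close> in simp)
    have img: "\<rho> ` set xs = set ys" using map\<rho> by (metis set_map)
    then have "bij_betw \<rho> (set xs) (set ys)"
      using cards eq_card_imp_inj_on[of "set xs" \<rho>] by (simp add: bij_betw_def)
    moreover have "bij_betw \<rho> ({1..N} - set xs) ({1..N} - set ys)"
      using e by (rule bij_betw_cong[THEN iffD1, rotated]) (simp add: \<rho>_def)
    ultimately have "bij_betw \<rho> (set xs \<union> ({1..N} - set xs)) (set ys \<union> ({1..N} - set ys))"
      by (rule bij_betw_combine) auto
    moreover have "set xs \<union> ({1..N} - set xs) = {1..N}" "set ys \<union> ({1..N} - set ys) = {1..N}"
      using that assms by auto
    ultimately have "bij_betw \<rho> {1..N} {1..N}" by simp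
    then have \<rho>: "\<rho> permutes {1..N}"
      by (rule bij_imp_permutes) (use assms(3) in \<open>auto simp: \<rho>_def\<close>)
    have "G ys = (\<Sum>\<pi>\<in>?P. f (map (\<pi> \<circ> \<rho>) xs))"
      unfolding G_def map\<rho>[symmetric] by (simp add: comp_assoc)
    also have "\<dots> = G xs"
      unfolding G_def
      by (rule sum.reindex_bij_witness[where i = "\<lambda>\<pi>. \<pi> \<circ> inv' \<rho>" and j = "\<lambda>\<pi>. \<pi> \<circ> \<rho>"])
        (use \<rho> in \<open>auto intro: permutes_compose permutes_inv simp: comp_assoc permutes_inv_o\<close>)
    finally show ?thesis .
  qed
  have xs: "xs \<in> ?D" using assms by simp
  then have "0 < card ?D" using finD card_gt_0_iff by blast
  have "real (card ?D) * G xs = (\<Sum>ys\<in>?D. G ys)" using const by simp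
  also have "\<dots> = (\<Sum>\<pi>\<in>?P. \<Sum>ys\<in>?D. f (map \<pi> ys))"
    unfolding G_def by (rule sum.swap)
  also have "\<dots> = (\<Sum>\<pi>\<in>?P. \<Sum>ys\<in>?D. f ys)"
  proof (rule sum.cong[OF refl])
    fix \<pi> assume "\<pi> \<in> ?P"
    then have \<pi>: "\<pi> permutes {1..N}" by simp
    then have i: "inv' \<pi> permutes {1..N}" by (rule permutes_inv)
    have cl: "map \<tau> ys \<in> ?D" if "\<tau> permutes {1..N}" "ys \<in> ?D" for \<tau> ys
    proof -
      have "inj \<tau>" using that(1) permutes_inj by blast
      then have "distinct (map \<tau> ys)" using that(2) by (auto simp: distinct_map intro: inj_on_subset)
      moreover have "set (map \<tau> ys) \<subseteq> {1..N}"
        using that permutes_in_image[OF that(1)] by (auto simp del: atLeastAtMost_iff)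
      ultimately show ?thesis using that(2) by simp
    qed
    show "(\<Sum>ys\<in>?D. f (map \<pi> ys)) = (\<Sum>ys\<in>?D. f ys)"
      by (rule sum.reindex_bij_witness[where i = "map (inv' \<pi>)" and j = "map \<pi>"])
        (use cl[OF \<pi>] cl[OF i] \<pi> in \<open>simp_all add: permutes_inv_o\<close>)
  qed
  also have "\<dots> = real (card ?P) * (\<Sum>ys\<in>?D. f ys)" by simp
  finally have "G xs = real (card ?P) * list_mean N f i"
    using \<open>0 < card ?D\<close> unfolding list_mean_def by (simp add: field_simps)
  then show ?thesis by (simp add: G_def)
qed

text \<open>Among i independent draws, the next one hits an earlier point with probability i / N;
  the induction closes because \<open>i\<^sup>2 + i\<close> is at most
  \<open>(i + 1)\<^sup>2\<close>.\<close>

lemma card_distinct_lists_ge: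
  assumes "i \<le> N" "N > 0"
  shows "1 - (real i)\<^sup>2 / real N \<le>
    real (card {xs. length xs = i \<and> distinct xs \<and> set xs \<subseteq> {1..N}}) / real N ^ i"
proof -
  let ?d = "\<lambda>i. card {xs. length xs = i \<and> distinct xs \<and> set xs \<subseteq> {1..N}}"
  have d: "?d i = \<Prod>{N - i + 1..N}" if "i \<le> N" for i
    using card_lists_distinct_length_eq[of "{1..N}" i] that by simp
  have le1: "real (?d i) / real N ^ i \<le> 1" for i
  proof -
    have "?d i \<le> card {xs. set xs \<subseteq> {1..N} \<and> length xs = i}"
      by (rule card_mono) (auto simp: finite_lists_length_eq)
    also have "\<dots> = N ^ i" by (simp add: card_lists_length_eq)
    finally have "real (?d i) \<le> real N ^ i" by (metis of_nat_le_iff of_nat_power)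
    then show ?thesis using assms(2) by simp
  qed
  show ?thesis using assms(1)
  proof (induction i)
    case 0
    have "{xs. length xs = 0 \<and> distinct xs \<and> set xs \<subseteq> {1..N}} = {[]}" by auto
    then show ?case by simp
  next
    case (Suc i)
    have "{N - Suc i + 1..N} = insert (N - i) {N - i + 1..N}" using Suc.prems by auto
    then have "?d (Suc i) = (N - i) * ?d i"
      using d[of "Suc i"] d[of i] Suc.prems by simp
    then have "real (?d (Suc i)) = (real N - real i) * real (?d i)"
      using Suc.prems by (simp only: of_nat_mult of_nat_diff[OF Suc_leD[OF Suc.prems]])
    moreover have "1 - real i / real N = (real N - real i) / real N"
      using assms(2) by (simp add: field_simps)
    ultimately have eq: "real (?d (Suc i)) / real N ^ Suc i = (1 - real i / real N) * (real (?d i) / real N ^ i)"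
      by (simp only: power_Suc times_divide_times_eq)
    have ld: "(1 - x) * y = y - x * y" for x y :: real by (simp add: algebra_simps)
    note eq
    also have "(1 - real i / real N) * (real (?d i) / real N ^ i) =
        real (?d i) / real N ^ i - real i / real N * (real (?d i) / real N ^ i)"
      by (rule ld)
    also have "\<dots> \<ge> (1 - (real i)\<^sup>2 / real N) - real i / real N * 1"
      using Suc le1[of i] by (intro diff_mono mult_left_mono) auto
    finally have "1 - (real i)\<^sup>2 / real N - real i / real N \<le> real (?d (Suc i)) / real N ^ Suc i"
      by simp
    moreover have "((real i)\<^sup>2 + real i) / real N \<le> (real (Suc i))\<^sup>2 / real N"
      by (intro divide_right_mono) (auto simp: power2_eq_square algebra_simps)
    ultimately show ?case by (simp add: add_divide_distrib)
  qed
qed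

text \<open>Passing from distinct lists to all lists has two effects: a larger normalisation and
  additional terms. Each lies between 0 and c times the proportion of lists with a repetition, and
  they have opposite signs, so the bound does not double.\<close>

lemma list_mean_approx:
  assumes i: "i \<le> N" "N > 0" and f: "\<And>xs. 0 \<le> f xs" "\<And>xs. f xs \<le> c"
  shows "\<bar>list_mean N f i - (\<Sum>xs | set xs \<subseteq> {1..N} \<and> length xs = i. f xs) / real N ^ i\<bar>
    \<le> c * (real i)\<^sup>2 / real N"
proof -
  let ?D = "{xs. length xs = i \<and> distinct xs \<and> set xs \<subseteq> {1..N}}"
  let ?E = "{xs. set xs \<subseteq> {1..N} \<and> length xs = i}"
  have finE: "finite ?E" by (simp add: finite_lists_length_eq)
  have sub: "?D \<subseteq> ?E" by auto
  have cE: "real (card ?E) = real N ^ i" by (simp add: card_lists_length_eq)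
  define d where "d = real (card ?D)"
  define n where "n = real N ^ i"
  have npos: "n > 0" using i by (simp add: n_def)
  have c: "0 \<le> c" using f[of "[]"] by simp
  have "\<Prod>{N - i + 1..N} > (0::nat)" by (rule prod_pos) auto
  moreover have "card ?D = \<Prod>{N - i + 1..N}"
    using card_lists_distinct_length_eq[of "{1..N}" i] i by simp
  ultimately have "0 < card ?D" by linarith
  then have dpos: "d > 0" by (simp add: d_def)
  define s where "s = sum f ?D"
  define s' where "s' = sum f (?E - ?D)"
  have tot: "sum f ?E = s + s'"
    unfolding s_def s'_def using sum.subset_diff[OF sub finE, of f] by simp
  have s0: "0 \<le> s" "0 \<le> s'" unfolding s_def s'_def by (auto intro!: sum_nonneg f)
  have s1: "s \<le> c * d" unfolding s_def d_def using sum_bounded_above[of ?D f c] f(2) by (simp add: mult.commute)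
  have "real (card (?E - ?D)) = n - d"
    unfolding n_def d_def cE[symmetric]
    using card_mono[OF finE sub] finite_subset[OF sub finE] sub by (simp add: card_Diff_subset of_nat_diff)
  then have s2: "s' \<le> c * (n - d)"
    unfolding s'_def using sum_bounded_above[of "?E - ?D" f c] f(2) by (simp add: mult.commute)
  have dn: "d \<le> n" unfolding n_def d_def cE[symmetric] using card_mono[OF finE sub] by simp
  have "s / d - s / n = s * (n - d) / (d * n)" using dpos npos by (simp add: field_simps)
  also have "\<dots> \<le> c * d * (n - d) / (d * n)"
    using s1 dn dpos npos by (intro divide_right_mono mult_right_mono) auto
  also have "\<dots> = c * (n - d) / n" using dpos npos by simp
  finally have u1: "s / d - s / n \<le> c * (n - d) / n" .
  have u2: "0 \<le> s / d - s / n" using s0 dn dpos npos by (simp add: frac_le)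
  have u3: "s' / n \<le> c * (n - d) / n" "0 \<le> s' / n" using s2 s0 npos by (auto intro: divide_right_mono)
  have eq: "list_mean N f i - sum f ?E / real N ^ i = (s / d - s / n) - s' / n"
    unfolding tot by (simp add: list_mean_def s_def d_def n_def add_divide_distrib)
  have "\<bar>list_mean N f i - sum f ?E / real N ^ i\<bar> \<le> c * (n - d) / n"
    unfolding eq using u1 u2 u3 by linarith
  also have "\<dots> = c * (1 - d / n)" using npos by (simp add: field_simps)
  also have "\<dots> \<le> c * ((real i)\<^sup>2 / real N)"
    using card_distinct_lists_ge[OF i] c by (intro mult_left_mono) (auto simp: d_def n_def)
  finally show ?thesis by simp
qed

text \<open>The entries are chosen independently, whence the i-th power; the second identity is z
  times the z-derivative of the first. At i = 0 the factor i absorbs the truncated exponent i -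
  1.\<close>

lemma sum_lists_power:
  fixes z :: real and w :: "nat \<Rightarrow> nat"
  assumes "finite X"
  shows "(\<Sum>xs | set xs \<subseteq> X \<and> length xs = i. z ^ sum_list (map w xs)) = (\<Sum>x\<in>X. z ^ w x) ^ i"
    and "(\<Sum>xs | set xs \<subseteq> X \<and> length xs = i. real (sum_list (map w xs)) * z ^ sum_list (map w xs)) =
      real i * (\<Sum>x\<in>X. real (w x) * z ^ w x) * (\<Sum>x\<in>X. z ^ w x) ^ (i - 1)"
proof (induction i)
  case 0
  have e: "{xs. set xs \<subseteq> X \<and> length xs = 0} = {[]}" by auto
  case 1 show ?case unfolding e by simp
  case 2 show ?case unfolding e by simp
next
  case (Suc i)
  let ?E = "{xs. set xs \<subseteq> X \<and> length xs = i}"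
  have red: "(\<Sum>xs | set xs \<subseteq> X \<and> length xs = Suc i. h xs) = (\<Sum>xs\<in>?E. \<Sum>x\<in>X. h (x # xs))"
    for h :: "nat list \<Rightarrow> real"
    unfolding lists_length_Suc_eq
    by (subst sum.reindex) (auto simp: inj_on_def sum.cartesian_product split_def)
  case 1
  show ?case unfolding red
    by (simp add: power_add Suc.IH(1) flip: sum_distrib_left sum_distrib_right)
  case 2
  let ?s = "\<lambda>xs. sum_list (map w xs)"
  have "(\<Sum>xs | set xs \<subseteq> X \<and> length xs = Suc i. real (?s xs) * z ^ ?s xs) =
    (\<Sum>xs\<in>?E. \<Sum>x\<in>X. (real (w x) * z ^ w x) * z ^ ?s xs + z ^ w x * (real (?s xs) * z ^ ?s xs))"
    unfolding red by (simp add: power_add algebra_simps)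
  also have "\<dots> = (\<Sum>x\<in>X. real (w x) * z ^ w x) * (\<Sum>xs\<in>?E. z ^ ?s xs) +
      (\<Sum>x\<in>X. z ^ w x) * (\<Sum>xs\<in>?E. real (?s xs) * z ^ ?s xs)"
    by (simp add: sum.distrib sum_distrib_left sum_distrib_right sum_product sum.swap[of _ X])
  also have "\<dots> = (\<Sum>x\<in>X. real (w x) * z ^ w x) * (\<Sum>x\<in>X. z ^ w x) ^ i + (\<Sum>x\<in>X. z ^ w x) *
      (real i * (\<Sum>x\<in>X. real (w x) * z ^ w x) * (\<Sum>x\<in>X. z ^ w x) ^ (i - 1))"
    by (simp only: Suc.IH)
  also have "\<dots> = real (Suc i) * (\<Sum>x\<in>X. real (w x) * z ^ w x) * (\<Sum>x\<in>X. z ^ w x) ^ (Suc i - 1)"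
    by (cases i) (simp_all add: algebra_simps)
  finally show ?case .
qed

section \<open>Conjugation and the counts attached to one class\<close>

lemma funpow_conj:
  assumes "bij \<pi>"
  shows "((\<pi> \<circ> s \<circ> inv' \<pi>) ^^ k) (\<pi> a) = \<pi> ((s ^^ k) a)"
  by (induction k) (use assms in \<open>simp_all add: bij_is_inj\<close>)

lemma least_power_conj:
  assumes "bij \<pi>"
  shows "least_power (\<pi> \<circ> s \<circ> inv' \<pi>) (\<pi> a) = least_power s a"
  unfolding least_power_def funpow_conj[OF assms]
  using assms by (simp add: bij_is_inj inj_eq)

lemma moved_conj:
  assumes "bij \<pi>"
  shows "moved (\<pi> \<circ> s \<circ> inv' \<pi>) = \<pi> ` moved s"
proof (intro equalityI subsetI)
  fix x assume "x \<in> moved (\<pi> \<circ> s \<circ> inv' \<pi>)"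
  then have "\<pi> (s (inv' \<pi> x)) \<noteq> x" by (simp add: moved_def)
  then have "inv' \<pi> x \<in> moved s" using assms by (auto simp: moved_def bij_is_surj surj_f_inv_f)
  then show "x \<in> \<pi> ` moved s" using assms by (metis bij_inv_eq_iff image_eqI)
next
  fix x assume "x \<in> \<pi> ` moved s"
  then show "x \<in> moved (\<pi> \<circ> s \<circ> inv' \<pi>)"
    using assms by (auto simp: moved_def bij_is_inj inj_eq)
qed

locale nontrivial_class =
  fixes N :: nat and K :: "(nat \<Rightarrow> nat) set"
  assumes N: "2 \<le> N"
    and conjugacy: "conjugacy_class (sym_group N) K"
    and nontrivial: "K \<noteq> {id}"
begin

lemma class_eq:
  obtains x where "x permutes {1..N}" "K = {\<pi> \<circ> x \<circ> inv' \<pi> | \<pi>. \<pi> permutes {1..N}}"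
proof -
  obtain x where x: "x \<in> carrier (sym_group N)"
    "K = {g \<otimes>\<^bsub>sym_group N\<^esub> x \<otimes>\<^bsub>sym_group N\<^esub> inv\<^bsub>sym_group N\<^esub> g | g. g \<in> carrier (sym_group N)}"
    using conjugacy unfolding conjugacy_class_def by blast
  have "K = {\<pi> \<circ> x \<circ> inv' \<pi> | \<pi>. \<pi> permutes {1..N}}"
    unfolding x(2) by (rule Collect_cong) (metis sym_group_carrier sym_group_inv_equality sym_group_mult)
  then show ?thesis using that x(1) by (simp add: sym_group_carrier)
qed

lemma class_permutes: "s \<in> K \<Longrightarrow> s permutes {1..N}"
  by (rule class_eq) (auto intro!: permutes_compose permutes_inv)

lemma class_permutation: "s \<in> K \<Longrightarrow> permutation s"
  using class_permutes permutation_permutes by blast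

lemma finite_class: "finite K"
  using class_permutes by (intro finite_subset[OF _ finite_permutations[of "{1..N}"]]) auto

lemma class_nonempty: "K \<noteq> {}"
  by (rule class_eq) (use permutes_id in auto)

lemma card_class_pos: "0 < card K"
  using finite_class class_nonempty by (simp add: card_gt_0_iff)

lemma class_conj:
  assumes "s \<in> K" "\<pi> permutes {1..N}"
  shows "\<pi> \<circ> s \<circ> inv' \<pi> \<in> K"
proof -
  obtain x where x: "K = {\<pi> \<circ> x \<circ> inv' \<pi> | \<pi>. \<pi> permutes {1..N}}" using class_eq by blast
  then obtain \<rho> where \<rho>: "\<rho> permutes {1..N}" "s = \<rho> \<circ> x \<circ> inv' \<rho>" using assms by blast
  have "inv' (\<pi> \<circ> \<rho>) = inv' \<rho> \<circ> inv' \<pi>"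
    using assms(2) \<rho>(1) by (simp add: o_inv_distrib permutes_bij)
  then have "\<pi> \<circ> s \<circ> inv' \<pi> = (\<pi> \<circ> \<rho>) \<circ> x \<circ> inv' (\<pi> \<circ> \<rho>)" using \<rho> by (simp add: comp_assoc)
  then show ?thesis using x \<rho>(1) assms(2) permutes_compose by blast
qed

text \<open>Conjugation only relabels the cycles, so the choice hidden in \<open>class_count\<close>
  can be replaced by any element at hand.\<close>

lemma period_count_class:
  assumes "s \<in> K"
  shows "period_count N s i = class_count N K i"
proof -
  obtain x where x: "K = {\<pi> \<circ> x \<circ> inv' \<pi> | \<pi>. \<pi> permutes {1..N}}" using class_eq by blast
  have "period_count N t i = period_count N x i" if t: "t \<in> K" for t
  proof -
    obtain \<rho> where \<rho>: "\<rho> permutes {1..N}" "t = \<rho> \<circ> x \<circ> inv' \<rho>" using t unfolding x by blast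
    have b: "bij \<rho>" using \<rho>(1) permutes_bij by blast
    have "{j \<in> {1..N}. least_power t j = i} = \<rho> ` {j \<in> {1..N}. least_power x j = i}"
    proof (intro equalityI subsetI)
      fix j assume j: "j \<in> {j \<in> {1..N}. least_power t j = i}"
      then have "inv' \<rho> j \<in> {1..N}" using permutes_in_image[OF permutes_inv[OF \<rho>(1)]] by blast
      moreover have "j = \<rho> (inv' \<rho> j)" using b by (simp add: bij_is_surj surj_f_inv_f)
      ultimately show "j \<in> \<rho> ` {j \<in> {1..N}. least_power x j = i}"
        using j least_power_conj[OF b, of x "inv' \<rho> j"] \<rho>(2) by (intro image_eqI) auto
    next
      fix j assume "j \<in> \<rho> ` {j \<in> {1..N}. least_power x j = i}"
      then show "j \<in> {j \<in> {1..N}. least_power t j = i}"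
        using least_power_conj[OF b, of x] \<rho>(2) permutes_in_image[OF \<rho>(1)] by auto
    qed
    moreover have "inj_on \<rho> {j \<in> {1..N}. least_power x j = i}"
      using b bij_is_inj inj_on_subset by blast
    ultimately show ?thesis unfolding period_count_def by (simp only: card_image)
  qed
  then show ?thesis unfolding class_count_def using assms by (metis someI)
qed

lemma moved_subset: "s \<in> K \<Longrightarrow> moved s \<subseteq> {1..N}"
  using class_permutes unfolding moved_def permutes_def by blast

lemma finite_moved: "s \<in> K \<Longrightarrow> finite (moved s)"
  using moved_subset finite_subset by blast

lemma least_power_1_iff:
  assumes "s \<in> K"
  shows "least_power s a = 1 \<longleftrightarrow> a \<notin> moved s"
  using least_power_dvd[OF class_permutation[OF assms], of a 1]
  by (simp add: moved_def)

lemma card_moved: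
  assumes "s \<in> K"
  shows "card (moved s) = class_support N K"
proof -
  have "{j \<in> {1..N}. least_power s j = 1} = {1..N} - moved s"
    using least_power_1_iff[OF assms] by auto
  then have "class_count N K 1 = N - card (moved s)"
    unfolding period_count_class[OF assms, symmetric] period_count_def
    using moved_subset[OF assms] finite_moved[OF assms] by (simp add: card_Diff_subset)
  moreover have "card (moved s) \<le> N"
    using card_mono[OF _ moved_subset[OF assms]] by simp
  ultimately show ?thesis unfolding class_support_def by simp
qed

lemma class_support_le: "class_support N K \<le> N"
  unfolding class_support_def by simp

lemma class_support_pos: "0 < class_support N K"
proof (rule ccontr)
  assume "\<not> 0 < class_support N K"
  then have "moved s = {}" if "s \<in> K" for s
    using card_moved[OF that] finite_moved[OF that] by simp
  then have "s = id" if "s \<in> K" for s using that by (fastforce simp: moved_def)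
  then show False using nontrivial class_nonempty by blast
qed

lemma card_moved_period:
  assumes "s \<in> K" "2 \<le> i"
  shows "card {a \<in> moved s. least_power s a = i} = class_count N K i"
proof -
  have "{a \<in> moved s. least_power s a = i} = {j \<in> {1..N}. least_power s j = i}"
    using moved_subset[OF assms(1)] least_power_1_iff[OF assms(1)] assms(2) by force
  then show ?thesis
    using period_count_class[OF assms(1)] unfolding period_count_def by simp
qed

lemma least_power_moved:
  assumes "s \<in> K" "a \<in> moved s"
  shows "least_power s a \<in> {2..N}"
proof -
  have "least_power s a = card (cycle_set s a)"
    using card_cycle_set[OF class_permutation[OF assms(1)]] by simp
  also have "\<dots> \<le> card {1..N}"
    using cycle_set_in[OF class_permutes[OF assms(1)], of a] moved_subset[OF assms(1)] assms(2)
    by (intro card_mono finite_atLeastAtMost) blast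
  finally show ?thesis
    using least_power_gt_one[OF class_permutation[OF assms(1)], of a] assms(2) by (simp add: moved_def)
qed

lemma sum_moved_period:
  fixes h :: "nat \<Rightarrow> real"
  assumes "s \<in> K"
  shows "(\<Sum>a\<in>moved s. h (least_power s a)) = (\<Sum>i=2..N. real (class_count N K i) * h i)"
proof -
  have "(\<Sum>a\<in>moved s. h (least_power s a)) =
      (\<Sum>i\<in>{2..N}. \<Sum>a | a \<in> moved s \<and> least_power s a = i. h (least_power s a))"
    by (rule sum.group[symmetric]) (use finite_moved[OF assms] least_power_moved[OF assms] in auto)
  also have "\<dots> = (\<Sum>i=2..N. real (class_count N K i) * h i)"
    by (intro sum.cong refl) (simp add: card_moved_period[OF assms, symmetric])
  finally show ?thesis .
qed

lemma sum_class_count: "(\<Sum>i=2..N. class_count N K i) = class_support N K"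
proof -
  obtain s where s: "s \<in> K" using class_nonempty by blast
  have "real (\<Sum>i=2..N. class_count N K i) = real (class_support N K)"
    using sum_moved_period[OF s, of "\<lambda>_. 1"] card_moved[OF s] by simp
  then show ?thesis by (simp only: of_nat_eq_iff)
qed

section \<open>Averages of equivariant data over the class\<close>

lemma sum_class_conj:
  fixes h :: "(nat \<Rightarrow> nat) \<Rightarrow> real"
  assumes "\<pi> permutes {1..N}"
  shows "(\<Sum>s\<in>K. h (\<pi> \<circ> s \<circ> inv' \<pi>)) = (\<Sum>s\<in>K. h s)"
proof (rule sum.reindex_bij_witness[where j = "\<lambda>s. \<pi> \<circ> s \<circ> inv' \<pi>" and i = "\<lambda>s. inv' \<pi> \<circ> s \<circ> \<pi>"])
  fix s assume s: "s \<in> K"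
  have c: "\<pi> \<circ> inv' \<pi> = id" "inv' \<pi> \<circ> \<pi> = id" using assms by (simp_all add: permutes_inv_o)
  show "inv' \<pi> \<circ> (\<pi> \<circ> s \<circ> inv' \<pi>) \<circ> \<pi> = s"
    by (metis c comp_assoc comp_id id_comp)
  show "\<pi> \<circ> (inv' \<pi> \<circ> s \<circ> \<pi>) \<circ> inv' \<pi> = s"
    by (metis c comp_assoc comp_id id_comp)
  show "\<pi> \<circ> s \<circ> inv' \<pi> \<in> K" using class_conj[OF s assms] .
  have "inv' (inv' \<pi>) = \<pi>" using assms permutes_inv_inv by blast
  then show "inv' \<pi> \<circ> s \<circ> \<pi> \<in> K" using class_conj[OF s permutes_inv[OF assms]] by simp
qed simp

text \<open>The class is stable under conjugation, so one may average over the conjugating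
  permutation. By equivariance it then acts on the lists themselves, and
  \<open>sum_permutes_map\<close> makes each of them uniform given its length.\<close>

lemma sum_class_equivariant:
  fixes V :: "(nat \<Rightarrow> nat) \<Rightarrow> nat list set"
  assumes fin: "\<And>s. s \<in> K \<Longrightarrow> finite (V s)"
    and V: "\<And>s xs. s \<in> K \<Longrightarrow> xs \<in> V s \<Longrightarrow> distinct xs \<and> set xs \<subseteq> {1..N}"
    and equi: "\<And>s \<pi>. s \<in> K \<Longrightarrow> \<pi> permutes {1..N} \<Longrightarrow> V (\<pi> \<circ> s \<circ> inv' \<pi>) = map \<pi> ` V s"
  shows "(\<Sum>s\<in>K. \<Sum>xs\<in>V s. f xs) = (\<Sum>s\<in>K. \<Sum>xs\<in>V s. list_mean N f (length xs))"
proof -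
  let ?P = "{\<pi>. \<pi> permutes {1..N}}"
  have "finite ?P" by (simp add: finite_permutations)
  then have cP: "0 < card ?P" using permutes_id card_gt_0_iff by blast
  have "real (card ?P) * (\<Sum>s\<in>K. \<Sum>xs\<in>V s. f xs) = (\<Sum>\<pi>\<in>?P. \<Sum>s\<in>K. \<Sum>xs\<in>V s. f xs)"
    by simp
  also have "\<dots> = (\<Sum>\<pi>\<in>?P. \<Sum>s\<in>K. \<Sum>xs\<in>V (\<pi> \<circ> s \<circ> inv' \<pi>). f xs)"
    by (rule sum.cong[OF refl], rule sum_class_conj[where h = "\<lambda>s. \<Sum>xs\<in>V s. f xs", symmetric]) simp
  also have "\<dots> = (\<Sum>\<pi>\<in>?P. \<Sum>s\<in>K. \<Sum>xs\<in>V s. f (map \<pi> xs))"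
  proof (rule sum.cong[OF refl], rule sum.cong[OF refl])
    fix \<pi> s assume ps: "\<pi> \<in> ?P" "s \<in> K"
    then have "inj (map \<pi>)" using permutes_inj by auto
    then have "inj_on (map \<pi>) (V s)" using inj_on_subset by blast
    then show "(\<Sum>xs\<in>V (\<pi> \<circ> s \<circ> inv' \<pi>). f xs) = (\<Sum>xs\<in>V s. f (map \<pi> xs))"
      using ps equi[of s \<pi>] by (simp add: sum.reindex)
  qed
  also have "\<dots> = (\<Sum>s\<in>K. \<Sum>\<pi>\<in>?P. \<Sum>xs\<in>V s. f (map \<pi> xs))" by (rule sum.swap)
  also have "\<dots> = (\<Sum>s\<in>K. \<Sum>xs\<in>V s. \<Sum>\<pi>\<in>?P. f (map \<pi> xs))"
    by (intro sum.cong refl sum.swap)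
  also have "\<dots> = (\<Sum>s\<in>K. \<Sum>xs\<in>V s. real (card ?P) * list_mean N f (length xs))"
    by (intro sum.cong refl sum_permutes_map) (use V in auto)
  also have "\<dots> = real (card ?P) * (\<Sum>s\<in>K. \<Sum>xs\<in>V s. list_mean N f (length xs))"
    by (simp add: sum_distrib_left)
  finally show ?thesis using cP by simp
qed

lemma sum_moved_point:
  fixes h :: "nat \<Rightarrow> real"
  shows "(\<Sum>s\<in>K. \<Sum>a\<in>moved s. h a) =
    real (card K) * real (class_support N K) * ((\<Sum>j=1..N. h j) / real N)"
proof -
  have e: "{xs. length xs = 1 \<and> distinct xs \<and> set xs \<subseteq> {1..N}} = (\<lambda>a. [a]) ` {1..N}"
    by (auto simp: length_Suc_conv)
  have lm: "list_mean N (\<lambda>xs. h (hd xs)) 1 = (\<Sum>j=1..N. h j) / real N"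
    unfolding list_mean_def e by (simp add: sum.reindex card_image inj_on_def)
  have "(\<Sum>s\<in>K. \<Sum>a\<in>moved s. h a) = (\<Sum>s\<in>K. \<Sum>xs\<in>(\<lambda>a. [a]) ` moved s. h (hd xs))"
    by (simp add: sum.reindex inj_on_def)
  also have "\<dots> = (\<Sum>s\<in>K. \<Sum>xs\<in>(\<lambda>a. [a]) ` moved s. list_mean N (\<lambda>xs. h (hd xs)) (length xs))"
  proof (rule sum_class_equivariant)
    fix s \<pi> assume "s \<in> K" "\<pi> permutes {1..N}"
    then show "(\<lambda>a. [a]) ` moved (\<pi> \<circ> s \<circ> inv' \<pi>) = map \<pi> ` (\<lambda>a. [a]) ` moved s"
      by (simp only: moved_conj[OF permutes_bij] image_image list.map)
  qed (use moved_subset finite_moved in \<open>fastforce+\<close>)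
  also have "\<dots> = (\<Sum>s\<in>K. \<Sum>a\<in>moved s. (\<Sum>j=1..N. h j) / real N)"
    unfolding lm[symmetric] by (simp add: sum.reindex inj_on_def)
  also have "\<dots> = real (card K) * real (class_support N K) * ((\<Sum>j=1..N. h j) / real N)"
    by (simp add: card_moved)
  finally show ?thesis .
qed

text \<open>A uniform ordered pair of distinct points has the form (b, q b) with probability at most
  1 / (N - 1), because b determines its partner. There are A * (A - 1) pairs of moved points, and (A
  - 1) / (N - 1) is at most A / N.\<close>

lemma sum_moved_pair:
  fixes q :: "nat \<Rightarrow> nat"
  shows "(\<Sum>s\<in>K. \<Sum>b\<in>moved s. of_bool (q b \<in> moved s \<and> q b \<noteq> b)) \<le>
    real (card K) * real (class_support N K) * (real (class_support N K) / real N)"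
proof -
  let ?A = "real (class_support N K)"
  define f :: "nat list \<Rightarrow> real" where "f xs = of_bool (q (hd xs) = last xs)" for xs
  define V where "V s = (\<lambda>(a, b). [a, b]) ` {(a, b). a \<in> moved s \<and> b \<in> moved s \<and> a \<noteq> b}"
    for s :: "nat \<Rightarrow> nat"
  have pairs: "{(a, b). a \<in> B \<and> b \<in> B \<and> a \<noteq> b} = (SIGMA a:B. B - {a})" for B :: "nat set" by auto
  have sig: "(\<Sum>a\<in>B. \<Sum>b\<in>B - {a}. g a b) = (\<Sum>x\<in>(SIGMA a:B. B - {a}). case x of (a, b) \<Rightarrow> g a b)"
    if "finite B" for B :: "nat set" and g :: "nat \<Rightarrow> nat \<Rightarrow> real"
    using that by (simp add: sum.Sigma)
  have cpairs: "real (card {(a, b). a \<in> B \<and> b \<in> B \<and> a \<noteq> b}) = real (card B) * (real (card B) - 1)"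
    if "finite B" for B :: "nat set"
  proof -
    have "card {(a, b). a \<in> B \<and> b \<in> B \<and> a \<noteq> b} = card B * (card B - 1)"
      unfolding pairs using that by simp
    then show ?thesis by (cases "card B") (simp_all add: algebra_simps)
  qed
  have e: "{xs. length xs = 2 \<and> distinct xs \<and> set xs \<subseteq> {1..N}} =
      (\<lambda>(a, b). [a, b]) ` {(a, b). a \<in> {1..N} \<and> b \<in> {1..N} \<and> a \<noteq> b}"
    by (auto simp: length_Suc_conv numeral_2_eq_2 image_iff)
  have inj: "inj_on (\<lambda>(a, b). [a, b]) B" for B :: "(nat \<times> nat) set" by (auto simp: inj_on_def)
  have lm: "list_mean N f 2 \<le> 1 / (real N - 1)"
  proof -
    have "(\<Sum>x\<in>{(a, b). a \<in> {1..N} \<and> b \<in> {1..N} \<and> a \<noteq> b}. f (case x of (a, b) \<Rightarrow> [a, b])) =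
        (\<Sum>a\<in>{1..N}. \<Sum>b\<in>{1..N} - {a}. of_bool (q a = b))"
      unfolding pairs sig[OF finite_atLeastAtMost] by (rule sum.cong) (auto simp: f_def)
    also have "\<dots> \<le> (\<Sum>a\<in>{1..N}. 1)"
    proof (rule sum_mono)
      fix a :: nat
      have "(\<Sum>b\<in>{1..N} - {a}. of_bool (q a = b)) \<le> (\<Sum>b\<in>insert (q a) {1..N}. of_bool (q a = b) :: real)"
        by (rule sum_mono2) auto
      also have "\<dots> = 1" by (simp add: of_bool_def sum.delta)
      finally show "(\<Sum>b\<in>{1..N} - {a}. of_bool (q a = b)) \<le> (1 :: real)" .
    qed
    finally have "(\<Sum>x\<in>{(a, b). a \<in> {1..N} \<and> b \<in> {1..N} \<and> a \<noteq> b}. f (case x of (a, b) \<Rightarrow> [a, b])) \<le> real N"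
      by simp
    moreover have "list_mean N f 2 = (\<Sum>x\<in>{(a, b). a \<in> {1..N} \<and> b \<in> {1..N} \<and> a \<noteq> b}.
        f (case x of (a, b) \<Rightarrow> [a, b])) / (real N * (real N - 1))"
      unfolding list_mean_def e sum.reindex[OF inj] card_image[OF inj] cpairs[OF finite_atLeastAtMost]
      by (simp add: o_def)
    ultimately have "list_mean N f 2 \<le> real N / (real N * (real N - 1))"
      using N by (simp only:) (intro divide_right_mono, auto)
    also have "\<dots> = 1 / (real N - 1)" using N by simp
    finally show ?thesis .
  qed
  have "(\<Sum>s\<in>K. \<Sum>b\<in>moved s. of_bool (q b \<in> moved s \<and> q b \<noteq> b)) = (\<Sum>s\<in>K. \<Sum>xs\<in>V s. f xs)"
  proof (rule sum.cong[OF refl])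
    fix s assume s: "s \<in> K"
    have "(\<Sum>xs\<in>V s. f xs) = (\<Sum>a\<in>moved s. \<Sum>b\<in>moved s - {a}. of_bool (q a = b))"
      unfolding V_def sum.reindex[OF inj] pairs sig[OF finite_moved[OF s]]
      by (rule sum.cong) (auto simp: f_def)
    also have "\<dots> = (\<Sum>a\<in>moved s. of_bool (q a \<in> moved s \<and> q a \<noteq> a))"
      by (intro sum.cong refl) (simp add: of_bool_def sum.delta finite_moved[OF s])
    finally show "(\<Sum>b\<in>moved s. of_bool (q b \<in> moved s \<and> q b \<noteq> b)) = (\<Sum>xs\<in>V s. f xs)" by simp
  qed
  also have "\<dots> = (\<Sum>s\<in>K. \<Sum>xs\<in>V s. list_mean N f (length xs))"
  proof (rule sum_class_equivariant)
    fix s assume s: "s \<in> K"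
    show "finite (V s)"
      unfolding V_def pairs using finite_moved[OF s] by simp
    show "distinct xs \<and> set xs \<subseteq> {1..N}" if "xs \<in> V s" for xs
      using that moved_subset[OF s] unfolding V_def by auto
    fix \<pi> assume \<pi>: "\<pi> permutes {1..N}"
    then have i: "inj \<pi>" using permutes_inj by blast
    show "V (\<pi> \<circ> s \<circ> inv' \<pi>) = map \<pi> ` V s"
      unfolding V_def moved_conj[OF permutes_bij[OF \<pi>]]
      using i by (auto simp: image_iff inj_eq) 
  qed
  also have "\<dots> = (\<Sum>s\<in>K. ?A * (?A - 1) * list_mean N f 2)"
  proof (rule sum.cong[OF refl])
    fix s assume s: "s \<in> K"
    have "(\<Sum>xs\<in>V s. list_mean N f (length xs)) = (\<Sum>xs\<in>V s. list_mean N f 2)"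
      by (rule sum.cong) (auto simp: V_def numeral_2_eq_2)
    then show "(\<Sum>xs\<in>V s. list_mean N f (length xs)) = ?A * (?A - 1) * list_mean N f 2"
      using cpairs[OF finite_moved[OF s]] card_moved[OF s] by (simp add: V_def card_image[OF inj])
  qed
  also have "\<dots> = real (card K) * (?A * ((?A - 1) * list_mean N f 2))" by simp
  also have "\<dots> \<le> real (card K) * (?A * ((?A - 1) * (1 / (real N - 1))))"
    using lm class_support_pos by (intro mult_left_mono) auto
  also have "\<dots> \<le> real (card K) * (?A * (?A / real N))"
    using class_support_le class_support_pos N
    by (intro mult_left_mono) (auto simp: field_simps)
  finally show ?thesis by simp
qed

text \<open>\<open>support s a\<close> lists the cycle starting from a; its head recovers a, so the
  moved points correspond one to one to the lists, and these are equivariant.\<close>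

lemma sum_moved_cycle:
  shows "(\<Sum>s\<in>K. \<Sum>a\<in>moved s. f (support s a)) =
    real (card K) * (\<Sum>i=2..N. real (class_count N K i) * list_mean N f i)"
proof -
  have injs: "inj_on (support s) (moved s)" if "s \<in> K" for s
  proof (rule inj_onI)
    fix a b assume "support s a = support s b"
    moreover have "hd (support s x) = x" for x
      using least_power_of_permutation(2)[OF class_permutation[OF that], of x] by (simp add: hd_map)
    ultimately show "a = b" by metis
  qed
  have "(\<Sum>s\<in>K. \<Sum>a\<in>moved s. f (support s a)) = (\<Sum>s\<in>K. \<Sum>xs\<in>support s ` moved s. f xs)"
    by (simp add: sum.reindex injs)
  also have "\<dots> = (\<Sum>s\<in>K. \<Sum>xs\<in>support s ` moved s. list_mean N f (length xs))"
  proof (rule sum_class_equivariant)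
    fix s assume s: "s \<in> K"
    show "finite (support s ` moved s)" using finite_moved[OF s] by simp
    show "distinct xs \<and> set xs \<subseteq> {1..N}" if xs: "xs \<in> support s ` moved s" for xs
    proof -
      obtain a where a: "a \<in> moved s" "xs = support s a" using xs by blast
      have "set xs \<subseteq> {1..N}"
        using cycle_set_in[OF class_permutes[OF s], of a] moved_subset[OF s] a
          cycle_set_eq_support[OF class_permutation[OF s], of a] by blast
      then show ?thesis using cycle_of_permutation[OF class_permutation[OF s], of a] a(2) by blast
    qed
    fix \<pi> assume \<pi>: "\<pi> permutes {1..N}"
    have "support (\<pi> \<circ> s \<circ> inv' \<pi>) (\<pi> a) = map \<pi> (support s a)" for a
      unfolding least_power_conj[OF permutes_bij[OF \<pi>]] funpow_conj[OF permutes_bij[OF \<pi>]] by simp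
    then show "support (\<pi> \<circ> s \<circ> inv' \<pi>) ` moved (\<pi> \<circ> s \<circ> inv' \<pi>) = map \<pi> ` support s ` moved s"
      unfolding moved_conj[OF permutes_bij[OF \<pi>]] image_image by simp
  qed
  also have "\<dots> = (\<Sum>s\<in>K. \<Sum>a\<in>moved s. list_mean N f (least_power s a))"
    by (simp add: sum.reindex injs)
  also have "\<dots> = real (card K) * (\<Sum>i=2..N. real (class_count N K i) * list_mean N f i)"
    by (simp add: sum_moved_period)
  finally show ?thesis .
qed

end

section \<open>The generator on cycle generating functions\<close>

definition cycle_gf :: "nat \<Rightarrow> real \<Rightarrow> (nat \<Rightarrow> nat) \<Rightarrow> real" where
  "cycle_gf N z p = (\<Sum>j=1..N. z ^ least_power p j) / real N"

text \<open>\<open>z\<close> times the derivative of \<open>cycle_gf N z p\<close> with respect to \<open>z\<close>.\<close>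

definition cycle_gf' :: "nat \<Rightarrow> real \<Rightarrow> (nat \<Rightarrow> nat) \<Rightarrow> real" where
  "cycle_gf' N z p = (\<Sum>j=1..N. real (least_power p j) * z ^ least_power p j) / real N"

lemma divide_of_nat_le_self:
  fixes x :: real
  assumes "0 \<le> x"
  shows "x / real m \<le> x"
proof (cases "m = 0")
  case False
  then have "x * 1 \<le> x * real m" using assms by (intro mult_left_mono) auto
  then show ?thesis using False by (simp add: divide_le_eq)
qed (use assms in simp)

section \<open>The effect of one jump, and of the generator\<close>

context nontrivial_class
begin

text \<open>Cycles that avoid the moved points survive the jump and cancel. The others are
  redistributed on the moved points by \<open>touched_sum\<close>, before and after the jump alike,
  and this is exact whatever collisions occur.\<close>

lemma cycle_gf_comp_diff:
  assumes s: "s \<in> K" and p: "p permutes {1..N}"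
  shows "cycle_gf N z (s \<circ> p) - cycle_gf N z p =
    (\<Sum>a\<in>moved s.
      real (least_power (s \<circ> p) a) * z ^ least_power (s \<circ> p) a / real (card (moved s \<inter> cycle_set (s \<circ> p) a)) -
      real (least_power p a) * z ^ least_power p a / real (card (moved s \<inter> cycle_set p a))) / real N"
proof -
  have sp: "(s \<circ> p) permutes {1..N}" using class_permutes[OF s] p permutes_compose by blast
  have b: "bij s" using class_permutes[OF s] permutes_bij by blast
  let ?U = "{j \<in> {1..N}. cycle_set p j \<inter> moved s \<noteq> {}}"
  have split: "(\<Sum>j=1..N. h j) = (\<Sum>j\<in>?U. h j) + (\<Sum>j\<in>{1..N} - ?U. h j)" for h :: "nat \<Rightarrow> real"
    using sum.subset_diff[of ?U "{1..N}" h, OF _ finite_atLeastAtMost] by (simp only: add.commute) blast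
  have "(\<Sum>j\<in>{1..N} - ?U. z ^ least_power (s \<circ> p) j) = (\<Sum>j\<in>{1..N} - ?U. z ^ least_power p j)"
    by (rule sum.cong) (auto simp: cycle_set_comp_eq(2))
  then have "cycle_gf N z (s \<circ> p) - cycle_gf N z p =
      ((\<Sum>j\<in>?U. z ^ least_power (s \<circ> p) j) - (\<Sum>j\<in>?U. z ^ least_power p j)) / real N"
    unfolding cycle_gf_def split[of "\<lambda>j. z ^ least_power (s \<circ> p) j"] split[of "\<lambda>j. z ^ least_power p j"]
    by (simp add: diff_divide_distrib add_divide_distrib)
  also have "(\<Sum>j\<in>?U. z ^ least_power (s \<circ> p) j) = (\<Sum>a\<in>moved s.
      real (least_power (s \<circ> p) a) * z ^ least_power (s \<circ> p) a / real (card (moved s \<inter> cycle_set (s \<circ> p) a)))"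
    using touched_sum[OF sp _ moved_subset[OF s], of "\<lambda>n. z ^ n"] touched_comp_iff[OF b, of p] by simp
  also have "(\<Sum>j\<in>?U. z ^ least_power p j) = (\<Sum>a\<in>moved s.
      real (least_power p a) * z ^ least_power p a / real (card (moved s \<inter> cycle_set p a)))"
    using touched_sum[OF p _ moved_subset[OF s], of "\<lambda>n. z ^ n"] by simp
  finally show ?thesis by (simp only: sum_subtractf)
qed

lemma touched_weight_bounds:
  assumes c: "\<And>n. real n * z ^ n \<le> c" and z: "0 \<le> z"
  shows "0 \<le> real n * z ^ n / real m" "real n * z ^ n / real m \<le> c"
proof -
  show "0 \<le> real n * z ^ n / real m" using z by simp
  have "real n * z ^ n / real m \<le> real n * z ^ n"
    using z by (simp add: divide_of_nat_le_self)
  then show "real n * z ^ n / real m \<le> c" using c order_trans by blast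
qed

text \<open>Each of the A summands is a difference of two numbers between 0 and c. Jumps of size O(A
  / N) at rate N / A are what makes the square field O(A / N).\<close>

lemma cycle_gf_comp_diff_bound:
  assumes s: "s \<in> K" and p: "p permutes {1..N}"
    and c: "\<And>n. real n * z ^ n \<le> c" and z: "0 \<le> z"
  shows "\<bar>cycle_gf N z (s \<circ> p) - cycle_gf N z p\<bar> \<le> c * real (class_support N K) / real N"
proof -
  have "\<bar>\<Sum>a\<in>moved s.
      real (least_power (s \<circ> p) a) * z ^ least_power (s \<circ> p) a / real (card (moved s \<inter> cycle_set (s \<circ> p) a)) -
      real (least_power p a) * z ^ least_power p a / real (card (moved s \<inter> cycle_set p a))\<bar> \<le>
      (\<Sum>a\<in>moved s. c)"
    using touched_weight_bounds[OF c z]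
    by (intro order_trans[OF sum_abs] sum_mono) (simp add: abs_le_iff, smt (verit))
  also have "\<dots> = c * real (class_support N K)" by (simp add: card_moved[OF s])
  finally show ?thesis unfolding cycle_gf_comp_diff[OF s p] by (simp add: divide_right_mono)
qed

text \<open>The exceptional event on which the hypothesis \<open>good\<close> of
  \<open>merge_cycles\<close> fails: a path explored from the \<open>s\<close>-cycle of a runs into
  another moved point.\<close>

definition crowded :: "nat \<Rightarrow> (nat \<Rightarrow> nat) \<Rightarrow> (nat \<Rightarrow> nat) \<Rightarrow> nat \<Rightarrow> bool" where
  "crowded L p s a \<longleftrightarrow> (\<exists>k\<le>L. \<exists>m. 0 < m \<and> m \<le> L \<and> (p ^^ m) ((s ^^ k) a) \<in> moved s \<and>
     (p ^^ m) ((s ^^ k) a) \<noteq> (s ^^ k) a)"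

text \<open>A union bound over the L + 1 values of k and the L values of m, each costing A / N by
  \<open>sum_moved_pair\<close> for the map \<open>p ^^ m\<close>.\<close>

lemma sum_crowded:
  "(\<Sum>s\<in>K. \<Sum>a\<in>moved s. of_bool (crowded L p s a)) \<le>
    real (card K) * real (class_support N K) * (real (L * (L + 1)) * real (class_support N K) / real N)"
proof -
  let ?e = "\<lambda>s m b. of_bool ((p ^^ m) b \<in> moved s \<and> (p ^^ m) b \<noteq> b) :: real"
  have "(\<Sum>s\<in>K. \<Sum>a\<in>moved s. of_bool (crowded L p s a)) \<le>
      (\<Sum>s\<in>K. \<Sum>a\<in>moved s. \<Sum>k\<le>L. \<Sum>m=1..L. ?e s m ((s ^^ k) a))"
  proof (intro sum_mono)
    fix s a
    show "of_bool (crowded L p s a) \<le> (\<Sum>k\<le>L. \<Sum>m=1..L. ?e s m ((s ^^ k) a))"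
    proof (cases "crowded L p s a")
      case True
      then obtain k m where km: "k \<le> L" "0 < m" "m \<le> L" "?e s m ((s ^^ k) a) = 1"
        unfolding crowded_def by auto
      have "1 \<le> (\<Sum>m=1..L. ?e s m ((s ^^ k) a))"
        using member_le_sum[of m "{1..L}" "\<lambda>m. ?e s m ((s ^^ k) a)"] km by auto
      also have "\<dots> \<le> (\<Sum>k\<le>L. \<Sum>m=1..L. ?e s m ((s ^^ k) a))"
        using member_le_sum[of k "{..L}" "\<lambda>k. \<Sum>m=1..L. ?e s m ((s ^^ k) a)"] km(1)
        by (auto intro: sum_nonneg)
      finally show ?thesis using True by simp
    qed (auto intro!: sum_nonneg)
  qed
  also have "\<dots> = (\<Sum>s\<in>K. \<Sum>k\<le>L. \<Sum>m=1..L. \<Sum>a\<in>moved s. ?e s m ((s ^^ k) a))"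
    by (rule sum.cong[OF refl], subst sum.swap, rule sum.cong[OF refl], rule sum.swap)
  \<comment> \<open>\<open>s ^^ k\<close> permutes the moved points, so the shift by k disappears
    from the sum.\<close>
  also have "\<dots> = (\<Sum>s\<in>K. \<Sum>k\<le>L. \<Sum>m=1..L. \<Sum>b\<in>moved s. ?e s m b)"
  proof (rule sum.cong[OF refl], rule sum.cong[OF refl], rule sum.cong[OF refl])
    fix s k m assume s: "s \<in> K"
    have inj: "inj (s ^^ k)" using class_permutes[OF s] by (simp add: inj_fn permutes_inj)
    have "(s ^^ k) ` moved s \<subseteq> moved s"
    proof
      fix x assume "x \<in> (s ^^ k) ` moved s"
      then obtain y where "y \<in> moved s" "x = (s ^^ k) y" by blast
      then show "x \<in> moved s" using inj unfolding moved_def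
        by (metis (mono_tags, lifting) funpow_swap1 injD mem_Collect_eq)
    qed
    then have "(s ^^ k) ` moved s = moved s"
      using endo_inj_surj[OF finite_moved[OF s]] inj_on_subset[OF inj subset_UNIV] by blast
    then have "bij_betw (s ^^ k) (moved s) (moved s)"
      using inj_on_subset[OF inj subset_UNIV] by (simp only: bij_betw_def simp_thms)
    then show "(\<Sum>a\<in>moved s. ?e s m ((s ^^ k) a)) = (\<Sum>b\<in>moved s. ?e s m b)"
      by (rule sum.reindex_bij_betw[where h = "s ^^ k" and g = "?e s m"])
  qed
  also have "\<dots> = (\<Sum>k\<le>L. \<Sum>m=1..L. \<Sum>s\<in>K. \<Sum>b\<in>moved s. ?e s m b)"
    by (subst sum.swap, rule sum.cong[OF refl], rule sum.swap)
  also have "\<dots> \<le> (\<Sum>k\<le>L. \<Sum>m=1..L. real (card K) * real (class_support N K) * (real (class_support N K) / real N))"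
    by (intro sum_mono sum_moved_pair)
  also have "\<dots> = real (card K) * real (class_support N K) * (real (L * (L + 1)) * real (class_support N K) / real N)"
    by (simp add: algebra_simps)
  finally show ?thesis .
qed

text \<open>f is the weight of a moved point whose cycle of i points merges the
  \<open>p\<close>-cycles of all of them: the total length is n, shared by i points. For i \<le> L,
  drawing with replacement leads to z times the derivative of an i-th power, whose factor i cancels
  the division by i. For i > L, each \<open>p\<close>-cycle has length at least 1, so n > L and the
  weight is at most \<eta>.\<close>

lemma list_mean_weight:
  fixes z :: real
  assumes p: "p permutes {1..N}" and c: "\<And>n. real n * z ^ n \<le> c" and z: "0 \<le> z"
    and \<eta>: "\<And>n. L < n \<Longrightarrow> real n * z ^ n \<le> \<eta>" and i: "2 \<le> i" "i \<le> N"
  defines "f \<equiv> \<lambda>xs. real (sum_list (map (least_power p) xs)) * z ^ sum_list (map (least_power p) xs) / real (length xs)"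
  shows "\<bar>list_mean N f i - (if i \<le> L then cycle_gf' N z p * cycle_gf N z p ^ (i - 1) else 0)\<bar>
    \<le> \<eta> + c * (real L)\<^sup>2 / real N"
proof -
  have perm: "permutation p" using p permutation_permutes by blast
  have Np: "0 < real N" using N by simp
  have f: "0 \<le> f xs" "f xs \<le> c" for xs unfolding f_def using touched_weight_bounds[OF c z] by auto
  have c0: "0 \<le> c" using f[of "[]"] by linarith
  have "0 \<le> real (Suc L) * z ^ Suc L" using z by simp
  then have \<eta>0: "0 \<le> \<eta>" using \<eta>[of "Suc L"] by linarith
  show ?thesis
  proof (cases "i \<le> L")
    case True
    have "(\<Sum>xs | set xs \<subseteq> {1..N} \<and> length xs = i. f xs) =
        (\<Sum>xs | set xs \<subseteq> {1..N} \<and> length xs = i. real (sum_list (map (least_power p) xs)) *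
          z ^ sum_list (map (least_power p) xs)) / real i"
      unfolding f_def sum_divide_distrib by (rule sum.cong) auto
    also have "\<dots> = (real N * cycle_gf' N z p) * (real N * cycle_gf N z p) ^ (i - 1)"
      unfolding sum_lists_power(2)[OF finite_atLeastAtMost] cycle_gf_def cycle_gf'_def using i Np by simp
    also have "\<dots> = cycle_gf' N z p * cycle_gf N z p ^ (i - 1) * real N ^ i"
      using i by (cases i) (simp_all add: power_mult_distrib)
    finally have e: "(\<Sum>xs | set xs \<subseteq> {1..N} \<and> length xs = i. f xs) / real N ^ i =
        cycle_gf' N z p * cycle_gf N z p ^ (i - 1)" using Np by simp
    have "\<bar>list_mean N f i - cycle_gf' N z p * cycle_gf N z p ^ (i - 1)\<bar> \<le> c * (real i)\<^sup>2 / real N"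
      using list_mean_approx[of i N f c] i(2) f Np unfolding e by simp
    also have "\<dots> \<le> c * (real L)\<^sup>2 / real N"
      using True c0 Np by (intro divide_right_mono mult_left_mono power_mono) auto
    finally show ?thesis using True \<eta>0 by simp
  next
    case False
    let ?D = "{xs. length xs = i \<and> distinct xs \<and> set xs \<subseteq> {1..N}}"
    have b: "f xs \<le> \<eta>" if "xs \<in> ?D" for xs
    proof -
      have len: "length xs \<le> sum_list (map (least_power p) xs)" for xs
      proof (induction xs)
        case (Cons a xs)
        then show ?case using least_power_of_permutation(2)[OF perm, of a] by simp
      qed simp
      have "length xs = i" using that by blast
      then have "L < sum_list (map (least_power p) xs)"
        using False len[of xs] by linarith
      then have "real (sum_list (map (least_power p) xs)) * z ^ sum_list (map (least_power p) xs) \<le> \<eta>"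
        by (rule \<eta>)
      moreover have "f xs \<le> real (sum_list (map (least_power p) xs)) * z ^ sum_list (map (least_power p) xs)"
        unfolding f_def by (rule divide_of_nat_le_self) (use z in simp)
      ultimately show ?thesis by linarith
    qed
    have fin: "finite ?D" by (rule finite_distinct_lists) simp
    have "sum f ?D \<le> \<eta> * real (card ?D)"
      using sum_bounded_above[of ?D f \<eta>] b by (simp add: mult.commute)
    then have "list_mean N f i \<le> \<eta>"
      unfolding list_mean_def using \<eta>0 by (cases "card ?D = 0") (simp_all add: divide_le_eq)
    moreover have "0 \<le> list_mean N f i"
      unfolding list_mean_def by (intro divide_nonneg_nonneg sum_nonneg f) auto
    moreover have "0 \<le> c * (real L)\<^sup>2 / real N" using c0 by simp
    ultimately show ?thesis using False by simp
  qed
qed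

text \<open>Gain and loss at a moved point each cost \<eta> for long cycles and c on the crowded
  event. Replacing the means over cycles by products, cut at period L, costs the third \<eta> and
  the last term.\<close>

lemma generator_estimate:
  assumes p: "p permutes {1..N}" and c: "\<And>n. real n * z ^ n \<le> c" and z: "0 \<le> z"
    and \<eta>: "\<And>n. L < n \<Longrightarrow> real n * z ^ n \<le> \<eta>" and L: "L \<le> N"
  shows "\<bar>walk_generator N K (cycle_gf N z) p + cycle_gf' N z p *
      (1 - (\<Sum>i=2..L. real (class_count N K i) / real (class_support N K) * cycle_gf N z p ^ (i - 1)))\<bar>
    \<le> 3 * \<eta> + 2 * c * (real (L * (L + 1)) * real (class_support N K) / real N) + c * (real L)\<^sup>2 / real N"
proof -
  let ?A = "real (class_support N K)"
  let ?k = "real (card K)"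
  let ?\<psi> = "\<lambda>n. real n * z ^ n"
  let ?w = "least_power p"
  have perm: "permutation p" using p permutation_permutes by blast
  have Ap: "0 < ?A" and kp: "0 < ?k" and Np: "0 < real N"
    using class_support_pos card_class_pos N by auto
  have c0: "0 \<le> c" using c[of 0] by simp
  have "0 \<le> ?\<psi> (Suc L)" using z by simp
  then have \<eta>0: "0 \<le> \<eta>" using \<eta>[of "Suc L"] by linarith
  define f where "f xs = real (sum_list (map ?w xs)) * z ^ sum_list (map ?w xs) / real (length xs)" for xs
  \<comment> \<open>By \<open>cycle_gf_comp_diff\<close>, \<open>gain\<close> and
    \<open>loss\<close> are the weights of a moved point after and before the jump; f gives the
    value of \<open>gain\<close> when cycles merge without collision.\<close>
  define gain where "gain s a = ?\<psi> (least_power (s \<circ> p) a) / real (card (moved s \<inter> cycle_set (s \<circ> p) a))" for s a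
  define loss where "loss s a = ?\<psi> (?w a) / real (card (moved s \<inter> cycle_set p a))" for s a
  have gain: "\<bar>gain s a - f (support s a)\<bar> \<le> \<eta> + c * of_bool (crowded L p s a)"
    if s: "s \<in> K" and a: "a \<in> moved s" for s a
  proof -
    have bnd: "0 \<le> gain s a" "gain s a \<le> c" "0 \<le> f (support s a)" "f (support s a) \<le> c"
      unfolding gain_def f_def using touched_weight_bounds[OF c z] by blast+
    show ?thesis
    proof (cases "crowded L p s a")
      case True then show ?thesis using bnd \<eta>0 by (simp only: of_bool_eq)
    next
      case False
      have T: "sum_list (map ?w (support s a)) = (\<Sum>k<least_power s a. ?w ((s ^^ k) a))"
        by (simp add: comp_def interv_sum_list_conv_sum_set_nat lessThan_atLeast0)
      have small: "0 \<le> ?\<psi> n / real m" "L < n \<Longrightarrow> ?\<psi> n / real m \<le> \<eta>" for n m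
      proof -
        show "0 \<le> ?\<psi> n / real m" using z by simp
        assume "L < n"
        then have "?\<psi> n \<le> \<eta>" by (rule \<eta>)
        moreover have "?\<psi> n / real m \<le> ?\<psi> n"
          using z by (simp add: divide_of_nat_le_self)
        ultimately show "?\<psi> n / real m \<le> \<eta>" by linarith
      qed
      have good: "(p ^^ m) ((s ^^ k) a) = (s ^^ k) a"
        if "k \<le> L" "0 < m" "m \<le> L" "(p ^^ m) ((s ^^ k) a) \<in> moved s" for k m
        using False that unfolding crowded_def by blast
      from merge_cycles[OF class_permutation[OF s] perm a good]
      consider "least_power (s \<circ> p) a = sum_list (map ?w (support s a))"
          "card (moved s \<inter> cycle_set (s \<circ> p) a) = least_power s a"
        | "L < least_power (s \<circ> p) a" "L < sum_list (map ?w (support s a))"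
        unfolding T by blast
      then show ?thesis
      proof cases
        case 1
        then show ?thesis unfolding gain_def f_def using False \<eta>0 by simp
      next
        case 2
        have "0 \<le> gain s a" "gain s a \<le> \<eta>" "0 \<le> f (support s a)" "f (support s a) \<le> \<eta>"
          unfolding gain_def f_def using small(1) small(2)[OF 2(1)] small(2)[OF 2(2)] by blast+
        then show ?thesis using False by simp
      qed
    qed
  qed
  have loss: "\<bar>loss s a - ?\<psi> (?w a)\<bar> \<le> \<eta> + c * of_bool (crowded L p s a)"
    if s: "s \<in> K" and a: "a \<in> moved s" for s a
  proof -
    have bnd: "0 \<le> loss s a" "loss s a \<le> c" "0 \<le> ?\<psi> (?w a)" "?\<psi> (?w a) \<le> c"
      unfolding loss_def using touched_weight_bounds[OF c z] c z by auto
    have le: "loss s a \<le> ?\<psi> (?w a)"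
      unfolding loss_def using z
      by (simp add: divide_of_nat_le_self)
    show ?thesis
    proof (cases "crowded L p s a")
      case True then show ?thesis using bnd \<eta>0 by auto
    next
      case False
      have g: "\<And>m. 0 < m \<Longrightarrow> m \<le> L \<Longrightarrow> (p ^^ m) a \<in> moved s \<Longrightarrow> (p ^^ m) a = a"
        using False[unfolded crowded_def, simplified, rule_format, of 0] by auto
      show ?thesis
      proof (cases "?w a \<le> L")
        case True
        then have "card (moved s \<inter> cycle_set p a) = 1"
          using lone_point_of_cycle[OF perm a g] by blast
        then show ?thesis using \<eta>0 False by (simp add: loss_def)
      next
        case False
        then have "?\<psi> (?w a) \<le> \<eta>" using \<eta> by simp
        then show ?thesis using bnd le c0 by simp
      qed
    qed
  qed
  let ?B = "\<Sum>s\<in>K. \<Sum>a\<in>moved s. of_bool (crowded L p s a) :: real"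
  have const: "(\<Sum>s\<in>K. \<Sum>a\<in>moved s. x) = ?k * ?A * x" for x :: real by (simp add: card_moved)
  have diff: "\<bar>(\<Sum>s\<in>K. \<Sum>a\<in>moved s. u s a) - (\<Sum>s\<in>K. \<Sum>a\<in>moved s. v s a)\<bar> \<le>
      ?k * ?A * \<eta> + c * ?B"
    if "\<And>s a. s \<in> K \<Longrightarrow> a \<in> moved s \<Longrightarrow> \<bar>u s a - v s a\<bar> \<le> \<eta> + c * of_bool (crowded L p s a)"
    for u v :: "(nat \<Rightarrow> nat) \<Rightarrow> nat \<Rightarrow> real"
  proof -
    have "\<bar>(\<Sum>s\<in>K. \<Sum>a\<in>moved s. u s a) - (\<Sum>s\<in>K. \<Sum>a\<in>moved s. v s a)\<bar> =
        \<bar>\<Sum>s\<in>K. \<Sum>a\<in>moved s. u s a - v s a\<bar>" by (simp add: sum_subtractf)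
    also have "\<dots> \<le> (\<Sum>s\<in>K. \<Sum>a\<in>moved s. \<bar>u s a - v s a\<bar>)"
      by (intro order_trans[OF sum_abs] sum_mono order_refl)
    also have "\<dots> \<le> (\<Sum>s\<in>K. \<Sum>a\<in>moved s. \<eta> + c * of_bool (crowded L p s a))"
      by (intro sum_mono that)
    also have "\<dots> = ?k * ?A * \<eta> + c * ?B"
      by (simp only: sum.distrib const sum_distrib_left)
    finally show ?thesis .
  qed
  define \<beta> where "\<beta> = real (L * (L + 1)) * ?A / real N"
  have B: "?B \<le> ?k * ?A * \<beta>" using sum_crowded unfolding \<beta>_def by simp
  have cB: "c * ?B \<le> ?k * ?A * (c * \<beta>)" using mult_left_mono[OF B c0] by (simp add: algebra_simps)
  define G where "G = (\<Sum>s\<in>K. \<Sum>a\<in>moved s. gain s a)"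
  define Lo where "Lo = (\<Sum>s\<in>K. \<Sum>a\<in>moved s. loss s a)"
  define M where "M = (\<Sum>i=2..N. real (class_count N K i) * list_mean N f i)"
  define M' where "M' = (\<Sum>i=2..L. real (class_count N K i) * (cycle_gf' N z p * cycle_gf N z p ^ (i - 1)))"
  have G: "\<bar>G - ?k * M\<bar> \<le> ?k * ?A * (\<eta> + c * \<beta>)"
    using diff[of gain "\<lambda>s a. f (support s a)", OF gain] cB
    unfolding G_def M_def sum_moved_cycle by (simp add: algebra_simps)
  have Lo: "\<bar>Lo - ?k * ?A * cycle_gf' N z p\<bar> \<le> ?k * ?A * (\<eta> + c * \<beta>)"
    using diff[of loss "\<lambda>s a. ?\<psi> (?w a)", OF loss] cB
    unfolding Lo_def sum_moved_point cycle_gf'_def by (simp add: algebra_simps)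
  have M: "\<bar>M - M'\<bar> \<le> ?A * (\<eta> + c * (real L)\<^sup>2 / real N)"
  proof -
    let ?t = "\<lambda>i. if i \<le> L then cycle_gf' N z p * cycle_gf N z p ^ (i - 1) else 0"
    have "M' = (\<Sum>i=2..N. real (class_count N K i) * ?t i)"
      unfolding M'_def by (rule sum.mono_neutral_cong_left) (use L in auto)
    then have "M - M' = (\<Sum>i=2..N. real (class_count N K i) * (list_mean N f i - ?t i))"
      unfolding M_def by (simp add: sum_subtractf right_diff_distrib)
    then have "\<bar>M - M'\<bar> \<le> (\<Sum>i=2..N. \<bar>real (class_count N K i) * (list_mean N f i - ?t i)\<bar>)"
      by (simp only: sum_abs)
    also have "\<dots> \<le> (\<Sum>i=2..N. real (class_count N K i) * (\<eta> + c * (real L)\<^sup>2 / real N))"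
      unfolding abs_mult f_def
      by (intro sum_mono mult_mono list_mean_weight[OF p c z \<eta>]) auto
    also have "\<dots> = ?A * (\<eta> + c * (real L)\<^sup>2 / real N)"
      unfolding sum_class_count[symmetric] by (simp add: sum_distrib_right)
    finally show ?thesis .
  qed
  have gen: "walk_generator N K (cycle_gf N z) p = (G - Lo) / (?k * ?A)"
  proof -
    have "(\<Sum>s\<in>K. cycle_gf N z (s \<circ> p) - cycle_gf N z p) = (\<Sum>s\<in>K. (\<Sum>a\<in>moved s. gain s a - loss s a) / real N)"
      unfolding gain_def loss_def by (intro sum.cong refl cycle_gf_comp_diff p)
    also have "\<dots> = (G - Lo) / real N"
      unfolding G_def Lo_def by (simp add: sum_subtractf sum_divide_distrib[symmetric])
    finally show ?thesis unfolding walk_generator_def using Np by simp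
  qed
  have M'_eq: "M' / ?A = cycle_gf' N z p *
      (\<Sum>i=2..L. real (class_count N K i) / ?A * cycle_gf N z p ^ (i - 1))"
    unfolding M'_def by (simp add: sum_divide_distrib sum_distrib_left mult_ac)
  \<comment> \<open>Three separate errors: the gain against its collision-free value, the loss
    against \<open>cycle_gf'\<close>, and the mean over cycles against its truncated product
    form.\<close>
  have "walk_generator N K (cycle_gf N z) p + cycle_gf' N z p *
      (1 - (\<Sum>i=2..L. real (class_count N K i) / ?A * cycle_gf N z p ^ (i - 1))) =
      (G - ?k * M) / (?k * ?A) - (Lo - ?k * ?A * cycle_gf' N z p) / (?k * ?A) + (M - M') / ?A"
    unfolding gen right_diff_distrib M'_eq[symmetric] using Ap kp by (simp add: field_simps)
  moreover have "\<bar>(G - ?k * M) / (?k * ?A)\<bar> \<le> \<eta> + c * \<beta>"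
    using G Ap kp by (simp add: abs_divide divide_le_eq mult_ac)
  moreover have "\<bar>(Lo - ?k * ?A * cycle_gf' N z p) / (?k * ?A)\<bar> \<le> \<eta> + c * \<beta>"
    using Lo Ap kp by (simp add: abs_divide divide_le_eq mult_ac)
  moreover have "\<bar>(M - M') / ?A\<bar> \<le> \<eta> + c * (real L)\<^sup>2 / real N"
    using M Ap by (simp add: abs_divide divide_le_eq mult_ac)
  moreover have "\<bar>x - y + w\<bar> \<le> 3 * \<eta> + 2 * d + e"
    if "\<bar>x\<bar> \<le> \<eta> + d" "\<bar>y\<bar> \<le> \<eta> + d" "\<bar>w\<bar> \<le> \<eta> + e" for x y w d e :: real
    using that by linarith
  ultimately show ?thesis
    unfolding \<beta>_def[symmetric] mult.assoc[of 2 c \<beta>] by (simp only:)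
qed

end

section \<open>The limiting extinction probability\<close>

lemma one_minus_power: "1 - u ^ (n + 1) = (1 - u) * (\<Sum>p<Suc n. u ^ p)" for u :: real
  using one_diff_power_eq[of u "n + 1"] by simp

text \<open>In the application \<open>a n\<close> is the limiting proportion of moved points of
  period n + 2; such a point is merged with n + 1 others, whence the exponent in \<open>g\<close>. A
  total mass below 1 means that part of the periods escapes to infinity.\<close>

locale offspring =
  fixes a :: "nat \<Rightarrow> real"
  assumes nonneg: "0 \<le> a n" and summable: "summable a" and le_1: "(\<Sum>n. a n) \<le> 1"
begin

definition g :: "real \<Rightarrow> real" where
  "g u = (\<Sum>n. a n * u ^ (n + 1))"

text \<open>Solved for u, the equation z = h t u reads u = z * exp (t * (g u - 1)), the equation of
  the total progeny of a branching process whose offspring has generating function exp (t * (g u -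
  1)). So \<open>h t\<close> is the inverse of the generating function of the limiting cycle
  length.\<close>

definition h :: "real \<Rightarrow> real \<Rightarrow> real" where
  "h t u = u * exp (t * (1 - g u))"

lemma summable_g: "0 \<le> u \<Longrightarrow> u \<le> 1 \<Longrightarrow> summable (\<lambda>n. a n * u ^ (n + 1))"
  by (rule summable_comparison_test'[OF summable, of 0])
    (auto simp: nonneg abs_mult power_le_one intro!: mult_left_le mult_le_one)

lemma g_nonneg: "0 \<le> u \<Longrightarrow> u \<le> 1 \<Longrightarrow> 0 \<le> g u"
  unfolding g_def by (intro suminf_nonneg summable_g) (auto simp: nonneg)

lemma g_mono:
  assumes "0 \<le> u" "u \<le> v" "v \<le> 1"
  shows "g u \<le> g v"
  unfolding g_def using assms
  by (intro suminf_le summable_g mult_left_mono power_mono nonneg) auto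

lemma g_le_self:
  assumes "0 \<le> u" "u \<le> 1"
  shows "g u \<le> u"
proof -
  have "g u \<le> (\<Sum>n. a n * u)"
    unfolding g_def using assms
    by (intro suminf_le summable_g mult_left_mono nonneg summable_mult2 summable)
      (auto intro: mult_left_le power_le_one)
  also have "\<dots> = (\<Sum>n. a n) * u" using summable by (simp add: suminf_mult2)
  also have "\<dots> \<le> u" using le_1 assms mult_right_mono[OF le_1 assms(1)] by simp
  finally show ?thesis .
qed

lemma continuous_on_g: "continuous_on {0..1} g"
proof -
  have "uniform_limit {0..1} (\<lambda>n u. \<Sum>i<n. a i * u ^ (i + 1)) (\<lambda>u. \<Sum>i. a i * u ^ (i + 1)) sequentially"
    by (rule Weierstrass_m_test[where M = a])
      (auto simp: nonneg summable abs_mult power_le_one intro!: mult_left_le mult_le_one)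
  then show ?thesis unfolding g_def[abs_def]
    by (rule uniform_limit_theorem[rotated]) (auto intro!: always_eventually continuous_intros)
qed

text \<open>Every remaining power of u is at most r ^ (m + 1), and the remaining coefficients have
  mass at most 1; no rate of decay of the coefficients enters.\<close>

lemma g_tail:
  assumes "0 \<le> u" "u \<le> r" "r \<le> 1"
  shows "\<bar>g u - (\<Sum>n<m. a n * u ^ (n + 1))\<bar> \<le> r ^ (m + 1)"
proof -
  have u: "u \<le> 1" using assms by simp
  have "g u - (\<Sum>n<m. a n * u ^ (n + 1)) = (\<Sum>n. a (n + m) * u ^ (n + m + 1))"
    unfolding g_def using suminf_split_initial_segment[OF summable_g[OF assms(1) u], of m] by simp
  moreover have s: "summable (\<lambda>n. a (n + m) * u ^ (n + m + 1))"
    using summable_ignore_initial_segment[OF summable_g[OF assms(1) u], of m] by simp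
  moreover have "0 \<le> (\<Sum>n. a (n + m) * u ^ (n + m + 1))"
    using s by (rule suminf_nonneg) (auto simp: nonneg assms)
  moreover have "(\<Sum>n. a (n + m) * u ^ (n + m + 1)) \<le> (\<Sum>n. a (n + m) * r ^ (m + 1))"
  proof (rule suminf_le[OF _ s])
    fix n
    have "u ^ (n + m + 1) = u ^ n * u ^ (m + 1)" by (simp add: power_add)
    also have "\<dots> \<le> 1 * u ^ (m + 1)" using assms u by (intro mult_right_mono power_le_one) auto
    also have "\<dots> \<le> r ^ (m + 1)" using assms power_mono[of u r "m + 1"] by simp
    finally show "a (n + m) * u ^ (n + m + 1) \<le> a (n + m) * r ^ (m + 1)"
      by (rule mult_left_mono) (rule nonneg)
  qed (intro summable_mult2 summable_ignore_initial_segment summable)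
  moreover have "(\<Sum>n. a (n + m) * r ^ (m + 1)) \<le> r ^ (m + 1)"
  proof -
    have "(\<Sum>n. a (n + m)) \<le> (\<Sum>n. a n)"
      using suminf_split_initial_segment[OF summable, of m] sum_nonneg[of "{..<m}" a] nonneg by simp
    then have le: "(\<Sum>n. a (n + m)) \<le> 1" using le_1 by simp
    have "(\<Sum>n. a (n + m) * r ^ (m + 1)) = (\<Sum>n. a (n + m)) * r ^ (m + 1)"
      using summable by (simp add: suminf_mult2 summable_ignore_initial_segment del: power_Suc)
    also have "\<dots> \<le> 1 * r ^ (m + 1)" using assms by (intro mult_right_mono le) auto
    finally show ?thesis by simp
  qed
  ultimately show ?thesis by linarith
qed

text \<open>\<Lambda> is the derivative of g at r. It is finite for r < 1, but may blow up as r
  tends to 1, when the mean of the offspring weights is infinite.\<close>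

lemma g_lipschitz:
  assumes "0 \<le> r" "r < 1"
  obtains \<Lambda> where "0 \<le> \<Lambda>" "\<And>u v. 0 \<le> u \<Longrightarrow> u \<le> r \<Longrightarrow> 0 \<le> v \<Longrightarrow> v \<le> r \<Longrightarrow> \<bar>g u - g v\<bar> \<le> \<Lambda> * \<bar>u - v\<bar>"
proof -
  have sr: "summable (\<lambda>n. real (n + 1) * r ^ n)"
    using geometric_deriv_sums[of r] assms by (simp add: sums_iff)
  have an: "a n \<le> 1" for n
    using sum_le_suminf[OF summable, of "{n}"] nonneg le_1 by simp
  have bound: "a n * (real (n + 1) * r ^ n) \<le> real (n + 1) * r ^ n" for n
    using an[of n] assms by (intro mult_left_le_one_le nonneg) auto
  have sl: "summable (\<lambda>n. a n * (real (n + 1) * r ^ n))"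
    by (rule summable_comparison_test'[OF sr, of 0]) (use bound assms nonneg in auto)
  define \<Lambda> where "\<Lambda> = (\<Sum>n. a n * (real (n + 1) * r ^ n))"
  have main: "g u - g v \<le> \<Lambda> * (u - v)" if "0 \<le> v" "v \<le> u" "u \<le> r" for u v
  proof -
    have s: "summable (\<lambda>n. a n * u ^ (n + 1))" "summable (\<lambda>n. a n * v ^ (n + 1))"
      by (rule summable_g; use that assms in simp)+
    have "g u - g v = (\<Sum>n. a n * u ^ (n + 1) - a n * v ^ (n + 1))"
      unfolding g_def using s by (rule suminf_diff)
    also have "\<dots> \<le> (\<Sum>n. a n * (real (n + 1) * r ^ n) * (u - v))"
    proof (rule suminf_le)
      fix n
      have "u ^ (n + 1) - v ^ (n + 1) = (u - v) * (\<Sum>p<Suc n. u ^ p * v ^ (n - p))"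
        using diff_power_eq_sum[of u n v] by simp
      also have "\<dots> \<le> (u - v) * (\<Sum>p<Suc n. r ^ n)"
      proof (intro mult_left_mono sum_mono)
        fix p assume "p \<in> {..<Suc n}"
        then have "r ^ n = r ^ p * r ^ (n - p)" by (simp flip: power_add)
        moreover have "u ^ p * v ^ (n - p) \<le> r ^ p * r ^ (n - p)"
          using that by (intro mult_mono power_mono) auto
        ultimately show "u ^ p * v ^ (n - p) \<le> r ^ n" by simp
      qed (use that in simp)
      also have "\<dots> = real (n + 1) * r ^ n * (u - v)" by simp
      finally have "a n * (u ^ (n + 1) - v ^ (n + 1)) \<le> a n * (real (n + 1) * r ^ n * (u - v))"
        by (rule mult_left_mono) (rule nonneg)
      then show "a n * u ^ (n + 1) - a n * v ^ (n + 1) \<le> a n * (real (n + 1) * r ^ n) * (u - v)"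
        by (simp add: algebra_simps)
    qed (use s sl in \<open>auto intro: summable_diff summable_mult2\<close>)
    also have "\<dots> = \<Lambda> * (u - v)" unfolding \<Lambda>_def using sl by (rule suminf_mult2[symmetric])
    finally show ?thesis .
  qed
  show ?thesis
  proof
    show "0 \<le> \<Lambda>" unfolding \<Lambda>_def using sl by (rule suminf_nonneg) (use assms nonneg in auto)
    fix u v assume uv: "0 \<le> u" "u \<le> r" "0 \<le> v" "v \<le> r"
    show "\<bar>g u - g v\<bar> \<le> \<Lambda> * \<bar>u - v\<bar>"
    proof (cases "v \<le> u")
      case True
      then show ?thesis using main[of v u] g_mono[of v u] uv assms by simp
    next
      case False
      then show ?thesis using main[of u v] g_mono[of u v] uv assms by (simp add: abs_if)
    qed
  qed
qed

lemma h_0: "h 0 u = u"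
  by (simp add: h_def)

lemma h_mono_time:
  assumes "0 \<le> u" "u \<le> 1" "s \<le> t"
  shows "h s u \<le> h t u"
proof -
  have "g u \<le> 1" using g_le_self[OF assms(1,2)] assms by simp
  then show ?thesis unfolding h_def using assms by (intro mult_left_mono) (auto intro: mult_right_mono)
qed

lemma h_add_time_le:
  assumes "0 \<le> u" "u \<le> 1" "0 \<le> \<delta>"
  shows "h (t + \<delta>) u \<le> h t u * exp \<delta>"
proof -
  have "\<delta> * (1 - g u) \<le> \<delta> * 1" using assms g_nonneg[OF assms(1,2)] by (intro mult_left_mono) auto
  then have "exp ((t + \<delta>) * (1 - g u)) \<le> exp (t * (1 - g u)) * exp \<delta>"
    by (simp add: algebra_simps flip: exp_add)
  then show ?thesis unfolding h_def using assms by (simp add: mult.assoc mult_left_mono)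
qed

lemma continuous_on_h: "continuous_on {0..1} (h t)"
  unfolding h_def[abs_def] by (intro continuous_intros continuous_on_g)

lemma h_at_1: "0 \<le> t \<Longrightarrow> 1 \<le> h t 1"
  unfolding h_def using g_le_self[of 1] by simp

text \<open>The ratio \<open>- ln u / (1 - u)\<close> is strictly decreasing while \<open>(1 - g u) / (1 - u)\<close> is
  nondecreasing, so \<open>h t\<close> crosses the level 1 at most once in \<open>{0<..<1}\<close>.\<close>

lemma one_minus_g_ratio_mono:
  assumes "0 \<le> u" "u \<le> v" "v < 1"
  shows "(1 - g u) * (1 - v) \<le> (1 - g v) * (1 - u)"
proof -
  have s: "summable (\<lambda>n. a n * u ^ (n + 1))" "summable (\<lambda>n. a n * v ^ (n + 1))"
    by (rule summable_g; use assms in simp)+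
  have pull: "(\<Sum>n. a n) * c - g w * c = (\<Sum>n. (a n - a n * w ^ (n + 1)) * c)"
    if "summable (\<lambda>n. a n * w ^ (n + 1))" for w c
    unfolding g_def left_diff_distrib[symmetric] suminf_diff[OF summable that]
    by (rule suminf_mult2[OF summable_diff[OF summable that]])
  \<comment> \<open>With the total mass in place of 1, the comparison can be made term by term,
    through geometric sums that increase in u; the missing mass is compared separately
    afterwards.\<close>
  have "(\<Sum>n. a n) * (1 - v) - g u * (1 - v) \<le> (\<Sum>n. a n) * (1 - u) - g v * (1 - u)"
  proof -
    have "(\<Sum>n. a n) * (1 - v) - g u * (1 - v) = (\<Sum>n. (a n - a n * u ^ (n + 1)) * (1 - v))"
      by (rule pull[OF s(1)])
    also have "\<dots> \<le> (\<Sum>n. (a n - a n * v ^ (n + 1)) * (1 - u))"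
    proof (rule suminf_le)
      fix n
      have "(1 - u ^ (n + 1)) * (1 - v) \<le> (1 - v ^ (n + 1)) * (1 - u)"
      proof -
        have "(\<Sum>p<Suc n. u ^ p) \<le> (\<Sum>p<Suc n. v ^ p)"
          using assms by (intro sum_mono power_mono)
        then have "(1 - u) * (1 - v) * (\<Sum>p<Suc n. u ^ p) \<le> (1 - u) * (1 - v) * (\<Sum>p<Suc n. v ^ p)"
          using assms by (intro mult_left_mono) auto
        then show ?thesis unfolding one_minus_power by (simp only: mult_ac)
      qed
      then have "a n * ((1 - u ^ (n + 1)) * (1 - v)) \<le> a n * ((1 - v ^ (n + 1)) * (1 - u))"
        by (rule mult_left_mono) (rule nonneg)
      then show "(a n - a n * u ^ (n + 1)) * (1 - v) \<le> (a n - a n * v ^ (n + 1)) * (1 - u)"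
        by (simp add: algebra_simps)
    qed (intro summable_mult2 summable_diff s summable)+
    also have "\<dots> = (\<Sum>n. a n) * (1 - u) - g v * (1 - u)"
      by (rule pull[OF s(2), symmetric])
    finally show ?thesis .
  qed
  moreover have "(1 - (\<Sum>n. a n)) * (1 - v) \<le> (1 - (\<Sum>n. a n)) * (1 - u)"
    using le_1 assms by (intro mult_left_mono) auto
  ultimately show ?thesis by (simp add: algebra_simps)
qed

lemma minus_ln_ratio_strict:
  fixes u v :: real
  assumes "0 < u" "u < v" "v < 1"
  shows "- ln v * (1 - u) < - ln u * (1 - v)"
proof -
  \<comment> \<open>\<theta> writes v as a convex combination of u and 1. What follows is strict
    concavity of the logarithm, obtained from its tangent at v.\<close>
  define \<theta> where "\<theta> = (v - u) / (1 - u)"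
  have th: "0 < \<theta>" "\<theta> < 1" using assms by (auto simp: \<theta>_def divide_less_eq)
  have tv: "\<theta> * (1 - u) = v - u" using assms by (simp add: \<theta>_def)
  then have v: "v = (1 - \<theta>) * u + \<theta>" by (simp add: algebra_simps)
  have l1: "ln (u / v) < u / v - 1"
    using ln_le_minus_one[of "u / v"] ln_eq_minus_one[of "u / v"] assms by (fastforce simp: less_le)
  have l2: "ln (1 / v) \<le> 1 / v - 1" using ln_le_minus_one[of "1 / v"] assms by simp
  have "(1 - \<theta>) * ln (u / v) + \<theta> * ln (1 / v) < (1 - \<theta>) * (u / v - 1) + \<theta> * (1 / v - 1)"
    using l1 l2 th by (intro add_less_le_mono mult_strict_left_mono mult_left_mono) auto
  also have "\<dots> = ((1 - \<theta>) * u + \<theta>) / v - 1" using assms by (simp add: field_simps)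
  also have "\<dots> = 0" using v assms by simp
  finally have "(1 - \<theta>) * ln u < ln v" using assms by (simp add: ln_div algebra_simps)
  then have "(1 - \<theta>) * ln u * (1 - u) < ln v * (1 - u)"
    using assms by (intro mult_strict_right_mono) auto
  moreover have "(1 - \<theta>) * (1 - u) = 1 - v" using tv by (simp add: algebra_simps)
  ultimately show ?thesis by (simp add: mult.commute mult.left_commute)
qed

section \<open>The point where h reaches the level 1\<close>

lemma h_ge_1_iff: "0 < u \<Longrightarrow> 1 \<le> h t u \<longleftrightarrow> - ln u \<le> t * (1 - g u)"
  and h_gt_1_iff: "0 < u \<Longrightarrow> 1 < h t u \<longleftrightarrow> - ln u < t * (1 - g u)"
proof -
  assume u: "0 < u"
  then have "h t u = exp (ln u + t * (1 - g u))" by (simp add: h_def exp_add)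
  then show "1 \<le> h t u \<longleftrightarrow> - ln u \<le> t * (1 - g u)" "1 < h t u \<longleftrightarrow> - ln u < t * (1 - g u)" by auto
qed

lemma h_gt_1_upward:
  assumes "0 < u" "u < v" "v < 1" "0 \<le> t" "1 \<le> h t u"
  shows "1 < h t v"
proof -
  have "- ln v * (1 - u) < - ln u * (1 - v)" by (rule minus_ln_ratio_strict) (use assms in auto)
  also have "\<dots> \<le> t * (1 - g u) * (1 - v)"
    using assms h_ge_1_iff[of u t] by (intro mult_right_mono) auto
  also have "\<dots> \<le> t * ((1 - g v) * (1 - u))"
    using one_minus_g_ratio_mono[of u v] assms by (simp add: mult.assoc mult_left_mono)
  finally have "- ln v * (1 - u) < t * (1 - g v) * (1 - u)" by (simp add: mult.assoc)
  then have "- ln v < t * (1 - g v)"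
    using mult_less_cancel_right_pos[of "1 - u" "- ln v"] assms by simp
  then show ?thesis using h_gt_1_iff[of v t] assms by simp
qed

text \<open>The inserted 1 keeps the set nonempty and is the value taken when \<open>h t\<close>
  stays below 1 on the open unit interval.\<close>

definition q :: "real \<Rightarrow> real" where
  "q t = Inf (insert 1 {u. 0 < u \<and> u < 1 \<and> 1 \<le> h t u})"

lemma q_bounds: "0 \<le> q t" "q t \<le> 1"
proof -
  show "0 \<le> q t" unfolding q_def by (rule cInf_greatest) auto
  show "q t \<le> 1" unfolding q_def by (rule cInf_lower) (auto intro!: bdd_belowI[of _ 0])
qed

lemma h_below_q:
  assumes "0 \<le> u" "u < q t"
  shows "h t u < 1"
proof (rule ccontr)
  assume n: "\<not> h t u < 1"
  have "u \<noteq> 0" using n by (auto simp: h_def)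
  then have "u \<in> insert 1 {u. 0 < u \<and> u < 1 \<and> 1 \<le> h t u}" using assms n q_bounds(2)[of t] by auto
  then have "q t \<le> u" unfolding q_def by (rule cInf_lower) (auto intro!: bdd_belowI[of _ 0])
  then show False using assms by simp
qed

lemma h_above_q:
  assumes "0 \<le> t" "q t < u" "u < 1"
  shows "1 < h t u"
proof -
  obtain v where "v \<in> insert 1 {u. 0 < u \<and> u < 1 \<and> 1 \<le> h t u}" "v < u"
    using cInf_lessD[of "insert 1 {u. 0 < u \<and> u < 1 \<and> 1 \<le> h t u}" u] assms(2) unfolding q_def by auto
  then show ?thesis using h_gt_1_upward[of v u t] assms by auto
qed

lemma q_le: "0 \<le> u \<Longrightarrow> 1 \<le> h t u \<Longrightarrow> q t \<le> u"
  using h_below_q[of u t] by fastforce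

lemma le_q:
  assumes "0 \<le> t" "u < 1" "h t u \<le> 1"
  shows "u \<le> q t"
  using h_above_q[OF assms(1) _ assms(2)] assms(3) by fastforce

text \<open>Since h t u \<le> u * exp t, the level 1 is not reached below exp (- t). Positivity
  leaves room for the points u < q t at which the walks are tested.\<close>

lemma q_pos:
  assumes "0 \<le> t"
  shows "0 < q t"
proof -
  have "exp (- t) \<le> q t"
    unfolding q_def
  proof (rule cInf_greatest)
    fix u assume u: "u \<in> insert 1 {u. 0 < u \<and> u < 1 \<and> 1 \<le> h t u}"
    show "exp (- t) \<le> u"
    proof (cases "u = 1")
      case False
      then have "1 \<le> h 0 u * exp t" using u h_add_time_le[of u t 0] assms by simp
      then show ?thesis by (simp add: h_0 exp_minus field_simps)
    qed (use assms in simp)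
  qed simp
  then show ?thesis by (rule less_le_trans[OF exp_gt_zero])
qed

lemma h_at_left_q:
  assumes "0 \<le> t"
  shows "(h t \<longlongrightarrow> h t (q t)) (at_left (q t))"
proof -
  have "continuous_on {0..q t} (h t)"
    by (rule continuous_on_subset[OF continuous_on_h]) (use q_bounds in auto)
  then show ?thesis by (rule continuous_on_Icc_at_leftD) (rule q_pos[OF assms])
qed

text \<open>To the left of q t the values are below 1, to the right above 1, and h is continuous. If
  q t = 1 there is no right-hand side, and \<open>h_at_1\<close> takes its place.\<close>

lemma h_q:
  assumes "0 \<le> t"
  shows "h t (q t) = 1"
proof (rule antisym)
  have "eventually (\<lambda>u. u \<in> {0<..<q t}) (at_left (q t))"
    using q_pos[OF assms] by (rule eventually_at_leftI[rotated]) simp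
  then have "eventually (\<lambda>u. h t u \<le> 1) (at_left (q t))"
    by eventually_elim (use h_below_q[of _ t] in \<open>auto intro: less_imp_le\<close>)
  then show "h t (q t) \<le> 1"
    using h_at_left_q[OF assms] by (intro tendsto_upperbound) auto
  show "1 \<le> h t (q t)"
  proof (cases "q t < 1")
    case True
    have "continuous_on {q t..1} (h t)"
      by (rule continuous_on_subset[OF continuous_on_h]) (use q_bounds in auto)
    then have lim: "(h t \<longlongrightarrow> h t (q t)) (at_right (q t))"
      by (rule continuous_on_Icc_at_rightD) (rule True)
    have "eventually (\<lambda>u. u \<in> {q t<..<1}) (at_right (q t))"
      using True by (rule eventually_at_rightI[rotated]) simp
    then have "eventually (\<lambda>u. 1 \<le> h t u) (at_right (q t))"
      by eventually_elim (use h_above_q[OF assms] in \<open>auto intro: less_imp_le\<close>)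
    then show ?thesis using lim by (intro tendsto_lowerbound) auto
  next
    case False
    then have "q t = 1" using q_bounds(2)[of t] by simp
    then show ?thesis using h_at_1[OF assms] by simp
  qed
qed

section \<open>Dependence of q on time\<close>

lemma continuous_on_h_time: "continuous_on S (\<lambda>t. h t u)"
  unfolding h_def by (intro continuous_intros)

text \<open>For a fixed u strictly on one side of q t, the strict inequality between h t u and 1
  survives a small change of t; \<open>le_q\<close> and \<open>q_le\<close> turn it back into a
  bound on q.\<close>

lemma continuous_on_q: "continuous_on {0..} q"
  unfolding continuous_on_def
proof
  fix t :: real assume "t \<in> {0..}"
  then have t: "0 \<le> t" by simp
  have lim: "((\<lambda>s. h s u) \<longlongrightarrow> h t u) (at t within {0..})" for u
    using continuous_on_h_time[of "{0..}" u] t by (simp add: continuous_on_def)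
  have ev: "eventually (\<lambda>s. 0 \<le> s) (at t within {0..})"
    by (simp add: eventually_at_filter)
  show "(q \<longlongrightarrow> q t) (at t within {0..})"
  proof (rule order_tendstoI)
    fix x assume "x < q t"
    then have "max x 0 < q t" using q_pos[OF t] by simp
    then obtain u where u: "max x 0 < u" "u < q t" using dense by blast
    then have "h t u < 1" using h_below_q[of u t] by simp
    with lim have "eventually (\<lambda>s. h s u < 1) (at t within {0..})" by (rule order_tendstoD)
    with ev show "eventually (\<lambda>s. x < q s) (at t within {0..})"
    proof eventually_elim
      case (elim s)
      have "u \<le> q s" using elim u q_bounds(2)[of t] by (intro le_q) auto
      then show ?case using u by simp
    qed
  next
    fix x assume x: "q t < x"
    show "eventually (\<lambda>s. q s < x) (at t within {0..})"
    proof (cases "1 < x")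
      case True
      have "q s < x" for s using q_bounds(2)[of s] True by linarith
      then show ?thesis by simp
    next
      case False
      obtain u where u: "q t < u" "u < x" using dense x by blast
      have "1 < h t u" using h_above_q[OF t u(1)] u False by simp
      with lim have "eventually (\<lambda>s. 1 < h s u) (at t within {0..})" by (rule order_tendstoD)
      with ev show ?thesis
      proof eventually_elim
        case (elim s)
        have "q s \<le> u" using elim u q_bounds(1)[of t] by (intro q_le) auto
        then show ?case using u by simp
      qed
    qed
  qed
qed

text \<open>As g u \<le> u, the level 1 is reached at u once t * (1 - u) is at least - ln u, for
  every choice of the weights.\<close>

lemma q_tendsto_0: "(q \<longlongrightarrow> 0) at_top"
proof (rule order_tendstoI)
  fix x :: real assume "x < 0"
  then have "x < q t" for t using q_bounds(1)[of t] by linarith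
  then show "eventually (\<lambda>t. x < q t) at_top" by simp
next
  fix x :: real assume x: "0 < x"
  define u where "u = min x 1 / 2"
  have u: "0 < u" "u < 1" "u < x" using x by (auto simp: u_def)
  have "eventually (\<lambda>t. max 0 (- ln u / (1 - u)) \<le> t) at_top" by (rule eventually_ge_at_top)
  then show "eventually (\<lambda>t. q t < x) at_top"
  proof eventually_elim
    case (elim t)
    then have "- ln u \<le> t * (1 - u)" using u pos_divide_le_eq[of "1 - u" "- ln u" t] by simp
    also have "\<dots> \<le> t * (1 - g u)" using elim g_le_self[of u] u by (intro mult_left_mono) auto
    finally have "1 \<le> h t u" using h_ge_1_iff[of u t] u by simp
    then have "q t \<le> u" using u by (intro q_le) auto
    then show ?case using u by simp
  qed
qed

text \<open>Bernoulli's inequality bounds 1 - g u by the mean times 1 - u; then t * (1 - g u) \<le>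
  1 - u \<le> - ln u, and h does not exceed 1. Equality at the critical time is included.\<close>

lemma q_subcritical:
  assumes t: "0 \<le> t" and one: "(\<Sum>n. a n) = 1" and s: "summable (\<lambda>n. real (n + 1) * a n)"
    and le: "t * (\<Sum>n. real (n + 1) * a n) \<le> 1"
  shows "q t = 1"
proof (rule antisym[OF q_bounds(2)], rule dense_le)
  fix u :: real assume u1: "u < 1"
  show "u \<le> q t"
  proof (cases "0 < u")
    case True
    have sg: "summable (\<lambda>n. a n * u ^ (n + 1))" by (rule summable_g) (use True u1 in auto)
    have "1 - g u = (\<Sum>n. a n - a n * u ^ (n + 1))"
      unfolding g_def one[symmetric] by (rule suminf_diff[OF summable sg])
    also have "\<dots> \<le> (\<Sum>n. real (n + 1) * a n * (1 - u))"
    proof (rule suminf_le)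
      fix n
      have "(\<Sum>p<Suc n. u ^ p) \<le> (\<Sum>p<Suc n. 1)" using True u1 by (intro sum_mono power_le_one) auto
      then have "1 - u ^ (n + 1) \<le> (1 - u) * real (n + 1)"
        unfolding one_minus_power using u1 by (intro mult_left_mono) auto
      then have "a n * (1 - u ^ (n + 1)) \<le> a n * ((1 - u) * real (n + 1))"
        by (rule mult_left_mono) (rule nonneg)
      then show "a n - a n * u ^ (n + 1) \<le> real (n + 1) * a n * (1 - u)" by (simp add: algebra_simps)
    qed (intro summable_diff summable sg summable_mult2 s)+
    also have "\<dots> = (\<Sum>n. real (n + 1) * a n) * (1 - u)" using s by (rule suminf_mult2[symmetric])
    finally have "t * (1 - g u) \<le> t * (\<Sum>n. real (n + 1) * a n) * (1 - u)"
      using t by (simp add: mult.assoc mult_left_mono)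
    also have "\<dots> \<le> 1 * (1 - u)" using le u1 by (intro mult_right_mono) auto
    also have "\<dots> \<le> - ln u" using ln_le_minus_one[OF True] by simp
    finally have "h t u \<le> 1" using h_gt_1_iff[OF True, of t] by linarith
    then show ?thesis using t u1 by (intro le_q)
  qed (use q_bounds(1)[of t] in linarith)
qed

lemma q_0: "q 0 = 1"
proof (rule antisym[OF q_bounds(2)], rule dense_le)
  fix u :: real assume "u < 1"
  then show "u \<le> q 0" by (intro le_q) (auto simp: h_0)
qed

text \<open>It suffices to find a u < 1 with h t u > 1, and it is sought near 1. If mass is missing,
  h t 1 > 1 already. Otherwise both sides of the comparison vanish at 1 and their slopes decide: 1
  for - ln u, against t times the mean.\<close>

lemma q_supercritical:
  assumes t: "0 < t"
    and super: "\<not> ((\<Sum>n. a n) = 1 \<and> summable (\<lambda>n. real (n + 1) * a n) \<and>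
      t * (\<Sum>n. real (n + 1) * a n) \<le> 1)"
  shows "q t < 1"
proof -
  have ev: "eventually (\<lambda>u. u \<in> {0<..<1::real}) (at_left 1)"
    by (rule eventually_at_leftI[of 0]) auto
  have "eventually (\<lambda>u. 1 < h t u) (at_left 1)"
  proof (cases "(\<Sum>n. a n) = 1")
    case False
    then have "g 1 < 1" using le_1 by (simp add: g_def)
    then have "1 < h t 1" using t by (simp add: h_def)
    moreover have "(h t \<longlongrightarrow> h t 1) (at_left 1)"
      by (rule continuous_on_Icc_at_leftD[OF continuous_on_h]) simp
    ultimately show ?thesis by (intro order_tendstoD)
  next
    case True
    \<comment> \<open>A finite part of the mean already exceeds 1 / t, so divergence and a large
      finite mean need no separate treatment.\<close>
    have "\<exists>m. 1 < t * (\<Sum>n<m. real (n + 1) * a n)"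
    proof (rule ccontr)
      assume "\<not> (\<exists>m. 1 < t * (\<Sum>n<m. real (n + 1) * a n))"
      then have b: "(\<Sum>n<m. real (n + 1) * a n) \<le> 1 / t" for m
        using t by (simp add: not_less field_simps)
      have s: "summable (\<lambda>n. real (n + 1) * a n)"
        by (rule bounded_imp_summable[where B = "1 / t"]) (use b[of "Suc _"] nonneg in \<open>auto simp: lessThan_Suc_atMost\<close>)
      have "(\<Sum>n. real (n + 1) * a n) \<le> 1 / t" using s b by (rule suminf_le_const)
      then show False using super True s t by (simp add: field_simps)
    qed
    then obtain m where m: "1 < t * (\<Sum>n<m. real (n + 1) * a n)" by blast
    define P where "P u = (\<Sum>n<m. a n * (\<Sum>p<Suc n. u ^ p))" for u
    \<comment> \<open>The extra factor u pays for the bound - ln u \<le> (1 - u) / u used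
      below.\<close>
    have "((\<lambda>u. t * P u * u) \<longlongrightarrow> t * P 1 * 1) (at_left 1)"
      unfolding P_def by (intro tendsto_intros)
    moreover have "P 1 = (\<Sum>n<m. real (n + 1) * a n)" by (simp add: P_def mult.commute)
    ultimately have "eventually (\<lambda>u. 1 < t * P u * u) (at_left 1)"
      using m by (intro order_tendstoD(1)) auto
    with ev show ?thesis
    proof eventually_elim
      case (elim u)
      then have u: "0 < u" "u < 1" by auto
      have sg: "summable (\<lambda>n. a n * u ^ (n + 1))" by (rule summable_g) (use u in auto)
      have "(1 - u) * P u = (\<Sum>n<m. a n - a n * u ^ (n + 1))"
        unfolding P_def sum_distrib_left[of "1 - u"]
      proof (rule sum.cong[OF refl])
        fix n
        have "a n - a n * u ^ (n + 1) = a n * (1 - u ^ (n + 1))" by (simp add: algebra_simps)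
        then show "(1 - u) * (a n * (\<Sum>p<Suc n. u ^ p)) = a n - a n * u ^ (n + 1)"
          unfolding one_minus_power by (simp only: mult_ac)
      qed
      also have "\<dots> \<le> (\<Sum>n. a n - a n * u ^ (n + 1))"
        using u by (intro sum_le_suminf summable_diff summable sg)
          (auto simp: nonneg mult_left_le power_le_one mult_le_one)
      also have "\<dots> = 1 - g u"
        unfolding g_def True[symmetric] by (rule suminf_diff[OF summable sg, symmetric])
      finally have P: "t * ((1 - u) * P u) \<le> t * (1 - g u)" using t by simp
      have "- ln u = ln (1 / u)" using u by (simp add: ln_div)
      also have "\<dots> \<le> 1 / u - 1" using ln_le_minus_one[of "1 / u"] u by simp
      also have "\<dots> = (1 - u) * (1 / u)" using u by (simp add: field_simps)
      also have "\<dots> < (1 - u) * (t * P u)"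
        using elim u by (intro mult_strict_left_mono) (auto simp: field_simps)
      also have "\<dots> \<le> t * (1 - g u)" using P by (simp add: algebra_simps)
      finally show ?case using h_gt_1_iff[OF u(1), of t] by simp
    qed
  qed
  then have "eventually (\<lambda>u. 1 < h t u \<and> u \<in> {0<..<1}) (at_left 1)" using ev by eventually_elim auto
  then obtain u where "1 < h t u" "u \<in> {0<..<1}"
    using eventually_happens'[OF trivial_limit_at_left_real] by blast
  then show ?thesis using q_le[of u t] by auto
qed

end

section \<open>Markov semigroups on finite sets\<close>

definition semigroup_op :: "'s set \<Rightarrow> (real \<Rightarrow> 's \<Rightarrow> 's pmf) \<Rightarrow> real \<Rightarrow> ('s \<Rightarrow> real) \<Rightarrow> 's \<Rightarrow> real" where
  "semigroup_op X p t f x = (\<Sum>y\<in>X. pmf (p t x) y * f y)"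

locale finite_semigroup =
  fixes X :: "'s set" and p :: "real \<Rightarrow> 's \<Rightarrow> 's pmf" and H :: "('s \<Rightarrow> real) \<Rightarrow> 's \<Rightarrow> real"
  assumes fin: "finite X" and semi: "transition_semigroup X p" and gen: "has_generator X p H"
begin

abbreviation "P \<equiv> semigroup_op X p"

lemma supp: "0 \<le> t \<Longrightarrow> x \<in> X \<Longrightarrow> set_pmf (p t x) \<subseteq> X"
  using semi unfolding transition_semigroup_def by blast

lemma expectation_eq: "0 \<le> t \<Longrightarrow> x \<in> X \<Longrightarrow> measure_pmf.expectation (p t x) f = P t f x"
  unfolding semigroup_op_def
  using integral_measure_pmf_real[OF fin, of "p t x" f] supp[of t x] by (auto simp: mult.commute)

lemma P_const:
  assumes "0 \<le> t" "x \<in> X"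
  shows "P t (\<lambda>_. c) x = c"
  using expectation_eq[OF assms, of "\<lambda>_. c"] by simp

lemma P_0: "x \<in> X \<Longrightarrow> P 0 f x = f x"
  using expectation_eq[of 0 x f] semi unfolding transition_semigroup_def by simp

lemma P_add:
  assumes "0 \<le> s" "0 \<le> t" "x \<in> X"
  shows "P (s + t) f x = P s (P t f) x"
proof -
  have b: "p (s + t) x = bind_pmf (p s x) (p t)" using semi assms unfolding transition_semigroup_def by blast
  have "pmf (p (s + t) x) z = (\<Sum>y\<in>X. pmf (p s x) y * pmf (p t y) z)" for z
    unfolding b pmf_bind using expectation_eq[OF assms(1,3), of "\<lambda>y. pmf (p t y) z"]
    by (simp add: semigroup_op_def)
  then have "P (s + t) f x = (\<Sum>z\<in>X. \<Sum>y\<in>X. pmf (p s x) y * (pmf (p t y) z * f z))"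
    unfolding semigroup_op_def by (simp add: sum_distrib_right mult.assoc)
  also have "\<dots> = (\<Sum>y\<in>X. \<Sum>z\<in>X. pmf (p s x) y * (pmf (p t y) z * f z))" by (rule sum.swap)
  finally show ?thesis unfolding semigroup_op_def by (simp add: sum_distrib_left)
qed

lemma P_mono:
  assumes "0 \<le> t" "x \<in> X" "\<And>y. y \<in> X \<Longrightarrow> f y \<le> f' y"
  shows "P t f x \<le> P t f' x"
  unfolding semigroup_op_def using assms by (intro sum_mono mult_left_mono) auto

lemma P_diff: "P t (\<lambda>y. f y - f' y) x = P t f x - P t f' x"
  unfolding semigroup_op_def by (simp add: right_diff_distrib sum_subtractf)

lemma P_cmult: "P t (\<lambda>y. c * f y) x = c * P t f x"
  unfolding semigroup_op_def by (simp add: sum_distrib_left mult_ac)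

lemma generator_lim:
  assumes "x \<in> X"
  shows "((\<lambda>t. (P t f x - f x) / t) \<longlongrightarrow> H f x) (at_right 0)"
proof -
  have "((\<lambda>t. (measure_pmf.expectation (p t x) f - f x) / t) \<longlongrightarrow> H f x) (at_right 0)"
    using gen assms unfolding has_generator_def by blast
  moreover have "eventually (\<lambda>t. (measure_pmf.expectation (p t x) f - f x) / t = (P t f x - f x) / t) (at_right 0)"
    using eventually_at_right_less[of 0] by eventually_elim (use assms in \<open>simp add: expectation_eq\<close>)
  ultimately show ?thesis by (rule Lim_transform_eventually)
qed

lemma increment_lim:
  assumes "x \<in> X"
  shows "((\<lambda>t. P t f x - f x) \<longlongrightarrow> 0) (at_right 0)"
proof -
  have "((\<lambda>t. t * ((P t f x - f x) / t)) \<longlongrightarrow> 0 * H f x) (at_right 0)"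
    by (intro tendsto_mult generator_lim assms) (simp add: tendsto_ident_at)
  moreover have "eventually (\<lambda>t. t * ((P t f x - f x) / t) = P t f x - f x) (at_right (0::real))"
    using eventually_at_right_less[of 0] by eventually_elim simp
  ultimately show ?thesis by (auto intro: Lim_transform_eventually)
qed

lemma P_abs_le:
  assumes "0 \<le> t" "x \<in> X"
  shows "\<bar>P t f x\<bar> \<le> (\<Sum>y\<in>X. \<bar>f y\<bar>)"
  unfolding semigroup_op_def
  by (rule order_trans[OF sum_abs sum_mono]) (auto simp: abs_mult pmf_le_1 intro: mult_left_le_one_le)

lemma right_derivative:
  assumes "0 \<le> t" "x \<in> X"
  shows "((\<lambda>e. (P (t + e) f x - P t f x) / e) \<longlongrightarrow> P t (H f) x) (at_right 0)"
proof -
  have "((\<lambda>e. \<Sum>y\<in>X. pmf (p t x) y * ((P e f y - f y) / e)) \<longlongrightarrow> P t (H f) x) (at_right 0)"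
    unfolding semigroup_op_def[of X p t "H f"] by (intro tendsto_intros generator_lim)
  moreover have "eventually (\<lambda>e. (\<Sum>y\<in>X. pmf (p t x) y * ((P e f y - f y) / e)) = (P (t + e) f x - P t f x) / e)
      (at_right 0)"
    using eventually_at_right_less[of 0]
  proof eventually_elim
    case (elim e)
    have "P (t + e) f x - P t f x = P t (\<lambda>y. P e f y - f y) x"
      using P_add[OF assms(1) _ assms(2), of e f] elim by (simp add: P_diff)
    then show ?case by (simp add: semigroup_op_def[of X p t] sum_divide_distrib)
  qed
  ultimately show ?thesis by (rule Lim_transform_eventually)
qed

lemma left_continuous:
  assumes "0 < t" "x \<in> X"
  shows "((\<lambda>e. P (t - e) f x) \<longlongrightarrow> P t f x) (at_right 0)"
proof -
  have ev: "eventually (\<lambda>e. e \<in> {0<..<t}) (at_right 0)"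
    using assms(1) by (rule eventually_at_rightI[rotated]) simp
  have "((\<lambda>e. \<Sum>y\<in>X. \<bar>P e f y - f y\<bar>) \<longlongrightarrow> (\<Sum>y\<in>X. \<bar>0\<bar>)) (at_right 0)"
    by (intro tendsto_intros increment_lim)
  then have "((\<lambda>e. \<Sum>y\<in>X. \<bar>P e f y - f y\<bar>) \<longlongrightarrow> 0) (at_right 0)" by simp
  moreover have "eventually (\<lambda>e. norm (P (t - e) f x - P t f x) \<le> (\<Sum>y\<in>X. \<bar>P e f y - f y\<bar>)) (at_right 0)"
    using ev
  proof eventually_elim
    case (elim e)
    have "P t f x - P (t - e) f x = P (t - e) (\<lambda>y. P e f y - f y) x"
      using P_add[of "t - e" e x f] elim assms by (simp add: P_diff)
    then have "\<bar>P t f x - P (t - e) f x\<bar> \<le> (\<Sum>y\<in>X. \<bar>P e f y - f y\<bar>)"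
      using P_abs_le[of "t - e" x] elim assms by simp
    then show ?case by (simp add: abs_minus_commute)
  qed
  ultimately have "((\<lambda>e. P (t - e) f x - P t f x) \<longlongrightarrow> 0) (at_right 0)"
    by (rule Lim_null_comparison[rotated])
  then show ?thesis by (simp add: LIM_zero_iff)
qed

text \<open>The generator only gives information to the right of 0. Here P t f - P (t - e) f is the
  mean of P e f - f under the law at time t - e, and \<open>left_continuous\<close>, applied to
  indicators, makes that law converge to the one at t.\<close>

lemma left_derivative:
  assumes "0 < t" "x \<in> X"
  shows "((\<lambda>e. (P (t - e) f x - P t f x) / - e) \<longlongrightarrow> P t (H f) x) (at_right 0)"
proof -
  have ev: "eventually (\<lambda>e. e \<in> {0<..<t}) (at_right 0)"
    using assms(1) by (rule eventually_at_rightI[rotated]) simp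
  have pm: "P s (\<lambda>z. of_bool (z = y)) x = pmf (p s x) y" if "y \<in> X" for s y
    unfolding semigroup_op_def using that fin by (simp add: of_bool_def if_distrib sum.delta cong: if_cong)
  have lim: "((\<lambda>e. pmf (p (t - e) x) y) \<longlongrightarrow> pmf (p t x) y) (at_right 0)" if "y \<in> X" for y
    using left_continuous[OF assms, of "\<lambda>z. of_bool (z = y)"] unfolding pm[OF that] .
  have "((\<lambda>e. \<Sum>y\<in>X. pmf (p (t - e) x) y * ((P e f y - f y) / e)) \<longlongrightarrow> P t (H f) x) (at_right 0)"
    unfolding semigroup_op_def[of X p t "H f"] by (intro tendsto_intros generator_lim lim)
  moreover have "eventually (\<lambda>e. (\<Sum>y\<in>X. pmf (p (t - e) x) y * ((P e f y - f y) / e)) =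
      (P (t - e) f x - P t f x) / - e) (at_right 0)"
    using ev
  proof eventually_elim
    case (elim e)
    have "P t f x - P (t - e) f x = P (t - e) (\<lambda>y. P e f y - f y) x"
      using P_add[of "t - e" e x f] elim assms by (simp add: P_diff)
    then have "(P t f x - P (t - e) f x) / e = (\<Sum>y\<in>X. pmf (p (t - e) x) y * ((P e f y - f y) / e))"
      by (simp add: semigroup_op_def[of X p "t - e" "\<lambda>y. P e f y - f y"] sum_divide_distrib)
    moreover have "(P t f x - P (t - e) f x) / e = (P (t - e) f x - P t f x) / - e"
      by (simp add: diff_divide_distrib)
    ultimately show ?case by (simp only:)
  qed
  ultimately show ?thesis by (rule Lim_transform_eventually)
qed

lemma has_derivative_P:
  assumes "0 < t" "x \<in> X"
  shows "((\<lambda>s. P s f x) has_real_derivative P t (H f) x) (at t)"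
proof -
  have r: "((\<lambda>e. (P (t + e) f x - P t f x) / e) \<longlongrightarrow> P t (H f) x) (at_right 0)"
    using assms by (intro right_derivative) auto
  have "((\<lambda>e. (P (t + e) f x - P t f x) / e) \<longlongrightarrow> P t (H f) x) (at_left 0)"
    using left_derivative[OF assms, of f]
    unfolding filterlim_at_left_to_right[of _ _ "0::real"] by simp
  with r show ?thesis unfolding DERIV_def by (simp add: filterlim_split_at)
qed

lemma right_continuous_0:
  assumes "x \<in> X"
  shows "((\<lambda>s. P s f x) \<longlongrightarrow> P 0 f x) (at_right 0)"
  using increment_lim[OF assms, of f] P_0[OF assms] by (simp add: LIM_zero_iff)

lemma continuous_on_P:
  assumes "x \<in> X"
  shows "continuous_on {0..b} (\<lambda>s. P s f x)"
  unfolding continuous_on_def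
proof
  fix t assume t: "t \<in> {0..b}"
  show "((\<lambda>s. P s f x) \<longlongrightarrow> P t f x) (at t within {0..b})"
  proof (cases "t = 0")
    case True
    show ?thesis unfolding True
      by (rule filterlim_mono[OF right_continuous_0[OF assms] order_refl])
        (auto simp: at_within_def intro!: le_infI1 le_infI2)
  next
    case False
    then have "isCont (\<lambda>s. P s f x) t"
      using DERIV_isCont[OF has_derivative_P[OF _ assms]] t by simp
    then show ?thesis by (auto simp: isCont_def intro: tendsto_within_subset)
  qed
qed

text \<open>The test function depends on time, so that it can follow a characteristic: the mean of
  \<open>F t\<close> has derivative P t applied to \<open>F' t\<close> plus \<open>H (F t)\<close>,
  which the drift condition controls.\<close>

lemma gronwall:
  fixes F F' :: "real \<Rightarrow> 's \<Rightarrow> real"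
  assumes x: "x \<in> X" and T: "0 \<le> T"
    and F': "\<And>t y. y \<in> X \<Longrightarrow> 0 \<le> t \<Longrightarrow> t \<le> T \<Longrightarrow> ((\<lambda>s. F s y) has_real_derivative F' t y) (at t)"
    and drift: "\<And>t y. y \<in> X \<Longrightarrow> 0 \<le> t \<Longrightarrow> t \<le> T \<Longrightarrow> F' t y + H (F t) y \<le> k * F t y + \<epsilon>"
    and start: "F 0 x = 0" and k: "0 \<le> k" and \<epsilon>: "0 \<le> \<epsilon>"
  shows "P T (F T) x \<le> \<epsilon> * T * exp (k * T)"
proof -
  define u where "u t = P t (F t) x" for t
  \<comment> \<open>\<open>H\<close> is given only through the limits at 0. Linearity on the finite
    state space is inherited from the semigroup, by expanding f in indicators.\<close>
  have lin: "H f y = (\<Sum>z\<in>X. f z * H (\<lambda>w. of_bool (w = z)) y)" if "y \<in> X" for f y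
  proof -
    have "((\<lambda>t. \<Sum>z\<in>X. f z * ((P t (\<lambda>w. of_bool (w = z)) y - of_bool (y = z)) / t)) \<longlongrightarrow>
        (\<Sum>z\<in>X. f z * H (\<lambda>w. of_bool (w = z)) y)) (at_right 0)"
      by (intro tendsto_intros generator_lim that)
    moreover have "(\<Sum>z\<in>X. f z * ((P t (\<lambda>w. of_bool (w = z)) y - of_bool (y = z)) / t)) = (P t f y - f y) / t" for t
    proof -
      have "P t f y = (\<Sum>z\<in>X. f z * P t (\<lambda>w. of_bool (w = z)) y)"
        unfolding semigroup_op_def using fin
        by (intro sum.cong refl) (simp add: of_bool_def if_distrib sum.delta cong: if_cong)
      moreover have "f y = (\<Sum>z\<in>X. f z * of_bool (y = z))"
        using fin that by (simp add: of_bool_def if_distrib sum.delta' cong: if_cong)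
      ultimately have "P t f y - f y = (\<Sum>z\<in>X. f z * (P t (\<lambda>w. of_bool (w = z)) y - of_bool (y = z)))"
        by (simp only: sum_subtractf[symmetric] right_diff_distrib[symmetric])
      then show ?thesis by (simp add: sum_divide_distrib)
    qed
    ultimately show ?thesis
      using tendsto_unique[OF _ generator_lim[OF that, of f]] by force
  qed
  have deriv: "(u has_real_derivative P t (F' t) x + P t (H (F t)) x) (at t)" if t: "0 < t" "t \<le> T" for t
  proof -
    have pm: "P s (\<lambda>z. of_bool (z = y)) x = pmf (p s x) y" if "y \<in> X" for s y
      unfolding semigroup_op_def using that fin by (simp add: of_bool_def if_distrib sum.delta cong: if_cong)
    \<comment> \<open>As a finite sum over states, each term is a product of two functions of time,
      and the ordinary product rule applies.\<close>
    have u: "u = (\<lambda>s. \<Sum>y\<in>X. F s y * P s (\<lambda>z. of_bool (z = y)) x)"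
      unfolding u_def semigroup_op_def[of X p _ "F _"]
      by (intro ext sum.cong refl) (simp add: pm)
    have "(u has_real_derivative (\<Sum>y\<in>X. F' t y * P t (\<lambda>z. of_bool (z = y)) x +
        P t (H (\<lambda>z. of_bool (z = y))) x * F t y)) (at t)"
      unfolding u using t by (intro DERIV_sum DERIV_mult F' has_derivative_P x) auto
    moreover have "(\<Sum>y\<in>X. F' t y * P t (\<lambda>z. of_bool (z = y)) x) = P t (F' t) x"
      unfolding semigroup_op_def[of X p t "F' t"] by (intro sum.cong refl) (simp add: pm)
    moreover have "(\<Sum>y\<in>X. P t (H (\<lambda>z. of_bool (z = y))) x * F t y) = P t (H (F t)) x"
    proof -
      have "P t (H (F t)) x = (\<Sum>w\<in>X. \<Sum>y\<in>X. pmf (p t x) w * (F t y * H (\<lambda>z. of_bool (z = y)) w))"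
        unfolding semigroup_op_def by (intro sum.cong refl) (simp add: lin[of _ "F t"] sum_distrib_left)
      also have "\<dots> = (\<Sum>y\<in>X. \<Sum>w\<in>X. pmf (p t x) w * (F t y * H (\<lambda>z. of_bool (z = y)) w))"
        by (rule sum.swap)
      also have "\<dots> = (\<Sum>y\<in>X. P t (H (\<lambda>z. of_bool (z = y))) x * F t y)"
        unfolding semigroup_op_def by (intro sum.cong refl) (simp add: sum_distrib_right sum_distrib_left mult_ac)
      finally show ?thesis by simp
    qed
    ultimately show ?thesis by (simp add: sum.distrib)
  qed
  \<comment> \<open>The usual integrating factor; subtracting \<epsilon> * t absorbs the error term,
    as exp (- k * t) \<le> 1.\<close>
  define v where "v t = exp (- k * t) * u t - \<epsilon> * t" for t
  have "v T \<le> v 0"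
  proof (rule DERIV_nonpos_imp_decreasing_open[OF T])
    fix t assume t: "0 < t" "t < T"
    let ?d = "P t (F' t) x + P t (H (F t)) x"
    have d: "(v has_real_derivative (exp (- k * t) * (- k)) * u t + exp (- k * t) * ?d - \<epsilon>) (at t)"
      unfolding v_def using t by (auto intro!: derivative_eq_intros deriv)
    have "?d = P t (\<lambda>y. F' t y + H (F t) y) x"
      unfolding semigroup_op_def by (simp add: distrib_left sum.distrib)
    also have "\<dots> \<le> P t (\<lambda>y. k * F t y - (- \<epsilon>)) x"
      using drift[of _ t] t x by (intro P_mono) auto
    also have "\<dots> = k * u t + \<epsilon>"
      unfolding P_diff P_cmult u_def using P_const[of t x "- \<epsilon>"] t x by simp
    finally have "exp (- k * t) * ?d \<le> exp (- k * t) * (k * u t + \<epsilon>)" by simp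
    also have "\<dots> \<le> exp (- k * t) * (k * u t) + \<epsilon>"
      using \<epsilon> k t by (auto simp: algebra_simps intro!: mult_left_le)
    finally show "\<exists>y. (v has_real_derivative y) (at t) \<and> y \<le> 0"
      using d by (intro exI[of _ "(exp (- k * t) * (- k)) * u t + exp (- k * t) * ?d - \<epsilon>"]) (simp add: algebra_simps)
  next
    have "continuous_on {0..T} (\<lambda>s. F s y)" if "y \<in> X" for y
      using F'[OF that] by (intro continuous_at_imp_continuous_on ballI) (auto intro: DERIV_isCont)
    moreover have "pmf (p s x) y = P s (\<lambda>z. of_bool (z = y)) x" if "y \<in> X" for s y
      unfolding semigroup_op_def using that fin by (simp add: of_bool_def if_distrib sum.delta cong: if_cong)
    ultimately show "continuous_on {0..T} v"
      unfolding v_def u_def semigroup_op_def[of X p _ "F _"]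
      by (auto intro!: continuous_intros continuous_on_P x simp: semigroup_op_def[of X p _ "F _"])
  qed
  moreover have "v 0 = 0" using P_0[OF x] start by (simp add: v_def u_def)
  ultimately have "exp (- k * T) * u T \<le> \<epsilon> * T" by (simp add: v_def)
  then have "exp (k * T) * (exp (- k * T) * u T) \<le> exp (k * T) * (\<epsilon> * T)" by simp
  moreover have "exp (k * T) * (exp (- k * T) * y) = y" for y :: real by (simp add: exp_minus)
  ultimately have "u T \<le> exp (k * T) * (\<epsilon> * T)" by (simp only:)
  then show ?thesis by (simp only: u_def mult_ac)
qed

end

text \<open>Take the Markov property at s = 0: the conditional probability is almost surely the
  constant \<open>pmf (p t x) y\<close>, and integrating it gives the law at t. From here on the
  walk is replaced by its semigroup on a finite set.\<close>

lemma law_of_markov_process: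
  assumes fin: "finite X" and mk: "markov_process M X S p" and x: "x \<in> X" and st: "AE w in M. S 0 w = x"
    and t: "0 \<le> t"
  shows "(\<integral>w. f (S t w) \<partial>M) = semigroup_op X p t f x"
proof -
  have ps: "prob_space M" and meas: "\<And>t. 0 \<le> t \<Longrightarrow> S t \<in> measurable M (count_space X)"
    using mk unfolding markov_process_def by auto
  interpret prob_space M by (rule ps)
  let ?F = "natural_filtration M X S 0"
  have sp: "space ?F = space M"
    unfolding natural_filtration_def by (simp add: space_measure_of_conv)
  have "{S u -` A \<inter> space M | u A. u \<in> {0..0} \<and> A \<subseteq> X} \<subseteq> sets M"
  proof clarsimp
    fix A assume "A \<subseteq> X"
    then show "S 0 -` A \<inter> space M \<in> sets M" using meas[of 0] by (auto intro: measurable_sets)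
  qed
  then have "sets ?F \<subseteq> sets M"
    unfolding natural_filtration_def by (simp add: sets_measure_of_conv sets.sigma_sets_subset)
  then have sub: "subalgebra M ?F" unfolding subalgebra_def using sp by simp
  interpret finite_measure_subalgebra M ?F by unfold_locales (rule sub)
  have law: "measure M {v \<in> space M. S t v = y} = pmf (p t x) y" if y: "y \<in> X" for y
  proof -
    have ms: "{v \<in> space M. S t v = y} \<in> sets M"
      using measurable_sets[OF meas[OF t], of "{y}"] y by (simp add: vimage_def Int_def conj_commute)
    let ?I = "indicat_real {v \<in> space M. S t v = y}"
    have "AE w in M. real_cond_exp M ?F (indicat_real {v \<in> space M. S (0 + t) v = y}) w = pmf (p t (S 0 w)) y"
      using mk t y unfolding markov_process_def by blast
    then have ae: "AE w in M. real_cond_exp M ?F ?I w = pmf (p t x) y"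
      using st by eventually_elim simp
    have "measure M {v \<in> space M. S t v = y} = (\<integral>w. ?I w \<partial>M)" using ms by simp
    also have "\<dots> = (\<integral>w. real_cond_exp M ?F ?I w \<partial>M)"
      by (intro real_cond_exp_int(2)[symmetric] integrable_real_indicator ms) (simp add: emeasure_eq_measure)
    also have "\<dots> = (\<integral>w. pmf (p t x) y \<partial>M)"
      using ae by (intro integral_cong_AE) auto
    also have "\<dots> = pmf (p t x) y" by (simp add: prob_space)
    finally show ?thesis .
  qed
  have "(\<integral>w. f (S t w) \<partial>M) = (\<integral>w. (\<Sum>y\<in>X. f y * indicat_real {v \<in> space M. S t v = y} w) \<partial>M)"
  proof (rule Bochner_Integration.integral_cong[OF refl])
    fix w assume w: "w \<in> space M"
    then have "S t w \<in> X" using measurable_space[OF meas[OF t]] by simp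
    then show "f (S t w) = (\<Sum>y\<in>X. f y * indicat_real {v \<in> space M. S t v = y} w)"
      using fin w by (simp add: indicator_def if_distrib sum.delta cong: if_cong)
  qed
  also have "\<dots> = (\<Sum>y\<in>X. \<integral>w. f y * indicat_real {v \<in> space M. S t v = y} w \<partial>M)"
  proof (rule Bochner_Integration.integral_sum)
    fix y assume y: "y \<in> X"
    have "{v \<in> space M. S t v = y} \<in> sets M"
      using measurable_sets[OF meas[OF t], of "{y}"] y by (simp add: vimage_def Int_def conj_commute)
    then have "integrable M (indicat_real {v \<in> space M. S t v = y})"
      by (rule integrable_real_indicator) (simp add: emeasure_eq_measure)
    then show "integrable M (\<lambda>w. f y * indicat_real {v \<in> space M. S t v = y} w)"
      by simp
  qed
  also have "\<dots> = (\<Sum>y\<in>X. f y * pmf (p t x) y)"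
  proof (rule sum.cong[OF refl])
    fix y assume y: "y \<in> X"
    have "{v \<in> space M. S t v = y} \<in> sets M"
      using measurable_sets[OF meas[OF t], of "{y}"] y by (simp add: vimage_def Int_def conj_commute)
    then show "(\<integral>w. f y * indicat_real {v \<in> space M. S t v = y} w \<partial>M) = f y * pmf (p t x) y"
      using law[OF y] by simp
  qed
  finally show ?thesis by (simp add: semigroup_op_def mult.commute)
qed

section \<open>Limits of the walks\<close>

lemma power_times_bounded:
  fixes r :: real
  assumes "0 \<le> r" "r < 1"
  obtains c where "0 < c" "\<And>n. real n * r ^ n \<le> c"
proof -
  have "(\<lambda>n. real n * r ^ n) \<longlonglongrightarrow> 0" using assms by (intro powser_times_n_limit_0) simp
  then have "Bseq (\<lambda>n. real n * r ^ n)" using convergent_imp_Bseq convergentI by blast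
  then obtain c where "0 < c" "\<And>n. norm (real n * r ^ n) \<le> c" by (rule BseqE) blast
  then show ?thesis using that[of c] assms by simp
qed

lemma cycle_gf_bounds:
  assumes p: "p permutes {1..N}" and z: "0 \<le> z" "z \<le> 1"
  shows "0 \<le> cycle_gf N z p" "cycle_gf N z p \<le> z" "0 \<le> cycle_gf' N z p"
proof -
  show "0 \<le> cycle_gf N z p" "0 \<le> cycle_gf' N z p"
    unfolding cycle_gf_def cycle_gf'_def using z by (auto intro!: divide_nonneg_nonneg sum_nonneg)
  have perm: "permutation p" using p permutation_permutes by blast
  have "(\<Sum>j=1..N. z ^ least_power p j) \<le> (\<Sum>j=1..N. z)"
  proof (rule sum_mono)
    fix j
    have "z ^ least_power p j \<le> z ^ 1"
      by (rule power_decreasing) (use z least_power_of_permutation(2)[OF perm, of j] in auto)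
    then show "z ^ least_power p j \<le> z" by simp
  qed
  then show "cycle_gf N z p \<le> z"
    unfolding cycle_gf_def using z by (cases "N = 0") (auto simp: divide_le_eq mult.commute)
qed

lemma cycle_gf'_le:
  assumes "\<And>n. real n * z ^ n \<le> c" "0 < N"
  shows "cycle_gf' N z p \<le> c"
proof -
  have "(\<Sum>j=1..N. real (least_power p j) * z ^ least_power p j) \<le> (\<Sum>j=1..N. c)"
    by (intro sum_mono assms)
  then show ?thesis unfolding cycle_gf'_def using assms(2) by (simp add: divide_le_eq mult.commute)
qed

text \<open>The identity defining the square field: the last term is its value at f, which measures
  the noise produced by the jumps.\<close>

lemma walk_generator_square:
  "walk_generator N K (\<lambda>p. (f p - u)\<^sup>2) p =
    2 * (f p - u) * walk_generator N K f p +
    real N / real (class_support N K) * (1 / real (card K)) * (\<Sum>s\<in>K. (f (s \<circ> p) - f p)\<^sup>2)"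
proof -
  have "(\<Sum>s\<in>K. (f (s \<circ> p) - u)\<^sup>2 - (f p - u)\<^sup>2) =
      2 * (f p - u) * (\<Sum>s\<in>K. f (s \<circ> p) - f p) + (\<Sum>s\<in>K. (f (s \<circ> p) - f p)\<^sup>2)"
    unfolding sum_distrib_left sum.distrib[symmetric]
    by (intro sum.cong refl) (simp add: power2_eq_square algebra_simps)
  then show ?thesis unfolding walk_generator_def by (simp only: distrib_left mult_ac)
qed

text \<open>Squared jumps of order (A / N) squared at rate N / A leave a noise of order A / N, which
  vanishes exactly by evanescence.\<close>

lemma (in nontrivial_class) walk_generator_square_le:
  assumes p: "p permutes {1..N}" and c: "\<And>n. real n * z ^ n \<le> c" and z: "0 \<le> z"
  shows "walk_generator N K (\<lambda>p. (cycle_gf N z p - u)\<^sup>2) p \<le>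
    2 * (cycle_gf N z p - u) * walk_generator N K (cycle_gf N z) p + c\<^sup>2 * (real (class_support N K) / real N)"
proof -
  let ?A = "real (class_support N K)"
  have Np: "0 < real N" and Ap: "0 < ?A" and kp: "0 < real (card K)"
    using N class_support_pos card_class_pos by auto
  have "(\<Sum>s\<in>K. (cycle_gf N z (s \<circ> p) - cycle_gf N z p)\<^sup>2) \<le> (\<Sum>s\<in>K. (c * ?A / real N)\<^sup>2)"
    using cycle_gf_comp_diff_bound[OF _ p c z]
    by (intro sum_mono) (metis abs_le_square_iff abs_ge_self order_trans power2_abs power_mono abs_ge_zero)
  then have "real N / ?A * (1 / real (card K)) * (\<Sum>s\<in>K. (cycle_gf N z (s \<circ> p) - cycle_gf N z p)\<^sup>2) \<le>
      real N / ?A * (1 / real (card K)) * (real (card K) * (c * ?A / real N)\<^sup>2)"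
    using Np Ap kp by (intro mult_left_mono) auto
  also have "\<dots> = c\<^sup>2 * (?A / real N)"
    using Np Ap kp by (simp add: power2_eq_square field_simps)
  finally show ?thesis unfolding walk_generator_square by simp
qed

section \<open>The limit of the generators\<close>

locale class_sequence =
  fixes C :: "nat \<Rightarrow> (nat \<Rightarrow> nat) set" and l :: "nat \<Rightarrow> real"
  assumes conj: "2 \<le> N \<Longrightarrow> conjugacy_class (sym_group N) (C N)"
    and nontriv: "2 \<le> N \<Longrightarrow> C N \<noteq> {id}"
    and conv: "classes_converge C l 0"
begin

lemma nontrivial_class: "2 \<le> N \<Longrightarrow> nontrivial_class N (C N)"
  by unfold_locales (use conj nontriv in auto)

definition a :: "nat \<Rightarrow> real" where
  "a n = l (n + 2)"

lemma a_has_sum: "(a has_sum (\<Sum>\<^sub>\<infinity>i\<in>{2..}. l i)) UNIV"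
proof -
  have "(l has_sum (\<Sum>\<^sub>\<infinity>i\<in>{2..}. l i)) {2..}"
    using conv unfolding classes_converge_def by (simp add: has_sum_infsum)
  moreover have "bij_betw (\<lambda>n. n + 2) UNIV {2::nat..}"
    by (rule bij_betw_byWitness[where f' = "\<lambda>n. n - 2"]) auto
  ultimately show ?thesis
    unfolding a_def[abs_def] using has_sum_reindex_bij_betw[of "\<lambda>n. n + 2" UNIV "{2..}" l] by simp
qed

sublocale offspring a
proof
  have s: "a sums (\<Sum>\<^sub>\<infinity>i\<in>{2..}. l i)" by (rule has_sum_imp_sums[OF a_has_sum])
  show "0 \<le> a n" for n using conv unfolding classes_converge_def by (simp add: a_def)
  show "summable a" using s by (rule sums_summable)
  show "(\<Sum>n. a n) \<le> 1"
    using s conv unfolding classes_converge_def by (simp add: sums_iff)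
qed

lemma support_ratio: "(\<lambda>N. real (class_support N (C N)) / real N) \<longlonglongrightarrow> 0"
proof -
  have "(\<lambda>N. 1 - real (class_count N (C N) 1) / real N) \<longlonglongrightarrow> 1 - (1 - 0)"
    using conv unfolding classes_converge_def by (intro tendsto_diff tendsto_const) auto
  moreover have "eventually (\<lambda>N. 1 - real (class_count N (C N) 1) / real N =
      real (class_support N (C N)) / real N) sequentially"
    using eventually_ge_at_top[of 2]
  proof eventually_elim
    case (elim N)
    interpret nontrivial_class N "C N" by (rule nontrivial_class[OF elim])
    have "class_count N (C N) 1 \<le> N"
    proof -
      obtain s where "s \<in> C N" using class_nonempty by blast
      then have "class_count N (C N) 1 = card {j \<in> {1..N}. least_power s j = 1}"
        using period_count_class unfolding period_count_def by metis
      also have "\<dots> \<le> card {1..N}" by (rule card_mono) auto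
      finally show ?thesis by simp
    qed
    then show ?case using elim by (simp add: class_support_def of_nat_diff field_simps)
  qed
  ultimately show ?thesis by (auto intro: Lim_transform_eventually)
qed

text \<open>Uniformity in z up to r is essential, since z moves along the characteristic; all bounds
  are increasing in z, so they are taken at r.\<close>

lemma generator_limit:
  assumes r: "0 \<le> r" "r < 1" and \<epsilon>: "0 < \<epsilon>"
  shows "eventually (\<lambda>N. \<forall>z p. 0 \<le> z \<longrightarrow> z \<le> r \<longrightarrow> p permutes {1..N} \<longrightarrow>
    \<bar>walk_generator N (C N) (cycle_gf N z) p + cycle_gf' N z p * (1 - g (cycle_gf N z p))\<bar> \<le> \<epsilon>) sequentially"
proof -
  obtain c where c: "0 < c" "\<And>n. real n * r ^ n \<le> c" using power_times_bounded[OF r] by blast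
  have "(\<lambda>n. real n * r ^ n) \<longlonglongrightarrow> 0" using r by (intro powser_times_n_limit_0) simp
  \<comment> \<open>The final budget in units of \<epsilon> / 12: 3 + 1 + 1 from
    \<open>generator_estimate\<close>, 3 from the tail of g, and 1 from its first m
    coefficients.\<close>
  then have "eventually (\<lambda>n. real n * r ^ n < \<epsilon> / 12) sequentially" using \<epsilon> by (intro order_tendstoD) auto
  moreover have "(\<lambda>n. c * r ^ n) \<longlonglongrightarrow> c * 0" using r by (intro tendsto_intros LIMSEQ_power_zero) simp
  then have "eventually (\<lambda>n. c * r ^ n < \<epsilon> / 4) sequentially" using \<epsilon> by (intro order_tendstoD) auto
  ultimately have "eventually (\<lambda>n. real n * r ^ n < \<epsilon> / 12 \<and> c * r ^ n < \<epsilon> / 4) sequentially"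
    by eventually_elim simp
  then obtain m where m: "\<And>n. m \<le> n \<Longrightarrow> real n * r ^ n < \<epsilon> / 12 \<and> c * r ^ n < \<epsilon> / 4"
    unfolding eventually_sequentially by blast
  \<comment> \<open>Periods 2 to L are then exactly the indices n < m, shifted by 2.\<close>
  define L where "L = m + 1"
  let ?A = "\<lambda>N. real (class_support N (C N))"
  have "(\<lambda>N. 2 * c * real (L * (L + 1)) * (?A N / real N)) \<longlonglongrightarrow> 2 * c * real (L * (L + 1)) * 0"
    by (intro tendsto_intros support_ratio)
  then have e1: "eventually (\<lambda>N. 2 * c * real (L * (L + 1)) * (?A N / real N) < \<epsilon> / 12) sequentially"
    using \<epsilon> by (intro order_tendstoD) auto
  have "(\<lambda>N. c * (real L)\<^sup>2 / real N) \<longlonglongrightarrow> 0"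
    by (rule tendsto_divide_0[OF tendsto_const filterlim_at_top_imp_at_infinity[OF filterlim_real_sequentially]])
  then have e2: "eventually (\<lambda>N. c * (real L)\<^sup>2 / real N < \<epsilon> / 12) sequentially"
    using \<epsilon> by (intro order_tendstoD) auto
  have "(\<lambda>N. c * (\<Sum>n<m. \<bar>a n - real (class_count N (C N) (n + 2)) / ?A N\<bar>)) \<longlonglongrightarrow>
      c * (\<Sum>n<m. \<bar>a n - a n\<bar>)"
    using conv unfolding classes_converge_def a_def by (intro tendsto_intros) auto
  then have e3: "eventually (\<lambda>N. c * (\<Sum>n<m. \<bar>a n - real (class_count N (C N) (n + 2)) / ?A N\<bar>) < \<epsilon> / 12) sequentially"
    using \<epsilon> by (intro order_tendstoD) auto
  from e1 e2 e3 eventually_ge_at_top[of "max 2 L"] show ?thesis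
  proof eventually_elim
    case (elim N)
    then have N2: "2 \<le> N" "L \<le> N" by auto
    interpret nontrivial_class N "C N" by (rule nontrivial_class[OF N2(1)])
    show ?case
    proof (intro allI impI)
      fix z p assume z: "0 \<le> z" "z \<le> r" and p: "p permutes {1..N}"
      have zr: "real n * z ^ n \<le> real n * r ^ n" for n
        using z by (intro mult_left_mono power_mono) auto
      have zc: "real n * z ^ n \<le> c" for n using zr c(2) order_trans by blast
      have z\<eta>: "real n * z ^ n \<le> \<epsilon> / 12" if "L < n" for n
      proof -
        have "m \<le> n" using that by (simp add: L_def)
        then show ?thesis using zr[of n] m[of n] by linarith
      qed
      let ?\<Phi> = "cycle_gf N z p" and ?D = "cycle_gf' N z p"
      have \<Phi>: "0 \<le> ?\<Phi>" "?\<Phi> \<le> r" "0 \<le> ?D" using cycle_gf_bounds[OF p z(1)] z r by auto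
      have D: "?D \<le> c" using cycle_gf'_le[OF zc] N2 by simp
      let ?S = "\<Sum>i=2..L. real (class_count N (C N) i) / ?A N * ?\<Phi> ^ (i - 1)"
      have S: "?S = (\<Sum>n<m. real (class_count N (C N) (n + 2)) / ?A N * ?\<Phi> ^ (n + 1))"
      proof -
        have "{2..L} = {0 + 2..<m + 2}" by (auto simp: L_def)
        then show ?thesis by (simp only: sum.shift_bounds_nat_ivl) (simp add: lessThan_atLeast0)
      qed
      have "\<bar>g ?\<Phi> - ?S\<bar> \<le> r ^ (m + 1) + (\<Sum>n<m. \<bar>a n - real (class_count N (C N) (n + 2)) / ?A N\<bar>)"
      proof -
        have "\<bar>(\<Sum>n<m. a n * ?\<Phi> ^ (n + 1)) - ?S\<bar> =
            \<bar>\<Sum>n<m. (a n - real (class_count N (C N) (n + 2)) / ?A N) * ?\<Phi> ^ (n + 1)\<bar>"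
          unfolding S by (simp add: sum_subtractf left_diff_distrib)
        also have "\<dots> \<le> (\<Sum>n<m. \<bar>a n - real (class_count N (C N) (n + 2)) / ?A N\<bar> * 1)"
        proof (intro order_trans[OF sum_abs] sum_mono)
          fix n
          have "\<bar>?\<Phi> ^ (n + 1)\<bar> \<le> 1" using \<Phi> r by (simp add: power_le_one del: power_Suc)
          then show "\<bar>(a n - real (class_count N (C N) (n + 2)) / ?A N) * ?\<Phi> ^ (n + 1)\<bar> \<le>
              \<bar>a n - real (class_count N (C N) (n + 2)) / ?A N\<bar> * 1"
            unfolding abs_mult by (intro mult_left_mono) auto
        qed
        finally show ?thesis using g_tail[OF \<Phi>(1,2), of m] r by simp
      qed
      then have "\<bar>?D * (?S - g ?\<Phi>)\<bar> \<le> c * (r ^ (m + 1) +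
          (\<Sum>n<m. \<bar>a n - real (class_count N (C N) (n + 2)) / ?A N\<bar>))"
        unfolding abs_mult using D \<Phi>(3) by (intro mult_mono) (auto simp: abs_minus_commute)
      also have "\<dots> \<le> \<epsilon> / 4 + \<epsilon> / 12" using elim m[of "m + 1"] by (simp add: distrib_left)
      finally have a: "\<bar>?D * (?S - g ?\<Phi>)\<bar> \<le> \<epsilon> / 4 + \<epsilon> / 12" .
      have b: "\<bar>walk_generator N (C N) (cycle_gf N z) p + ?D * (1 - ?S)\<bar> \<le>
          3 * (\<epsilon> / 12) + 2 * c * (real (L * (L + 1)) * ?A N / real N) + c * (real L)\<^sup>2 / real N"
        by (rule generator_estimate[OF p zc z(1) z\<eta> N2(2)])
      have e: "2 * c * (real (L * (L + 1)) * ?A N / real N) < \<epsilon> / 12"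
        using elim by (simp add: mult.assoc)
      have "walk_generator N (C N) (cycle_gf N z) p + ?D * (1 - g ?\<Phi>) =
          (walk_generator N (C N) (cycle_gf N z) p + ?D * (1 - ?S)) + ?D * (?S - g ?\<Phi>)"
        by (simp add: right_diff_distrib)
      then show "\<bar>walk_generator N (C N) (cycle_gf N z) p + ?D * (1 - g ?\<Phi>)\<bar> \<le> \<epsilon>"
        using a b e elim(2) \<epsilon> by (simp only: abs_le_iff) linarith
    qed
  qed
qed

end

section \<open>From generating functions back to their coefficients\<close>

lemma cycle_gf_eq_sum:
  assumes p: "p permutes {1..N}"
  shows "cycle_gf N z p = (\<Sum>n\<le>N. real (period_count N p n) / real N * z ^ n)"
proof -
  have perm: "permutation p" using p permutation_permutes by blast
  have "least_power p j \<in> {..N}" if "j \<in> {1..N}" for j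
  proof -
    have "card (cycle_set p j) \<le> card {1..N}"
      by (rule card_mono) (use cycle_set_in[OF p that] in auto)
    then show ?thesis by (simp add: card_cycle_set[OF perm])
  qed
  then have "(\<Sum>j=1..N. z ^ least_power p j) =
      (\<Sum>n\<le>N. \<Sum>j | j \<in> {1..N} \<and> least_power p j = n. z ^ least_power p j)"
    by (intro sum.group[symmetric]) auto
  also have "\<dots> = (\<Sum>n\<le>N. real (period_count N p n) * z ^ n)"
    by (intro sum.cong refl) (simp add: period_count_def)
  finally show ?thesis unfolding cycle_gf_def by (simp add: sum_divide_distrib)
qed

lemma period_count_0:
  assumes "p permutes {1..N}"
  shows "period_count N p 0 = 0"
proof -
  have "permutation p" using assms permutation_permutes by blast
  then have "0 < least_power p j" for j by (rule least_power_of_permutation(2))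
  then have "{j \<in> {1..N}. least_power p j = 0} = {}" by (metis (mono_tags, lifting) empty_Collect_eq less_irrefl)
  then show ?thesis unfolding period_count_def by simp
qed

text \<open>Limits along points z accumulating at 0 are enough. Given the convergence of the earlier
  coefficients, removing the first n terms and dividing by z ^ n leaves a convergent sequence within
  z of \<open>b N n\<close>, which is therefore Cauchy. Tannery's theorem then identifies the
  limiting series.\<close>

lemma power_series_coefficients_converge:
  fixes b :: "nat \<Rightarrow> nat \<Rightarrow> real"
  assumes nn: "\<And>N n. 0 \<le> b N n" and s: "\<And>N. summable (b N)" and le: "\<And>N. (\<Sum>n. b N n) \<le> 1"
    and Z: "\<And>z. z \<in> Z \<Longrightarrow> 0 < z \<and> z < 1" and small: "\<And>e. 0 < e \<Longrightarrow> \<exists>z\<in>Z. z < e"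
    and lim: "\<And>z. z \<in> Z \<Longrightarrow> (\<lambda>N. \<Sum>n. b N n * z ^ n) \<longlonglongrightarrow> F z"
  shows "convergent (\<lambda>N. b N n)"
    and "z \<in> Z \<Longrightarrow> (\<lambda>n. lim (\<lambda>N. b N n) * z ^ n) sums F z"
proof -
  have b1: "b N n \<le> 1" for N n
    using sum_le_suminf[OF s, of "{n}" N] nn le[of N] by simp
  have sz: "summable (\<lambda>n. b N n * z ^ n)" if "z \<in> Z" for N z
    by (rule summable_comparison_test'[OF s[of N], of 0])
      (use Z[OF that] nn in \<open>auto simp: abs_mult power_le_one intro: mult_left_le\<close>)
  have conv: "convergent (\<lambda>N. b N n)" for n
  proof (induction n rule: less_induct)
    case (less n)
    have "Cauchy (\<lambda>N. b N n)"
    proof (rule metric_CauchyI)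
      fix e :: real assume e: "0 < e"
      obtain z where z: "z \<in> Z" "z < e / 3" using small[of "e / 3"] e by auto
      have z01: "0 < z" "z < 1" using Z[OF z(1)] by auto
      define R where "R N = ((\<Sum>k. b N k * z ^ k) - (\<Sum>k<n. b N k * z ^ k)) / z ^ n" for N
      have "convergent (\<lambda>N. \<Sum>k<n. b N k * z ^ k)"
        by (intro convergent_sum convergent_mult less convergent_const) simp
      then have "convergent R"
        unfolding R_def divide_inverse using lim[OF z(1)]
        by (intro convergent_mult convergent_diff convergent_const) (auto simp: convergent_def)
      then have "Cauchy R" by (rule convergent_Cauchy)
      then obtain M where M: "\<And>m k. M \<le> m \<Longrightarrow> M \<le> k \<Longrightarrow> dist (R m) (R k) < e / 3"
        using metric_CauchyD[of R "e / 3"] e by auto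
      \<comment> \<open>Beyond \<open>b N n\<close>, the quotient R only has terms with a factor z,
        and their coefficients have mass at most 1.\<close>
      have bR: "b N n \<le> R N \<and> R N \<le> b N n + z" for N
      proof -
        have s': "summable (\<lambda>k. b N (k + n))" using s[of N] by (rule summable_ignore_initial_segment)
        have sk: "summable (\<lambda>k. b N (k + n) * z ^ k)"
          by (rule summable_comparison_test'[OF s', of 0])
            (use z01 nn in \<open>auto simp: abs_mult power_le_one intro: mult_left_le\<close>)
        have "(\<Sum>k. b N k * z ^ k) - (\<Sum>k<n. b N k * z ^ k) = (\<Sum>k. b N (k + n) * z ^ (k + n))"
          using suminf_split_initial_segment[OF sz[OF z(1)], of N n] by simp
        also have "\<dots> = (\<Sum>k. b N (k + n) * z ^ k * z ^ n)" by (simp add: power_add mult.assoc)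
        also have "\<dots> = (\<Sum>k. b N (k + n) * z ^ k) * z ^ n" using sk by (rule suminf_mult2[symmetric])
        finally have "R N = (\<Sum>k. b N (k + n) * z ^ k)" unfolding R_def using z01 by simp
        also have "\<dots> = b N n + (\<Sum>k. b N (Suc k + n) * z ^ Suc k)"
          using suminf_split_head[OF sk] by simp
        finally have R: "R N = b N n + (\<Sum>k. b N (Suc k + n) * z ^ Suc k)" .
        have sk': "summable (\<lambda>k. b N (Suc k + n) * z ^ Suc k)"
          using sk by (subst summable_Suc_iff)
        have "0 \<le> (\<Sum>k. b N (Suc k + n) * z ^ Suc k)"
          using sk' by (rule suminf_nonneg) (use nn z01 in auto)
        moreover have "(\<Sum>k. b N (Suc k + n) * z ^ Suc k) \<le> (\<Sum>k. b N (Suc k + n) * z)"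
        proof (rule suminf_le[OF _ sk'])
          show "b N (Suc k + n) * z ^ Suc k \<le> b N (Suc k + n) * z" for k
            using z01 nn by (intro mult_left_mono) (auto intro: mult_left_le power_le_one)
          show "summable (\<lambda>k. b N (Suc k + n) * z)"
            using s' by (intro summable_mult2) (subst summable_Suc_iff)
        qed
        moreover have "(\<Sum>k. b N (Suc k + n) * z) = (\<Sum>k. b N (Suc k + n)) * z"
          using s' by (intro suminf_mult2[symmetric]) (subst summable_Suc_iff)
        moreover have "(\<Sum>k. b N (Suc k + n)) * z \<le> 1 * z"
        proof (rule mult_right_mono)
          have "(\<Sum>k. b N (k + Suc n)) \<le> (\<Sum>k. b N k)"
            using suminf_split_initial_segment[OF s[of N], of "Suc n"] sum_nonneg[of "{..<Suc n}" "b N"] nn by simp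
          then show "(\<Sum>k. b N (Suc k + n)) \<le> 1" using le[of N] by simp
        qed (use z01 in simp)
        ultimately show ?thesis unfolding R by linarith
      qed
      show "\<exists>M. \<forall>m\<ge>M. \<forall>k\<ge>M. dist (b m n) (b k n) < e"
      proof (intro exI allI impI)
        fix m k assume "M \<le> m" "M \<le> k"
        then have "\<bar>R m - R k\<bar> < e / 3" using M by (simp add: dist_real_def)
        then show "dist (b m n) (b k n) < e"
          using bR[of m] bR[of k] z(2) unfolding dist_real_def by linarith
      qed
    qed
    then show ?case by (rule Cauchy_convergent)
  qed
  then show "convergent (\<lambda>N. b N n)" .
  show "(\<lambda>n. lim (\<lambda>N. b N n) * z ^ n) sums F z" if z: "z \<in> Z"
  proof -
    have l: "(\<lambda>N. b N n) \<longlonglongrightarrow> lim (\<lambda>N. b N n)" for n using conv convergent_LIMSEQ_iff by blast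
    have "((\<lambda>N. b N n * z ^ n) \<longlonglongrightarrow> lim (\<lambda>N. b N n) * z ^ n)" for n by (intro tendsto_intros l)
    moreover have "eventually (\<lambda>(n, N). norm (b N n * z ^ n) \<le> z ^ n) (at_top \<times>\<^sub>F sequentially)"
      using Z[OF z] nn b1 by (intro always_eventually) (auto simp: abs_mult intro!: mult_left_le_one_le)
    moreover have "summable (\<lambda>n. z ^ n)" using Z[OF z] by (intro summable_geometric) simp
    ultimately have t: "summable (\<lambda>n. norm (lim (\<lambda>N. b N n) * z ^ n))"
      "(\<lambda>N. \<Sum>n. b N n * z ^ n) \<longlonglongrightarrow> (\<Sum>n. lim (\<lambda>N. b N n) * z ^ n)"
      using tannerys_theorem[of "\<lambda>n N. b N n * z ^ n" "\<lambda>n. lim (\<lambda>N. b N n) * z ^ n" sequentially "\<lambda>n. z ^ n"]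
      by auto
    have "F z = (\<Sum>n. lim (\<lambda>N. b N n) * z ^ n)"
      using LIMSEQ_unique[OF lim[OF z] t(2)] .
    then show ?thesis using summable_norm_cancel[OF t(1)] by (simp add: sums_iff)
  qed
qed

section \<open>Limits along the walks\<close>

locale class_walks = class_sequence +
  fixes M :: "nat \<Rightarrow> 'w measure" and S :: "nat \<Rightarrow> real \<Rightarrow> 'w \<Rightarrow> nat \<Rightarrow> nat"
  assumes walk: "2 \<le> N \<Longrightarrow> class_random_walk N (C N) (M N) (S N)"
begin

lemma finite_carrier: "finite (carrier (sym_group N))"
  by (simp add: sym_group_def finite_permutations)

lemma id_carrier: "id \<in> carrier (sym_group N)"
  by (simp add: sym_group_def permutes_id)

lemma walk_semigroup:
  assumes "2 \<le> N"
  obtains p where "finite_semigroup (carrier (sym_group N)) p (walk_generator N (C N))"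
    "\<And>t f. 0 \<le> t \<Longrightarrow> (\<integral>w. f (S N t w) \<partial>M N) = semigroup_op (carrier (sym_group N)) p t f id"
proof -
  obtain p where p: "markov_process (M N) (carrier (sym_group N)) (S N) p"
    "has_generator (carrier (sym_group N)) p (walk_generator N (C N))" and st: "AE w in M N. S N 0 w = id"
    using walk[OF assms] unfolding class_random_walk_def by blast
  have "finite_semigroup (carrier (sym_group N)) p (walk_generator N (C N))"
    by unfold_locales (use p finite_carrier in \<open>auto simp: markov_process_def\<close>)
  then show ?thesis
    using that law_of_markov_process[OF finite_carrier p(1) id_carrier st] by blast
qed

lemma h_deriv: "((\<lambda>s. h s u) has_real_derivative h s u * (1 - g u)) (at s)"
  unfolding h_def by (auto intro!: derivative_eq_intros)

text \<open>The characteristic grows at the relative rate 1 - g u, which is why the derivative in z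
  enters only through \<open>cycle_gf'\<close>, with its factor z.\<close>

lemma cycle_gf_deriv:
  "((\<lambda>s. cycle_gf N (h s u) p) has_real_derivative cycle_gf' N (h s u) p * (1 - g u)) (at s)"
proof -
  have "((\<lambda>s. h s u ^ n) has_real_derivative real n * h s u ^ n * (1 - g u)) (at s)" for n
    using DERIV_power[OF h_deriv[of u s], of n] by (cases n) (simp_all add: mult_ac)
  then have "((\<lambda>s. (\<Sum>j=1..N. h s u ^ least_power p j)) has_real_derivative
      (\<Sum>j=1..N. real (least_power p j) * h s u ^ least_power p j * (1 - g u))) (at s)"
    by (intro DERIV_sum)
  then show ?thesis
    unfolding cycle_gf_def cycle_gf'_def
    by (auto dest: DERIV_cdivide[where c = "real N"] simp: sum_distrib_right)
qed

text \<open>Along the characteristic \<open>s \<mapsto> h s u\<close> of the transport equation satisfied by the limiting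
  generating function, the value \<open>u\<close> is preserved.\<close>

lemma mean_square_le:
  assumes t: "0 \<le> t" and u: "0 \<le> u" "u \<le> 1" and h1: "h t u < 1" and \<delta>: "0 < \<delta>"
  shows "eventually (\<lambda>N. (\<integral>w. (cycle_gf N (h t u) (S N t w) - u)\<^sup>2 \<partial>M N) \<le> \<delta>) sequentially"
proof -
  define r where "r = h t u"
  \<comment> \<open>Up to time t the characteristic stays below its endpoint r < 1, so one constant
    c and one Lipschitz constant \<Lambda> serve throughout.\<close>
  have hs: "u \<le> h s u" "h s u \<le> r" if "0 \<le> s" "s \<le> t" for s
    using h_mono_time[OF u that(1)] h_mono_time[OF u that(2)] by (auto simp: h_0 r_def)
  have r: "0 \<le> r" "r < 1" using hs[of t] u t h1 by (auto simp: r_def)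
  obtain c where c: "0 < c" "\<And>n. real n * r ^ n \<le> c" using power_times_bounded[OF r] by blast
  obtain \<Lambda> where \<Lambda>: "0 \<le> \<Lambda>"
    "\<And>u v. 0 \<le> u \<Longrightarrow> u \<le> r \<Longrightarrow> 0 \<le> v \<Longrightarrow> v \<le> r \<Longrightarrow> \<bar>g u - g v\<bar> \<le> \<Lambda> * \<bar>u - v\<bar>"
    using g_lipschitz[OF r] by blast
  define k where "k = 2 * c * \<Lambda>"
  have k: "0 \<le> k" using c \<Lambda>(1) by (simp add: k_def)
  \<comment> \<open>Chosen to bring the bound of \<open>gronwall\<close>, with error 3 * \<epsilon>,
    below \<delta>; the added 1 keeps the denominator positive at t = 0.\<close>
  define \<epsilon> where "\<epsilon> = \<delta> / (3 * t * exp (k * t) + 1)"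
  have pos: "0 < 3 * t * exp (k * t) + 1" using t by (intro add_nonneg_pos) auto
  then have \<epsilon>: "0 < \<epsilon>" using \<delta> by (simp add: \<epsilon>_def)
  have \<epsilon>\<delta>: "3 * \<epsilon> * t * exp (k * t) \<le> \<delta>"
  proof -
    have "3 * \<epsilon> * t * exp (k * t) \<le> \<epsilon> * (3 * t * exp (k * t) + 1)" using \<epsilon> by (simp add: algebra_simps)
    also have "\<dots> = \<delta>" using pos by (simp add: \<epsilon>_def)
    finally show ?thesis .
  qed
  have "(\<lambda>N. c\<^sup>2 * (real (class_support N (C N)) / real N)) \<longlonglongrightarrow> c\<^sup>2 * 0"
    by (intro tendsto_intros support_ratio)
  then have "eventually (\<lambda>N. c\<^sup>2 * (real (class_support N (C N)) / real N) < \<epsilon>) sequentially"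
    using \<epsilon> by (intro order_tendstoD) auto
  then show ?thesis using generator_limit[OF r \<epsilon>] eventually_ge_at_top[of 2]
  proof eventually_elim
    case (elim N)
    interpret nontrivial_class N "C N" by (rule nontrivial_class[OF elim(3)])
    obtain p where sg: "finite_semigroup (carrier (sym_group N)) p (walk_generator N (C N))"
      and law: "\<And>t f. 0 \<le> t \<Longrightarrow> (\<integral>w. f (S N t w) \<partial>M N) = semigroup_op (carrier (sym_group N)) p t f id"
      using walk_semigroup[OF elim(3)] by blast
    interpret finite_semigroup "carrier (sym_group N)" p "walk_generator N (C N)" by (rule sg)
    define F where "F s y = (cycle_gf N (h s u) y - u)\<^sup>2" for s y
    define F' where "F' s y = 2 * (cycle_gf N (h s u) y - u) * (cycle_gf' N (h s u) y * (1 - g u))" for s y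
    have "P t (F t) id \<le> (3 * \<epsilon>) * t * exp (k * t)"
    proof (rule gronwall[OF id_carrier t _ _ _ k])
      show "((\<lambda>s. F s y) has_real_derivative F' s y) (at s)" for s y
        unfolding F_def F'_def by (auto intro!: derivative_eq_intros cycle_gf_deriv simp: mult_ac)
      \<comment> \<open>All cycles of the identity have length 1, so its generating function at
        \<open>h 0 u = u\<close> is u: the squared distance starts at 0.\<close>
      have "least_power (id :: nat \<Rightarrow> nat) j = 1" for j
        by (rule least_power_eqI) auto
      then show "F 0 id = 0" using N by (simp add: F_def h_0 cycle_gf_def)
      show "0 \<le> 3 * \<epsilon>" using \<epsilon> by simp
      fix s y assume y: "y \<in> carrier (sym_group N)" and s: "0 \<le> s" "s \<le> t"
      have yp: "y permutes {1..N}" using y by (simp add: sym_group_def)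
      define z where "z = h s u"
      have z: "0 \<le> z" "z \<le> r" "u \<le> r" using hs[OF s] u by (auto simp: z_def)
      have zc: "real n * z ^ n \<le> c" for n
        using c(2)[of n] z power_mono[of z r n] by (meson mult_left_mono of_nat_0_le_iff order_trans)
      define \<Phi> where "\<Phi> = cycle_gf N z y"
      define D where "D = cycle_gf' N z y"
      have \<Phi>: "0 \<le> \<Phi>" "\<Phi> \<le> r" and D: "0 \<le> D" "D \<le> c"
        using cycle_gf_bounds[OF yp z(1)] cycle_gf'_le[OF zc] N z r by (auto simp: \<Phi>_def D_def)
      define e where "e = walk_generator N (C N) (cycle_gf N z) y + D * (1 - g \<Phi>)"
      have e: "\<bar>e\<bar> \<le> \<epsilon>" using elim(2) z yp by (simp add: e_def \<Phi>_def D_def)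
      have x1: "\<bar>\<Phi> - u\<bar> \<le> 1" using \<Phi> u r z by (simp add: abs_le_iff)
      have "walk_generator N (C N) (F s) y \<le>
          2 * (\<Phi> - u) * walk_generator N (C N) (cycle_gf N z) y + c\<^sup>2 * (real (class_support N (C N)) / real N)"
        unfolding F_def[abs_def] z_def[symmetric] \<Phi>_def
        by (rule walk_generator_square_le[OF yp zc z(1)])
      then have "F' s y + walk_generator N (C N) (F s) y \<le>
          2 * (\<Phi> - u) * (D * (1 - g u)) + 2 * (\<Phi> - u) * (e - D * (1 - g \<Phi>)) + \<epsilon>"
        unfolding F'_def z_def[symmetric] \<Phi>_def[symmetric] D_def[symmetric] using elim(1)
        by (simp add: e_def)
      \<comment> \<open>The motion of z and the drift of the walk cancel up to the difference g
        \<Phi> - g u, which is of the order of \<Phi> - u itself.\<close>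
      also have "\<dots> = 2 * (D * ((\<Phi> - u) * (g \<Phi> - g u))) + 2 * ((\<Phi> - u) * e) + \<epsilon>"
        by (simp add: algebra_simps)
      also have "\<dots> \<le> 2 * (c * (\<Lambda> * (\<Phi> - u)\<^sup>2)) + 2 * \<epsilon> + \<epsilon>"
      proof -
        have "(\<Phi> - u) * (g \<Phi> - g u) \<le> \<bar>\<Phi> - u\<bar> * \<bar>g \<Phi> - g u\<bar>"
          by (simp add: abs_mult[symmetric])
        also have "\<dots> \<le> \<bar>\<Phi> - u\<bar> * (\<Lambda> * \<bar>\<Phi> - u\<bar>)"
          using \<Lambda>(2)[OF \<Phi> u(1) z(3)] by (intro mult_left_mono) auto
        also have "\<dots> = \<Lambda> * (\<Phi> - u)\<^sup>2" by (simp add: power2_eq_square mult_ac)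
        finally have a1: "(\<Phi> - u) * (g \<Phi> - g u) \<le> \<Lambda> * (\<Phi> - u)\<^sup>2" .
        have "D * ((\<Phi> - u) * (g \<Phi> - g u)) \<le> D * (\<Lambda> * (\<Phi> - u)\<^sup>2)"
          using a1 D by (intro mult_left_mono) auto
        also have "\<dots> \<le> c * (\<Lambda> * (\<Phi> - u)\<^sup>2)"
          using D \<Lambda>(1) by (intro mult_right_mono) auto
        finally have "D * ((\<Phi> - u) * (g \<Phi> - g u)) \<le> c * (\<Lambda> * (\<Phi> - u)\<^sup>2)" .
        moreover have "(\<Phi> - u) * e \<le> 1 * \<epsilon>"
          using mult_mono[OF x1 e] by (simp add: abs_mult[symmetric] abs_le_iff)
        ultimately show ?thesis by simp
      qed
      also have "\<dots> = k * F s y + 3 * \<epsilon>"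
        unfolding F_def z_def[symmetric] \<Phi>_def[symmetric] k_def by (simp add: algebra_simps)
      finally show "F' s y + walk_generator N (C N) (F s) y \<le> k * F s y + 3 * \<epsilon>" .
    qed
    also have "\<dots> \<le> \<delta>" by (rule \<epsilon>\<delta>)
    finally show ?case using law[OF t, of "F t"] by (simp add: F_def)
  qed
qed

text \<open>Mean-square convergence implies convergence of the mean; instead of the Cauchy-Schwarz
  inequality, x \<le> e / 2 + x^2 / (2 * e) is applied pointwise.\<close>

lemma mean_cycle_gf_limit:
  assumes t: "0 \<le> t" and u: "0 \<le> u" "u \<le> 1" and h1: "h t u < 1"
  shows "(\<lambda>N. \<integral>w. cycle_gf N (h t u) (S N t w) \<partial>M N) \<longlonglongrightarrow> u"
proof (rule tendstoI)
  fix e :: real assume e: "0 < e"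
  have "eventually (\<lambda>N. (\<integral>w. (cycle_gf N (h t u) (S N t w) - u)\<^sup>2 \<partial>M N) \<le> e\<^sup>2 / 2) sequentially"
    by (rule mean_square_le[OF assms]) (use e in simp)
  then show "eventually (\<lambda>N. dist (\<integral>w. cycle_gf N (h t u) (S N t w) \<partial>M N) u < e) sequentially"
    using eventually_ge_at_top[of 2]
  proof eventually_elim
    case (elim N)
    obtain p where sg: "finite_semigroup (carrier (sym_group N)) p (walk_generator N (C N))"
      and law: "\<And>t f. 0 \<le> t \<Longrightarrow> (\<integral>w. f (S N t w) \<partial>M N) = semigroup_op (carrier (sym_group N)) p t f id"
      using walk_semigroup[OF elim(2)] by blast
    interpret finite_semigroup "carrier (sym_group N)" p "walk_generator N (C N)" by (rule sg)
    let ?f = "cycle_gf N (h t u)"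
    let ?X = "P t (\<lambda>y. (?f y - u)\<^sup>2) id"
    have x: "?X \<le> e\<^sup>2 / 2" using elim(1) law[OF t, of "\<lambda>y. (?f y - u)\<^sup>2"] by simp
    have m: "P t ?f id - u = P t (\<lambda>y. ?f y - u) id"
      by (simp add: P_diff P_const[OF t id_carrier])
    have am: "v \<le> e / 2 + v\<^sup>2 / (2 * e)" for v :: real
    proof -
      have "0 \<le> (v - e)\<^sup>2" by simp
      then have "2 * e * v \<le> e * e + v\<^sup>2" by (simp add: power2_eq_square algebra_simps)
      then show ?thesis using e by (simp add: field_simps power2_eq_square)
    qed
    \<comment> \<open>\<sigma> is a sign: its two values bound the deviation from above and
      below.\<close>
    have bnd: "P t (\<lambda>y. \<sigma> * (?f y - u)) id \<le> e / 2 + (1 / (2 * e)) * ?X" if "\<sigma>\<^sup>2 = 1" for \<sigma>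
    proof -
      have "P t (\<lambda>y. \<sigma> * (?f y - u)) id \<le> P t (\<lambda>y. e / 2 - (- 1 / (2 * e)) * (?f y - u)\<^sup>2) id"
      proof (rule P_mono[OF t id_carrier])
        fix y
        show "\<sigma> * (?f y - u) \<le> e / 2 - (- 1 / (2 * e)) * (?f y - u)\<^sup>2"
          using am[of "\<sigma> * (?f y - u)"] that by (simp add: power_mult_distrib)
      qed
      also have "\<dots> = e / 2 + (1 / (2 * e)) * ?X"
        unfolding P_diff P_cmult P_const[OF t id_carrier] by simp
      finally show ?thesis .
    qed
    have "(1 / (2 * e)) * ?X \<le> (1 / (2 * e)) * (e\<^sup>2 / 2)" using x e by (intro mult_left_mono) auto
    also have "\<dots> = e / 4" using e by (simp add: power2_eq_square)
    finally have "e / 2 + (1 / (2 * e)) * ?X < e" using e by simp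
    then have "P t ?f id - u < e" "- (P t ?f id - u) < e"
      using bnd[of 1] bnd[of "- 1"] unfolding m P_cmult by simp_all
    then show ?case unfolding law[OF t] dist_real_def by linarith
  qed
qed

lemma mean_mass_facts:
  assumes N: "2 \<le> N" and t: "0 \<le> t"
  shows "0 \<le> mean_mass M S n t N" "N < n \<Longrightarrow> mean_mass M S n t N = 0" "mean_mass M S 0 t N = 0"
    "(\<Sum>n\<le>N. mean_mass M S n t N * z ^ n) = (\<integral>w. cycle_gf N z (S N t w) \<partial>M N)"
    "(\<Sum>n\<le>N. mean_mass M S n t N) = 1"
proof -
  obtain p where sg: "finite_semigroup (carrier (sym_group N)) p (walk_generator N (C N))"
    and law: "\<And>t f. 0 \<le> t \<Longrightarrow> (\<integral>w. f (S N t w) \<partial>M N) = semigroup_op (carrier (sym_group N)) p t f id"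
    using walk_semigroup[OF N] by blast
  interpret finite_semigroup "carrier (sym_group N)" p "walk_generator N (C N)" by (rule sg)
  let ?X = "carrier (sym_group N)"
  have perm: "y permutes {1..N}" if "y \<in> ?X" for y using that by (simp add: sym_group_def)
  have mm: "mean_mass M S n t N = P t (\<lambda>y. real (period_count N y n) / real N) id" for n
    unfolding mean_mass_def using law[OF t, of "\<lambda>y. real (period_count N y n) / real N"] by simp
  have cong: "P t f id = P t f' id" if "\<And>y. y \<in> ?X \<Longrightarrow> f y = f' y" for f f'
    unfolding semigroup_op_def using that by (intro sum.cong refl) simp
  show "0 \<le> mean_mass M S n t N"
    using P_mono[OF t id_carrier, of "\<lambda>_. 0" "\<lambda>y. real (period_count N y n) / real N"]
      P_const[OF t id_carrier, of 0] by (simp add: mm)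
  have zero: "mean_mass M S n t N = 0" if "\<And>y. y \<in> ?X \<Longrightarrow> period_count N y n = 0" for n
    using cong[of "\<lambda>y. real (period_count N y n) / real N" "\<lambda>_. 0"] that P_const[OF t id_carrier, of 0] by (simp add: mm)
  show "mean_mass M S 0 t N = 0" by (rule zero) (use perm period_count_0 in auto)
  show "mean_mass M S n t N = 0" if n: "N < n"
  proof (rule zero)
    fix y assume y: "y \<in> ?X"
    have pm: "permutation y" using perm[OF y] permutation_permutes by blast
    have "least_power y j \<noteq> n" if "j \<in> {1..N}" for j
    proof -
      have "card (cycle_set y j) \<le> card {1..N}"
        by (rule card_mono) (use cycle_set_in[OF perm[OF y] that] in auto)
      then show ?thesis using n by (simp add: card_cycle_set[OF pm])
    qed
    then have "{j \<in> {1..N}. least_power y j = n} = {}" by blast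
    then show "period_count N y n = 0" unfolding period_count_def by simp
  qed
  show gf: "(\<Sum>n\<le>N. mean_mass M S n t N * z ^ n) = (\<integral>w. cycle_gf N z (S N t w) \<partial>M N)" for z
  proof -
    have "(\<integral>w. cycle_gf N z (S N t w) \<partial>M N) = P t (\<lambda>y. \<Sum>n\<le>N. real (period_count N y n) / real N * z ^ n) id"
      unfolding law[OF t] by (rule cong) (rule cycle_gf_eq_sum[OF perm])
    also have "\<dots> = (\<Sum>y\<in>?X. \<Sum>n\<le>N. pmf (p t id) y * (real (period_count N y n) / real N * z ^ n))"
      unfolding semigroup_op_def sum_distrib_left ..
    also have "\<dots> = (\<Sum>n\<le>N. \<Sum>y\<in>?X. pmf (p t id) y * (real (period_count N y n) / real N * z ^ n))"
      by (rule sum.swap)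
    also have "\<dots> = (\<Sum>n\<le>N. mean_mass M S n t N * z ^ n)"
      unfolding mm semigroup_op_def sum_distrib_right by (simp only: mult.assoc)
    finally show ?thesis by simp
  qed
  have "(\<integral>w. cycle_gf N 1 (S N t w) \<partial>M N) = P t (\<lambda>_. 1) id"
    unfolding law[OF t] using N by (intro cong) (simp add: cycle_gf_def)
  then show "(\<Sum>n\<le>N. mean_mass M S n t N) = 1" using gf[of 1] P_const[OF t id_carrier, of 1] by simp
qed

text \<open>The limiting masses have generating function u at the point h t u. As u increases to q t
  this point increases to 1 in the limit, so their sum is q t, by Abel's argument for nonnegative
  coefficients.\<close>

lemma mass_limits:
  assumes t: "0 \<le> t"
  shows "convergent (mean_mass M S n t)" and "infinite_mass M S t = 1 - q t"
proof -
  \<comment> \<open>The walks are only specified for N \<ge> 2, hence the shift by 2, which makes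
    the bounds hold for every index.\<close>
  define b where "b N n = mean_mass M S n t (N + 2)" for N n
  define Z where "Z = {h t u | u. 0 < u \<and> u < q t}"
  have fin: "b N n = 0" if "n \<notin> {..N + 2}" for N n
    unfolding b_def using mean_mass_facts(2)[of "N + 2" t n] t that by simp
  have sb: "(\<lambda>n. b N n * z ^ n) sums (\<Sum>n\<le>N + 2. b N n * z ^ n)" for N z
    by (rule sums_finite) (use fin in auto)
  have sb1: "b N sums 1" for N
  proof -
    have "(\<Sum>n\<le>N + 2. b N n) = 1"
      unfolding b_def by (rule mean_mass_facts(5)) (use t in auto)
    then show ?thesis using sb[of N 1] by (simp only: power_one mult_1_right)
  qed
  have nn: "0 \<le> b N n" for N n unfolding b_def using mean_mass_facts(1)[of "N + 2" t n] t by simp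
  define F where "F z = (THE u. 0 < u \<and> u < q t \<and> z = h t u)" for z
  have lim: "(\<lambda>N. \<Sum>n. b N n * h t u ^ n) \<longlonglongrightarrow> u" if u: "0 < u" "u < q t" for u
  proof -
    have "(\<lambda>N. \<integral>w. cycle_gf N (h t u) (S N t w) \<partial>M N) \<longlonglongrightarrow> u"
      using u q_bounds(2)[of t] h_below_q[of u t] by (intro mean_cycle_gf_limit t) auto
    then have "(\<lambda>N. \<integral>w. cycle_gf (N + 2) (h t u) (S (N + 2) t w) \<partial>M (N + 2)) \<longlonglongrightarrow> u"
      by (rule LIMSEQ_ignore_initial_segment)
    moreover have "(\<Sum>n. b N n * h t u ^ n) = (\<integral>w. cycle_gf (N + 2) (h t u) (S (N + 2) t w) \<partial>M (N + 2))" for N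
      using sb[of N "h t u"] mean_mass_facts(4)[of "N + 2" t "h t u"] t by (simp add: b_def sums_iff)
    ultimately show ?thesis by simp
  qed
  \<comment> \<open>Injectivity of \<open>h t\<close> below q t needs no analysis of h: the same
    sequence converges to both u and v. It makes F a genuine inverse.\<close>
  have uniq: "u = v" if "0 < u" "u < q t" "0 < v" "v < q t" "h t u = h t v" for u v
    using LIMSEQ_unique[OF lim[OF that(1,2)]] lim[OF that(3,4)] that(5) by simp
  have F: "F (h t u) = u" if "0 < u" "u < q t" for u
    unfolding F_def by (rule the_equality) (use that uniq in auto)
  have Z: "0 < z \<and> z < 1" if "z \<in> Z" for z
    using that h_below_q unfolding Z_def by (auto simp: h_def)
  have small: "\<exists>z\<in>Z. z < e" if e: "0 < e" for e
  proof -
    define u where "u = min (e * exp (- t)) (q t) / 2"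
    have u: "0 < u" "u < q t" "u < e * exp (- t)" using e q_pos[OF t] by (auto simp: u_def min_def)
    have "h (0 + t) u \<le> h 0 u * exp t" using u q_bounds(2)[of t] t by (intro h_add_time_le) auto
    also have "\<dots> < e * exp (- t) * exp t" using u by (simp add: h_0)
    also have "\<dots> = e" by (simp add: exp_minus)
    finally show ?thesis using u unfolding Z_def by auto
  qed
  note coeff = power_series_coefficients_converge[of b Z F, OF nn _ _ Z small]
  have c1: "convergent (\<lambda>N. b N n)" for n
    using sb1 lim F by (intro coeff(1)) (auto simp: Z_def sums_iff)
  have c2: "(\<lambda>n. lim (\<lambda>N. b N n) * z ^ n) sums F z" if "z \<in> Z" for z
    using sb1 lim F that by (intro coeff(2)) (auto simp: Z_def sums_iff)
  show cv: "convergent (mean_mass M S n t)" for n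
    using c1[of n] convergent_ignore_initial_segment[of "mean_mass M S n t" 2] unfolding b_def by simp
  define x where "x n = limit_mass M S n t" for n
  have xl: "(\<lambda>N. b N n) \<longlonglongrightarrow> x n" for n
    using cv[of n] unfolding b_def x_def limit_mass_def
    by (intro LIMSEQ_ignore_initial_segment) (simp add: convergent_LIMSEQ_iff)
  then have xb: "lim (\<lambda>N. b N n) = x n" for n by (rule limI)
  have xs: "(\<lambda>n. x n * h t u ^ n) sums u" if "0 < u" "u < q t" for u
    using c2[of "h t u"] that F[OF that] unfolding Z_def xb by auto
  have x0: "0 \<le> x n" for n by (rule LIMSEQ_le_const[OF xl]) (use nn in auto)
  \<comment> \<open>A finite sum passes to the limit as u tends to q t, where h t u tends to 1;
    before the limit it is at most the full series, whose value is u < q t.\<close>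
  have partial: "(\<Sum>n<K. x n) \<le> q t" for K
  proof -
    have "((\<lambda>u. \<Sum>n<K. x n * h t u ^ n) \<longlongrightarrow> (\<Sum>n<K. x n * h t (q t) ^ n)) (at_left (q t))"
      by (intro tendsto_intros h_at_left_q t)
    then have "((\<lambda>u. \<Sum>n<K. x n * h t u ^ n) \<longlongrightarrow> (\<Sum>n<K. x n)) (at_left (q t))"
      by (simp add: h_q[OF t])
    moreover have "eventually (\<lambda>u. u \<in> {0<..<q t}) (at_left (q t))"
      using q_pos[OF t] by (rule eventually_at_leftI[rotated]) simp
    then have "eventually (\<lambda>u. (\<Sum>n<K. x n * h t u ^ n) \<le> q t) (at_left (q t))"
    proof eventually_elim
      case (elim u)
      then have u: "0 < u" "u < q t" by auto
      have "0 \<le> h t u" using u by (simp add: h_def)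
      then have "(\<Sum>n<K. x n * h t u ^ n) \<le> (\<Sum>n. x n * h t u ^ n)"
        using xs[OF u] x0 by (intro sum_le_suminf) (auto simp: sums_iff)
      then show ?case using xs[OF u] u by (simp add: sums_iff)
    qed
    ultimately show ?thesis by (intro tendsto_upperbound) auto
  qed
  have sx: "summable x"
    by (rule bounded_imp_summable[where B = "q t"]) (use x0 partial[of "Suc _"] in \<open>auto simp: lessThan_Suc_atMost\<close>)
  have "suminf x = q t"
  proof (rule antisym)
    show "suminf x \<le> q t" using sx partial by (rule suminf_le_const)
    show "q t \<le> suminf x"
    proof (rule dense_le_bounded[OF q_pos[OF t]])
      fix u assume u: "0 < u" "u < q t"
      have "0 \<le> h t u" "h t u \<le> 1" using u h_below_q[of u t] by (auto simp: h_def intro: less_imp_le)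
      then have "(\<Sum>n. x n * h t u ^ n) \<le> suminf x"
        using xs[OF u] sx x0 by (intro suminf_le) (auto simp: sums_iff intro: mult_left_le power_le_one)
      then show "u \<le> suminf x" using xs[OF u] by (simp add: sums_iff)
    qed
  qed
  then have "(x has_sum q t) UNIV"
    using sx x0 by (intro sums_nonneg_imp_has_sum) (auto simp: sums_iff)
  then have "infsum x UNIV = q t" by (rule infsumI)
  moreover have "infsum x {1..} = infsum x UNIV"
  proof (rule infsum_cong_neutral)
    fix n assume "n \<in> UNIV - {1::nat..}"
    then have n: "n = 0" by auto
    have "b N 0 = 0" for N unfolding b_def using mean_mass_facts(3)[of "N + 2" t] t by simp
    then show "x n = 0" using xl[of 0] LIMSEQ_unique[OF xl[of 0], of 0] n by simp
  qed auto
  ultimately show "infinite_mass M S t = 1 - q t" unfolding infinite_mass_def x_def by simp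
qed

text \<open>The substitution j = n + 2 turns the weights j - 1 into n + 1, so the critical time is
  the reciprocal of the mean in \<open>q_subcritical\<close> and \<open>q_supercritical\<close>, or
  0.\<close>

lemma critical_time_cases:
  assumes t: "0 \<le> t"
  shows "t \<le> critical_time l \<Longrightarrow> q t = 1" and "critical_time l < t \<Longrightarrow> q t < 1"
proof -
  let ?w = "\<lambda>j. (real j - 1) * l j"
  let ?v = "\<lambda>n. real (n + 1) * a n"
  have one: "(\<Sum>\<^sub>\<infinity>j\<in>{2..}. l j) = (\<Sum>n. a n)"
    using has_sum_imp_sums[OF a_has_sum] by (simp add: sums_iff)
  have bij: "bij_betw (\<lambda>n. n + 2) UNIV {2::nat..}"
    by (rule bij_betw_byWitness[where f' = "\<lambda>n. n - 2"]) auto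
  have wv: "(\<lambda>n. ?w (n + 2)) = ?v" by (auto simp: fun_eq_iff a_def)
  have v0: "0 \<le> ?v n" for n using nonneg[of n] by simp
  have sw: "?w summable_on {2..} \<longleftrightarrow> summable ?v"
    using summable_on_reindex_bij_betw[OF bij, of ?w] summable_on_UNIV_nonneg_real_iff[of ?v, OF v0]
    unfolding wv by simp
  have iw: "infsum ?w {2..} = suminf ?v" if "summable ?v"
  proof -
    have "(?v has_sum suminf ?v) UNIV" using that v0 by (intro sums_nonneg_imp_has_sum) (auto simp: summable_sums)
    then have "infsum ?v UNIV = suminf ?v" by (rule infsumI)
    then show ?thesis using infsum_reindex_bij_betw[OF bij, of ?w] unfolding wv by simp
  qed
  have crit: "critical_time l = (if (\<Sum>n. a n) = 1 \<and> summable ?v then 1 / suminf ?v else 0)"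
    unfolding critical_time_def one sw using iw by simp
  \<comment> \<open>This keeps the reciprocal away from division by zero and makes the critical time
    positive in the regular case.\<close>
  have ge1: "1 \<le> suminf ?v" if "(\<Sum>n. a n) = 1" "summable ?v"
  proof -
    have "(\<Sum>n. a n) \<le> suminf ?v"
    proof (rule suminf_le[OF _ summable that(2)])
      fix n
      have "1 * a n \<le> real (n + 1) * a n" by (rule mult_right_mono) (use nonneg[of n] in auto)
      then show "a n \<le> ?v n" by simp
    qed
    then show ?thesis using that by simp
  qed
  show "q t = 1" if le: "t \<le> critical_time l"
  proof (cases "(\<Sum>n. a n) = 1 \<and> summable ?v")
    case True
    then have "t * suminf ?v \<le> 1" using le ge1 unfolding crit by (simp add: pos_le_divide_eq)
    then show ?thesis using True by (intro q_subcritical t) auto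
  next
    case False
    then have "t = 0" using le t unfolding crit by (auto split: if_splits)
    then show ?thesis by (simp add: q_0)
  qed
  show "q t < 1" if less: "critical_time l < t"
  proof (rule q_supercritical)
    show "0 < t" using less ge1 t unfolding crit by (auto split: if_splits intro: le_less_trans[rotated])
    show "\<not> ((\<Sum>n. a n) = 1 \<and> summable ?v \<and> t * suminf ?v \<le> 1)"
    proof clarify
      assume a: "(\<Sum>n. a n) = 1" "summable ?v" "t * suminf ?v \<le> 1"
      then have "1 / suminf ?v < t" using less unfolding crit by simp
      then show False using a ge1 by (simp add: divide_less_eq)
    qed
  qed
qed

end

theorem theorem2p10:
  fixes C :: "nat \<Rightarrow> (nat \<Rightarrow> nat) set"
    and M :: "nat \<Rightarrow> 'w measure"
    and S :: "nat \<Rightarrow> real \<Rightarrow> 'w \<Rightarrow> nat \<Rightarrow> nat"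
    and l :: "nat \<Rightarrow> real"
    and \<alpha> :: real
  assumes "\<And>N. N \<ge> 2 \<Longrightarrow> conjugacy_class (sym_group N) (C N)"
    and "\<And>N. N \<ge> 2 \<Longrightarrow> C N \<noteq> {id}"
    and "classes_converge C l \<alpha>"
    and "\<alpha> = 0"
    and "\<And>N. N \<ge> 2 \<Longrightarrow> class_random_walk N (C N) (M N) (S N)"
  shows "(\<forall>n\<ge>1. \<forall>t\<ge>0. convergent (mean_mass M S n t)) \<and>
    continuous_on {0..} (infinite_mass M S) \<and>
    (infinite_mass M S \<longlongrightarrow> 1) at_top \<and>
    (\<forall>t. 0 \<le> t \<and> t \<le> critical_time l \<longrightarrow> infinite_mass M S t = 0) \<and>
    (\<forall>t. t > critical_time l \<longrightarrow> infinite_mass M S t > 0)"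
proof -
  interpret class_walks C l M S
    by unfold_locales (use assms in auto)
  have "continuous_on {0..} (\<lambda>t. 1 - q t)" by (intro continuous_intros continuous_on_q)
  then have cont: "continuous_on {0..} (infinite_mass M S)"
    by (rule continuous_on_cong[THEN iffD1, rotated 2]) (auto simp: mass_limits(2))
  have "((\<lambda>t. 1 - q t) \<longlongrightarrow> 1 - 0) at_top" by (intro tendsto_intros q_tendsto_0)
  moreover have "eventually (\<lambda>t. 1 - q t = infinite_mass M S t) at_top"
    using eventually_ge_at_top[of 0] by eventually_elim (simp add: mass_limits(2))
  ultimately have lim: "(infinite_mass M S \<longlongrightarrow> 1) at_top" by (auto intro: Lim_transform_eventually)
  \<comment> \<open>Needed because the last claim does not ask for t \<ge> 0: it follows from t >
    \<open>critical_time l\<close>.\<close>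
  have c0: "0 \<le> critical_time l"
  proof -
    have "0 \<le> (\<Sum>\<^sub>\<infinity>j\<in>{2..}. (real j - 1) * l j)"
      using assms(3) unfolding classes_converge_def by (intro infsum_nonneg) auto
    then show ?thesis unfolding critical_time_def by simp
  qed
  show ?thesis
    using cont lim c0 mass_limits critical_time_cases by auto
qed

end
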